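(* Let $6/5<\gamma<2$ and let $\Omega$ be a real analytic function on a neighborhood of $[0,+\infty)$ with $\Omega(0)=1$. Then there exists a number $\epsilon_0$ with $0<\epsilon_0\le 1$, depending only on $\gamma$ and the function $\Omega$, such that the following holds for all positive constants $c,G,A,\Lambda,\rho_c$ for which the equation of state $P(\rho)=A\rho^{\gamma}\Omega(A\rho^{\gamma-1}/c^2)$ satisfies the standing assumption on the pressure. Put $$u_c:=\int_0^{\rho_c}\frac{P'(\rho)\,d\rho}{\rho+P(\rho)/c^2}.$$ If $$u_c\le c^2\epsilon_0,\qquad \Lambda\le\frac{4\pi}{c^2}G\Big(\frac{\gamma-1}{\gamma A}\Big)^{\frac1{\gamma-1}}(u_c)^{\frac1{\gamma-1}}\epsilon_0,$$ then the prolongation to the right of the solution germ with central density $\rho_c$ of the Tolman-Oppenheimer-Volkoff-de Sitter equation is monotone-short.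
   Context: Constants: $c>0$, $G>0$, $\Lambda>0$. Standing assumption on the pressure: $P$ is a given function of the density $\rho>0$ with $P>0$ and $0<dP/d\rho<c^2$ for $\rho>0$, and $P\to0$ as $\rho\to+0$; moreover $P=A\rho^{\gamma}\Omega(A\rho^{\gamma-1}/c^2)$ with positive constants $A,\gamma$, $1<\gamma<2$, and $\Omega$ real analytic on a neighborhood of $[0,+\infty)$ with $\Omega(0)=1$. Since $P$ is strictly increasing in $\rho$, $\rho$ is regarded as a function of $P$. Notation: $\kappa(r,m):=1-\frac{2Gm}{c^2r}-\frac{\Lambda}{3}r^2$ and $Q(r,m,P):=G\big(m+\frac{4\pi r^3}{c^2}P\big)-\frac{c^2\Lambda}{3}r^3$. The Tolman-Oppenheimer-Volkoff-de Sitter equation is the system $$\frac{dm}{dr}=4\pi r^2\rho,\qquad \frac{dP}{dr}=-(\rho+P/c^2)\frac{Q(r,m,P)}{r^2\kappa(r,m)}$$ considered on the domain $\mathcal D=\{(r,m,P): 0<r,\ |m|<+\infty,\ 0<\rho,\ 0<\kappa(r,m)\}$. Solution germ: given a central density $\rho_c>0$, with $P_c:=P(\rho_c)$, the solution germ at $r=+0$ with central density $\rho_c$ is the solution with $$m=\frac{4\pi}{3}\rho_cr^3+O(r^5),\qquad P=P_c-(\rho_c+P_c/c^2)\big(4\pi G(\rho_c+3P_c/c^2)-c^2\Lambda\big)\frac{r^2}{6}+O(r^4)$$ as $r\to+0$. Its prolongation is its (unique) continuation to the right as long as possible as a solution in $\mathcal D$. Monotone-short: a solution $(m(r),P(r))$,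 $0<r<r_+$, is monotone-short if $r_+<\infty$, $dP/dr<0$ for $0<r<r_+$, $P\to0$ as $r\to r_+$, and $\kappa_+>0$, $Q_+>0$, where, with $m_+:=\lim_{r\to r_+-0}m(r)$, $$\kappa_+:=\lim_{r\to r_+-0}\kappa(r,m(r))=1-\frac{2Gm_+}{c^2r_+}-\frac{\Lambda}{3}r_+^2,\qquad Q_+:=\lim_{r\to r_+-0}Q(r,m(r),P(r))=Gm_+-\frac{c^2\Lambda}{3}r_+^3.$$ *)

theory Defs
  imports "HOL-Analysis.Analysis" "HOL-Library.Landau_Symbols"
begin

definition real_analytic_on :: "(real \<Rightarrow> real) \<Rightarrow> real set \<Rightarrow> bool" where
  "real_analytic_on f S \<longleftrightarrow> (\<forall>x\<in>S. \<exists>F. (\<lambda>h. f (x + h)) has_fps_expansion F)"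

text \<open>Throughout, \<open>Pf\<close> is the pressure as a function of the density, whereas \<open>p\<close> is a
  pressure value or a pressure profile.\<close>

definition admissible_pressure :: "real \<Rightarrow> (real \<Rightarrow> real) \<Rightarrow> bool" where
  "admissible_pressure c Pf \<longleftrightarrow>
     (\<forall>\<rho>>0. Pf \<rho> > 0 \<and> Pf differentiable (at \<rho>) \<and> 0 < deriv Pf \<rho> \<and> deriv Pf \<rho> < c\<^sup>2) \<and>
     (Pf \<longlongrightarrow> 0) (at_right 0)"

definition gas_pressure :: "real \<Rightarrow> real \<Rightarrow> real \<Rightarrow> (real \<Rightarrow> real) \<Rightarrow> real \<Rightarrow> real" where
  "gas_pressure c A \<gamma> \<Omega> \<rho> = A * \<rho> powr \<gamma> * \<Omega> (A * \<rho> powr (\<gamma> - 1) / c\<^sup>2)"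

text \<open>For admissible \<open>Pf\<close>, the density as a function of the pressure; it is meaningful only
  for arguments in \<open>Pf ` {0<..}\<close>.\<close>

definition density_of :: "(real \<Rightarrow> real) \<Rightarrow> real \<Rightarrow> real" where
  "density_of Pf = the_inv_into {0<..} Pf"

text \<open>The gauge integral covers the singularity of the integrand at \<open>0\<close>, which for
  \<open>gas_pressure\<close> is of order \<open>\<rho> powr (\<gamma> - 2)\<close> with \<open>\<gamma> > 1\<close> and hence integrable.\<close>

definition central_potential :: "real \<Rightarrow> (real \<Rightarrow> real) \<Rightarrow> real \<Rightarrow> real" where
  "central_potential c Pf \<rho>c = integral {0..\<rho>c} (\<lambda>\<rho>. deriv Pf \<rho> / (\<rho> + Pf \<rho> / c\<^sup>2))"

definition kappa :: "real \<Rightarrow> real \<Rightarrow> real \<Rightarrow> real \<Rightarrow> real \<Rightarrow> real" where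
  "kappa c G \<Lambda> r m = 1 - 2 * G * m / (c\<^sup>2 * r) - \<Lambda> / 3 * r\<^sup>2"

definition tov_Q :: "real \<Rightarrow> real \<Rightarrow> real \<Rightarrow> real \<Rightarrow> real \<Rightarrow> real \<Rightarrow> real" where
  "tov_Q c G \<Lambda> r m p = G * (m + 4 * pi * r ^ 3 / c\<^sup>2 * p) - c\<^sup>2 * \<Lambda> / 3 * r ^ 3"

text \<open>Membership of \<open>p\<close> in \<open>Pf ` {0<..}\<close> expresses that \<open>p\<close> is the pressure at some
  density \<open>\<rho> > 0\<close>.\<close>

definition tov_domain ::
    "real \<Rightarrow> real \<Rightarrow> real \<Rightarrow> (real \<Rightarrow> real) \<Rightarrow> (real \<times> real \<times> real) set" where
  "tov_domain c G \<Lambda> Pf = {(r, m, p). 0 < r \<and> p \<in> Pf ` {0<..} \<and> 0 < kappa c G \<Lambda> r m}"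

text \<open>A solution on \<open>0 < r < R\<close>, where \<open>R\<close> may be infinite; the values of \<open>m\<close> and \<open>p\<close>
  outside this interval are irrelevant.\<close>

definition tov_solution :: "real \<Rightarrow> real \<Rightarrow> real \<Rightarrow> (real \<Rightarrow> real) \<Rightarrow>
    ereal \<Rightarrow> (real \<Rightarrow> real) \<Rightarrow> (real \<Rightarrow> real) \<Rightarrow> bool" where
  "tov_solution c G \<Lambda> Pf R m p \<longleftrightarrow>
     (\<forall>r. 0 < r \<and> ereal r < R \<longrightarrow>
        (r, m r, p r) \<in> tov_domain c G \<Lambda> Pf \<and>
        (m has_real_derivative 4 * pi * r\<^sup>2 * density_of Pf (p r)) (at r) \<and>
        (p has_real_derivative
           - (density_of Pf (p r) + p r / c\<^sup>2) *
             (tov_Q c G \<Lambda> r (m r) (p r) / (r\<^sup>2 * kappa c G \<Lambda> r (m r)))) (at r))"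

definition tov_central_expansion :: "real \<Rightarrow> real \<Rightarrow> real \<Rightarrow> (real \<Rightarrow> real) \<Rightarrow> real \<Rightarrow>
    (real \<Rightarrow> real) \<Rightarrow> (real \<Rightarrow> real) \<Rightarrow> bool" where
  "tov_central_expansion c G \<Lambda> Pf \<rho>c m p \<longleftrightarrow>
     (\<lambda>r. m r - 4 * pi / 3 * \<rho>c * r ^ 3) \<in> O[at_right 0](\<lambda>r. r ^ 5) \<and>
     (\<lambda>r. p r - (Pf \<rho>c - (\<rho>c + Pf \<rho>c / c\<^sup>2) *
                   (4 * pi * G * (\<rho>c + 3 * Pf \<rho>c / c\<^sup>2) - c\<^sup>2 * \<Lambda>) * r\<^sup>2 / 6))
       \<in> O[at_right 0](\<lambda>r. r ^ 4)"

definition tov_prolongation :: "real \<Rightarrow> real \<Rightarrow> real \<Rightarrow> (real \<Rightarrow> real) \<Rightarrow> real \<Rightarrow>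
    ereal \<Rightarrow> (real \<Rightarrow> real) \<Rightarrow> (real \<Rightarrow> real) \<Rightarrow> bool" where
  "tov_prolongation c G \<Lambda> Pf \<rho>c R m p \<longleftrightarrow>
     0 < R \<and> tov_solution c G \<Lambda> Pf R m p \<and> tov_central_expansion c G \<Lambda> Pf \<rho>c m p \<and>
     (\<forall>R' m' p'. R \<le> R' \<and> tov_solution c G \<Lambda> Pf R' m' p' \<and>
        (\<forall>r. 0 < r \<and> ereal r < R \<longrightarrow> m' r = m r \<and> p' r = p r) \<longrightarrow> R' = R)"

definition monotone_short :: "real \<Rightarrow> real \<Rightarrow> real \<Rightarrow>
    ereal \<Rightarrow> (real \<Rightarrow> real) \<Rightarrow> (real \<Rightarrow> real) \<Rightarrow> bool" where
  "monotone_short c G \<Lambda> R m p \<longleftrightarrow>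
     (\<exists>rp mp \<kappa>p Qp. R = ereal rp \<and>
        (\<forall>r. 0 < r \<and> r < rp \<longrightarrow> deriv p r < 0) \<and>
        (p \<longlongrightarrow> 0) (at_left rp) \<and>
        (m \<longlongrightarrow> mp) (at_left rp) \<and>
        ((\<lambda>r. kappa c G \<Lambda> r (m r)) \<longlongrightarrow> \<kappa>p) (at_left rp) \<and>
        ((\<lambda>r. tov_Q c G \<Lambda> r (m r) (p r)) \<longlongrightarrow> Qp) (at_left rp) \<and>
        0 < \<kappa>p \<and> 0 < Qp)"

end

theory Submission imports Defs
begin

text \<open>The unknown $x = A\rho^{\gamma-1}/c^2$ is used instead of the potential $u$: then
  $\rho = (c^2x/A)^n$ with $n = 1/(\gamma-1) \in (1,5)$ holds exactly, and only the behaviour of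
  $\Omega$ near $0$ matters. Writing $x = x_c\theta$ and scaling the radius, the system becomes a
  Volterra equation
  $\theta(\xi) = 1 - \int_0^\xi K(s, w(s), \theta(s))\,ds$ with
  $w(\xi) = \xi^{-3}\int_0^\xi s^2\theta(s)^n\,ds$, whose kernel differs from the Lane-Emden kernel
  $s\,w$ by $O(\epsilon)$ when $x_c$ and $c^2\Lambda/(4\pi G\rho_c)$ are at most $\epsilon$.
  A Picard iteration in an exponentially weighted norm gives existence, uniqueness and stability
  at once.

  For $n < 5$ the Pohozaev functional of a Lane-Emden solution is increasing, hence bounded below,
  whereas positivity on a long interval forces it to be small; so the Lane-Emden solution becomes
  negative at a point depending on $n$ only, and by stability so does the perturbed one. The mean density
  $w$ has a uniform positive lower bound there, which keeps $Q$ positive and makes $\theta$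
  decrease until its first zero. The resulting solution cannot be prolonged because $P$ tends to
  $0$, and every solution with the same germ coincides with it by uniqueness.\<close>

section \<open>Real functions\<close>

text \<open>The range 6/5 < \<gamma> < 2 is exactly 1 < n < 5. The lower bound on n keeps
  \<open>t powr n\<close> Lipschitz at t = 0, where the density vanishes, so the surface is an
  ordinary point of the Volterra equation and the profile can be continued past it. Being negative
  at a fixed X beyond the surface is an open condition, which survives a perturbation. The upper
  bound on n acts twice: it makes the coefficient 3/(n+1) - 1/2 in the Pohozaev identity positive
  and the exponent 1 - 4/(n-1) in the opposing estimate negative.

  The obstacle is uniformity: the final bound must not depend on c, G, A, \<Lambda> or the central
  density. After scaling these enter only through \<open>xc\<close> and \<open>\<beta>\<close>, and
  the perturbed profile is treated as an approximate solution of the Lane-Emden equation, so all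
  constants come from n, X, \<open>x\<^sub>0\<close> and \<open>L\<^sub>0\<close>. The hypotheses
  reach \<open>xc\<close> and \<open>\<beta>\<close> because, for small x, the potential is c^2 * (n
  + 1) times a quantity between x/2 and 2x.\<close>

lemma real_analytic_imp_C2:
  assumes "real_analytic_on f U" "x \<in> U"
  obtains d f1 f2 where "d > 0"
    "\<And>y. \<bar>y - x\<bar> < d \<Longrightarrow> (f has_real_derivative f1 y) (at y)"
    "\<And>y. \<bar>y - x\<bar> < d \<Longrightarrow> (f1 has_real_derivative f2 y) (at y)"
    "continuous_on {x - d<..<x + d} f2"
proof -
  obtain F where F: "(\<lambda>h. f (x + h)) has_fps_expansion F"
    using assms unfolding real_analytic_on_def by blast
  then have pos: "fps_conv_radius F > 0" 
    and ev: "eventually (\<lambda>z. eval_fps F z = f (x + z)) (nhds 0)"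
    by (auto simp: has_fps_expansion_def)
  from ev obtain e where e: "e > 0" "\<And>z. \<bar>z\<bar> < e \<Longrightarrow> eval_fps F z = f (x + z)"
    unfolding eventually_nhds_metric by (auto simp: dist_real_def)
  obtain r where r: "r > 0" "ereal r < fps_conv_radius F"
    using pos by (metis dual_order.strict_trans ereal_dense2 ereal_less(2))
  define d where "d = min e r"
  have d: "d > 0" using e r by (auto simp: d_def)
  have ball: "ereal (norm z) < fps_conv_radius F" if "\<bar>z\<bar> < d" for z
    using that r(2) by (auto simp: d_def intro: less_trans[of "ereal \<bar>z\<bar>" "ereal r"])
  have rad1: "fps_conv_radius (fps_deriv F) \<ge> fps_conv_radius F" by (rule fps_conv_radius_deriv)
  have rad2: "fps_conv_radius (fps_deriv (fps_deriv F)) \<ge> fps_conv_radius F"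
    using fps_conv_radius_deriv order_trans rad1 by blast
  have ball1: "ereal (norm z) < fps_conv_radius (fps_deriv F)"
    and ball2: "ereal (norm z) < fps_conv_radius (fps_deriv (fps_deriv F))" if "\<bar>z\<bar> < d" for z
    using ball[OF that] rad1 rad2 by auto
  show ?thesis
  proof (rule that[of d "\<lambda>y. eval_fps (fps_deriv F) (y - x)" "\<lambda>y. eval_fps (fps_deriv (fps_deriv F)) (y - x)"])
    show "d > 0" by (rule d)
    fix y assume y: "\<bar>y - x\<bar> < d"
    have D: "((\<lambda>y. eval_fps F (y - x)) has_real_derivative eval_fps (fps_deriv F) (y - x)) (at y)"
      using has_field_derivative_eval_fps[OF ball[OF y], of UNIV] DERIV_shift[of "eval_fps F" _ y "- x"] by simp
    have "eventually (\<lambda>z. z \<in> {x - d<..<x + d}) (nhds y)"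
      by (intro eventually_nhds_in_open) (use y in auto)
    then have "eventually (\<lambda>z. eval_fps F (z - x) = f z) (nhds y)"
    proof eventually_elim
      case (elim z)
      then show ?case using e(2)[of "z - x"] by (auto simp: d_def)
    qed
    then show "(f has_real_derivative eval_fps (fps_deriv F) (y - x)) (at y)"
      using D by (rule DERIV_cong_ev[OF refl _ refl, THEN iffD1])
    show "((\<lambda>y. eval_fps (fps_deriv F) (y - x)) has_real_derivative eval_fps (fps_deriv (fps_deriv F)) (y - x)) (at y)"
      using has_field_derivative_eval_fps[OF ball1[OF y], of UNIV] DERIV_shift[of "eval_fps (fps_deriv F)" _ y "- x"]
      by simp
  next
    show "continuous_on {x - d<..<x + d} (\<lambda>y. eval_fps (fps_deriv (fps_deriv F)) (y - x))"
      by (rule continuous_on_compose2[OF continuous_on_eval_fps])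
        (use ball2 in \<open>auto intro!: continuous_intros simp: in_eball_iff\<close>)
  qed
qed

lemma C1_imp_lipschitz:
  fixes g g' :: "real \<Rightarrow> real"
  assumes "\<And>x. x \<in> {a..b} \<Longrightarrow> (g has_real_derivative g' x) (at x)"
    and "continuous_on {a..b} g'"
  obtains L where "L \<ge> 0" "\<And>x y. x \<in> {a..b} \<Longrightarrow> y \<in> {a..b} \<Longrightarrow> \<bar>g x - g y\<bar> \<le> L * \<bar>x - y\<bar>"
proof -
  have "bounded (g' ` {a..b})"
    by (rule compact_imp_bounded[OF compact_continuous_image[OF assms(2)]]) simp
  then obtain L where L: "L > 0" "\<And>x. x \<in> {a..b} \<Longrightarrow> \<bar>g' x\<bar> \<le> L"
    unfolding bounded_pos by auto
  show ?thesis
  proof (rule that[of L])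
    show "\<bar>g x - g y\<bar> \<le> L * \<bar>x - y\<bar>" if "x \<in> {a..b}" "y \<in> {a..b}" for x y
      using field_differentiable_bound[of "{a..b}" g g' L x y] assms(1) L that
      by (auto intro: has_field_derivative_at_within simp: abs_minus_commute)
  qed (use L in auto)
qed

lemma bigo_O_at_right_0I:
  fixes f g :: "real \<Rightarrow> real"
  assumes "0 < d" "\<And>r. 0 < r \<Longrightarrow> r < d \<Longrightarrow> \<bar>f r\<bar> \<le> C * r ^ k"
  shows "f \<in> O[at_right 0](\<lambda>r. r ^ k)"
proof (rule bigoI[of _ C])
  show "eventually (\<lambda>r. norm (f r) \<le> C * norm (r ^ k)) (at_right 0)"
    unfolding eventually_at_right_field using assms by (intro exI[of _ d]) auto
qed

text \<open>The factors are exchanged one at a time from the left. Each difference is then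
  multiplied by factors of the second product on its left and of the first product on its right, and
  these are the ones that carry bounds. The kernel \<open>rate\<close> is estimated as such a triple
  product.\<close>

lemma product3_diff:
  fixes a b c a' b' c' A B C :: real
  assumes "\<bar>b\<bar> \<le> B" "\<bar>c\<bar> \<le> C" "\<bar>a'\<bar> \<le> A" "\<bar>b'\<bar> \<le> B"
  shows "\<bar>a * b * c - a' * b' * c'\<bar> \<le> \<bar>a - a'\<bar> * (B * C) + A * \<bar>b - b'\<bar> * C + A * B * \<bar>c - c'\<bar>"
proof -
  have "a * b * c - a' * b' * c' = (a - a') * (b * c) + a' * (b - b') * c + a' * b' * (c - c')"
    by (simp add: algebra_simps)
  then have "\<bar>a * b * c - a' * b' * c'\<bar> \<le> \<bar>a - a'\<bar> * (\<bar>b\<bar> * \<bar>c\<bar>) + \<bar>a'\<bar> * \<bar>b - b'\<bar> * \<bar>c\<bar> + \<bar>a'\<bar> * \<bar>b'\<bar> * \<bar>c - c'\<bar>"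
    using abs_triangle_ineq[of "(a - a') * (b * c) + a' * (b - b') * c" "a' * b' * (c - c')"]
      abs_triangle_ineq[of "(a - a') * (b * c)" "a' * (b - b') * c"] by (simp add: abs_mult)
  also have "\<dots> \<le> \<bar>a - a'\<bar> * (B * C) + A * \<bar>b - b'\<bar> * C + A * B * \<bar>c - c'\<bar>"
    using assms by (intro add_mono mult_mono order_refl) auto
  finally show ?thesis .
qed

section \<open>Volterra equations with averaged arguments\<close>

text \<open>Truncation makes the scaled equations globally Lipschitz. The solutions of interest
  stay below \<open>1\<close>; the margin up to \<open>2\<close> serves the uniqueness argument.\<close>

definition trunc :: "real \<Rightarrow> real" where "trunc t = max 0 (min 2 t)"

lemma trunc_range: "0 \<le> trunc t" "trunc t \<le> 2"
  and trunc_id: "0 \<le> t \<Longrightarrow> t \<le> 2 \<Longrightarrow> trunc t = t"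
  and trunc_lipschitz: "\<bar>trunc s - trunc t\<bar> \<le> \<bar>s - t\<bar>"
  by (auto simp: trunc_def)

lemma continuous_on_trunc [continuous_intros]:
  "continuous_on S f \<Longrightarrow> continuous_on S (\<lambda>x. trunc (f x))"
  unfolding trunc_def by (intro continuous_intros)

text \<open>Because n \<ge> 1, the derivative n * z powr (n - 1) stays bounded down to 0. The mean
  value theorem asks for differentiability in the interior only, so the endpoint 0 is
  allowed.\<close>

lemma powr_lipschitz:
  fixes n :: real
  assumes "n \<ge> 1" "0 \<le> x" "x \<le> 2" "0 \<le> y" "y \<le> 2"
  shows "\<bar>x powr n - y powr n\<bar> \<le> n * 2 powr n * \<bar>x - y\<bar>"
proof -
  have *: "\<bar>x powr n - y powr n\<bar> \<le> n * 2 powr n * \<bar>x - y\<bar>" if xy: "0 \<le> x" "x < y" "y \<le> 2" for x y :: real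
  proof -
    obtain z where z: "x < z" "z < y" "y powr n - x powr n = (y - x) * (n * z powr (n - 1))"
    proof -
      have "\<exists>l z. x < z \<and> z < y \<and> DERIV (\<lambda>z. z powr n) z :> l \<and> y powr n - x powr n = (y - x) * l"
      proof (rule MVT)
        show "continuous_on {x..y} (\<lambda>z. z powr n)"
          using xy assms(1) by (intro continuous_on_powr' continuous_on_id continuous_on_const) auto
        show "(\<lambda>z. z powr n) differentiable (at z)" if "x < z" "z < y" for z
          using that xy has_real_derivative_powr[of z n] unfolding real_differentiable_def by auto
      qed (use xy in auto)
      then obtain l z where "x < z" "z < y" and D: "DERIV (\<lambda>z. z powr n) z :> l"
        and eq: "y powr n - x powr n = (y - x) * l" by blast
      moreover have "l = n * z powr (n - 1)"
        using DERIV_unique[OF D has_real_derivative_powr] \<open>x < z\<close> xy by auto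
      ultimately show ?thesis using that by blast
    qed
    have "z powr (n - 1) \<le> 2 powr (n - 1)" using z that assms by (intro powr_mono2) auto
    also have "\<dots> \<le> 2 powr n" by (intro powr_mono) auto
    finally have "n * z powr (n - 1) \<le> n * 2 powr n" using assms by (intro mult_left_mono) auto
    moreover have "0 \<le> n * z powr (n - 1)" using assms by auto
    ultimately show ?thesis
      using z that by (auto simp: abs_mult abs_minus_commute[of "x powr n"] mult.commute[of "y - x"] intro!: mult_right_mono)
  qed
  show ?thesis using *[of x y] *[of y x] assms by (cases x y rule: linorder_cases) (auto simp: abs_minus_commute)
qed

lemma has_integral_square: "a \<ge> 0 \<Longrightarrow> ((\<lambda>t. t\<^sup>2) has_integral (a ^ 3 / 3 :: real)) {0..a}"
proof -
  assume "a \<ge> 0"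
  have "((\<lambda>t. t\<^sup>2) has_integral (a ^ 3 / 3 - 0 ^ 3 / 3)) {0..a}"
    by (rule fundamental_theorem_of_calculus)
      (use \<open>a \<ge> 0\<close> in \<open>auto intro!: derivative_eq_intros simp: has_real_derivative_iff_has_vector_derivative[symmetric]\<close>)
  then show ?thesis by simp
qed

text \<open>For $\xi > 0$ this is $\xi^{-3}\int_0^\xi s^2 \theta(s)^n\,ds$, with the singularity at
  $\xi = 0$ removed by the substitution $s = \xi t$.\<close>

definition avg :: "real \<Rightarrow> (real \<Rightarrow> real) \<Rightarrow> real \<Rightarrow> real" where
  "avg n \<theta> \<xi> = integral {0..1} (\<lambda>t. t\<^sup>2 * trunc (\<theta> (\<xi> * t)) powr n)"

section \<open>The averaged density and the enclosed mass\<close>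

context
  fixes n X :: real
  assumes n: "n \<ge> 1"
begin

lemma continuous_on_trunc_powr:
  "continuous_on S f \<Longrightarrow> continuous_on S (\<lambda>x. trunc (f x) powr n)"
  using n trunc_range by (intro continuous_on_powr' continuous_intros) auto

lemma trunc_powr_bounds: "0 \<le> trunc t powr n" "trunc t powr n \<le> 2 powr n"
  using n trunc_range by (auto intro!: powr_mono2)

lemma avg_integrand_cont:
  assumes "continuous_on {0..X} \<theta>" "\<xi> \<in> {0..X}"
  shows "continuous_on {0..1} (\<lambda>t. t\<^sup>2 * trunc (\<theta> (\<xi> * t)) powr n)"
proof (intro continuous_on_mult continuous_on_power continuous_on_id continuous_on_const
      continuous_on_trunc_powr continuous_on_compose2[OF assms(1)])
  show "(*) \<xi> ` {0..1} \<subseteq> {0..X}"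
    using assms(2) by (auto intro: order_trans[OF mult_left_le])
qed

lemma continuous_on_avg:
  assumes "continuous_on {0..X} \<theta>"
  shows "continuous_on {0..X} (avg n \<theta>)"
proof -
  have "continuous_on ({0..X} \<times> cbox 0 1) (\<lambda>(x, t). t\<^sup>2 * trunc (\<theta> (x * t)) powr n)"
    unfolding split_beta
  proof (intro continuous_on_mult continuous_on_power continuous_on_fst continuous_on_snd continuous_on_id
        continuous_on_trunc_powr continuous_on_compose2[OF assms(1)])
    show "(\<lambda>p. fst p * snd p) ` ({0..X} \<times> cbox 0 1) \<subseteq> {0..X}"
      by (auto intro: order_trans[OF mult_left_le])
  qed
  from integral_continuous_on_param[OF this] show ?thesis
    unfolding avg_def[abs_def] by simp
qed

text \<open>The weight t^2 has total mass 1/3 on [0, 1], so three times \<open>avg\<close> is a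
  weighted mean of the truncated density over [0, \<xi>].\<close>

lemma avg_between:
  assumes "continuous_on {0..X} \<theta>" "\<xi> \<in> {0..X}"
    and "\<And>s. s \<in> {0..\<xi>} \<Longrightarrow> a \<le> trunc (\<theta> s) powr n \<and> trunc (\<theta> s) powr n \<le> b"
  shows "a / 3 \<le> avg n \<theta> \<xi>" "avg n \<theta> \<xi> \<le> b / 3"
proof -
  have int: "((\<lambda>t. t\<^sup>2 * trunc (\<theta> (\<xi> * t)) powr n) has_integral avg n \<theta> \<xi>) {0..1}"
    unfolding avg_def by (rule integrable_integral[OF integrable_continuous_real[OF avg_integrand_cont[OF assms(1,2)]]])
  have c: "((\<lambda>t. t\<^sup>2 * k) has_integral k / 3) {0..1}" for k :: real
    using has_integral_mult_left[OF has_integral_square[of 1], of k] by simp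
  have *: "a \<le> trunc (\<theta> (\<xi> * t)) powr n \<and> trunc (\<theta> (\<xi> * t)) powr n \<le> b" if "t \<in> {0..1}" for t
    using that assms(2) by (intro assms(3)) (auto intro: mult_left_le)
  show "a / 3 \<le> avg n \<theta> \<xi>" using * by (intro has_integral_le[OF c int] mult_left_mono) auto
  show "avg n \<theta> \<xi> \<le> b / 3" using * by (intro has_integral_le[OF int c] mult_left_mono) auto
qed

lemma avg_bounds:
  assumes "continuous_on {0..X} \<theta>" "\<xi> \<in> {0..X}"
  shows "0 \<le> avg n \<theta> \<xi>" "avg n \<theta> \<xi> \<le> 2 powr n"
  using avg_between[OF assms, of 0 "2 powr n"] trunc_powr_bounds by (auto intro: order_trans)

lemma avg_diff:
  assumes "continuous_on {0..X} \<theta>\<^sub>1" "continuous_on {0..X} \<theta>\<^sub>2" "\<xi> \<in> {0..X}"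
    and close: "\<And>t. t \<in> {0..\<xi>} \<Longrightarrow> \<bar>\<theta>\<^sub>1 t - \<theta>\<^sub>2 t\<bar> \<le> e"
  shows "\<bar>avg n \<theta>\<^sub>1 \<xi> - avg n \<theta>\<^sub>2 \<xi>\<bar> \<le> n * 2 powr n * e"
proof -
  have int: "(\<lambda>t. t\<^sup>2 * trunc (\<theta>\<^sub>i (\<xi> * t)) powr n) integrable_on {0..1}" if "continuous_on {0..X} \<theta>\<^sub>i" for \<theta>\<^sub>i
    by (rule integrable_continuous_real[OF avg_integrand_cont[OF that assms(3)]])
  have "\<bar>avg n \<theta>\<^sub>1 \<xi> - avg n \<theta>\<^sub>2 \<xi>\<bar> = norm (integral {0..1}
      (\<lambda>t. t\<^sup>2 * trunc (\<theta>\<^sub>1 (\<xi> * t)) powr n - t\<^sup>2 * trunc (\<theta>\<^sub>2 (\<xi> * t)) powr n))"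
    unfolding avg_def using int assms by (subst integral_diff) auto
  also have "\<dots> \<le> integral {0..1} (\<lambda>t::real. n * 2 powr n * e)"
  proof (rule integral_norm_bound_integral)
    fix t :: real assume t: "t \<in> {0..1}"
    have "\<xi> * t \<in> {0..\<xi>}" using t assms(3) by (auto intro: mult_left_le)
    note c = close[OF this]
    have "\<bar>trunc (\<theta>\<^sub>1 (\<xi> * t)) powr n - trunc (\<theta>\<^sub>2 (\<xi> * t)) powr n\<bar>
        \<le> n * 2 powr n * \<bar>trunc (\<theta>\<^sub>1 (\<xi> * t)) - trunc (\<theta>\<^sub>2 (\<xi> * t))\<bar>"
      by (rule powr_lipschitz) (auto simp: trunc_range n)
    also have "\<dots> \<le> n * 2 powr n * e"
      by (rule mult_left_mono) (use n order_trans[OF trunc_lipschitz c] in auto)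
    finally have "\<bar>trunc (\<theta>\<^sub>1 (\<xi> * t)) powr n - trunc (\<theta>\<^sub>2 (\<xi> * t)) powr n\<bar> \<le> n * 2 powr n * e" .
    then have "\<bar>t\<^sup>2\<bar> * \<bar>trunc (\<theta>\<^sub>1 (\<xi> * t)) powr n - trunc (\<theta>\<^sub>2 (\<xi> * t)) powr n\<bar> \<le> 1 * (n * 2 powr n * e)"
      by (intro mult_mono) (use t in \<open>auto intro: power_le_one\<close>)
    then show "norm (t\<^sup>2 * trunc (\<theta>\<^sub>1 (\<xi> * t)) powr n - t\<^sup>2 * trunc (\<theta>\<^sub>2 (\<xi> * t)) powr n) \<le> n * 2 powr n * e"
      by (simp add: abs_mult right_diff_distrib[symmetric])
  qed (use int assms in \<open>auto intro!: integrable_diff\<close>)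
  finally show ?thesis by simp
qed

text \<open>Undoing the substitution s = \<xi> * t identifies the enclosed mass. This form can be
  differentiated in \<xi>, whereas the integrand of \<open>avg\<close> contains
  \<open>\<theta>\<close> at moving arguments.\<close>

lemma avg_mass:
  assumes "continuous_on {0..X} \<theta>" "\<xi> \<in> {0..X}"
  shows "\<xi> ^ 3 * avg n \<theta> \<xi> = integral {0..\<xi>} (\<lambda>s. s\<^sup>2 * trunc (\<theta> s) powr n)"
proof (cases "\<xi> = 0")
  case False
  then have pos: "\<xi> > 0" using assms by auto
  have "continuous_on {0..\<xi>} (\<lambda>s. s\<^sup>2 * trunc (\<theta> s) powr n)"
    by (intro continuous_on_mult continuous_on_power continuous_on_id continuous_on_trunc_powr
        continuous_on_subset[OF assms(1)]) (use assms in auto)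
  then have "((\<lambda>s. s\<^sup>2 * trunc (\<theta> s) powr n) has_integral integral {0..\<xi>} (\<lambda>s. s\<^sup>2 * trunc (\<theta> s) powr n)) (cbox 0 \<xi>)"
    by (simp add: integrable_integral integrable_continuous_real)
  from has_integral_affinity[OF this, of \<xi> 0] pos
  have "((\<lambda>t. (\<xi> * t)\<^sup>2 * trunc (\<theta> (\<xi> * t)) powr n) has_integral
      inverse \<xi> * integral {0..\<xi>} (\<lambda>s. s\<^sup>2 * trunc (\<theta> s) powr n)) {0..1}"
    by (simp add: image_mult_atLeastAtMost_if inverse_eq_divide)
  then have "((\<lambda>t. \<xi>\<^sup>2 * (t\<^sup>2 * trunc (\<theta> (\<xi> * t)) powr n)) has_integral
      inverse \<xi> * integral {0..\<xi>} (\<lambda>s. s\<^sup>2 * trunc (\<theta> s) powr n)) {0..1}"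
    by (simp add: power_mult_distrib mult.assoc)
  from integral_unique[OF this]
  have "\<xi>\<^sup>2 * avg n \<theta> \<xi> = inverse \<xi> * integral {0..\<xi>} (\<lambda>s. s\<^sup>2 * trunc (\<theta> s) powr n)"
    by (simp add: avg_def)
  then have "\<xi> * (\<xi>\<^sup>2 * avg n \<theta> \<xi>) = integral {0..\<xi>} (\<lambda>s. s\<^sup>2 * trunc (\<theta> s) powr n)"
    using pos by (simp add: field_simps)
  then show ?thesis by (simp add: power3_eq_cube power2_eq_square mult.assoc)
qed simp

lemma avg_mass_deriv:
  assumes "continuous_on {0..X} \<theta>" "0 < \<xi>" "\<xi> < X"
  shows "((\<lambda>\<xi>. \<xi> ^ 3 * avg n \<theta> \<xi>) has_real_derivative \<xi>\<^sup>2 * trunc (\<theta> \<xi>) powr n) (at \<xi>)"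
proof -
  have c: "continuous_on {0..X} (\<lambda>s. s\<^sup>2 * trunc (\<theta> s) powr n)"
    by (intro continuous_on_mult continuous_on_power continuous_on_id continuous_on_trunc_powr assms)
  have "((\<lambda>\<xi>. integral {0..\<xi>} (\<lambda>s. s\<^sup>2 * trunc (\<theta> s) powr n)) has_real_derivative \<xi>\<^sup>2 * trunc (\<theta> \<xi>) powr n)
      (at \<xi> within {0..X})"
    using assms by (intro integral_has_real_derivative[OF c]) auto
  then have "((\<lambda>\<xi>. \<xi> ^ 3 * avg n \<theta> \<xi>) has_real_derivative \<xi>\<^sup>2 * trunc (\<theta> \<xi>) powr n) (at \<xi> within {0..X})"
    by (rule has_field_derivative_transform_within[of _ _ _ _ 1])
      (use assms in \<open>auto simp: avg_mass\<close>)
  then show ?thesis using at_within_Icc_at[of 0 \<xi> X] assms by simp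
qed

text \<open>For t \<le> \<tau> the argument \<xi> * t stays in the core [0, \<tau> * X] whatever
  \<xi> is. Control of the core alone therefore bounds \<open>avg\<close> from below uniformly up to
  X, even where \<open>\<theta>\<close> has become negative.\<close>

lemma avg_lower:
  assumes "continuous_on {0..X} \<theta>" "\<xi> \<in> {0..X}" "0 < \<tau>" "\<tau> \<le> 1"
    and low: "\<And>t. t \<in> {0..\<tau> * X} \<Longrightarrow> 1 / 2 \<le> \<theta> t"
  shows "(1 / 2) powr n * (\<tau> ^ 3 / 3) \<le> avg n \<theta> \<xi>"
proof -
  have int: "(\<lambda>t. t\<^sup>2 * trunc (\<theta> (\<xi> * t)) powr n) integrable_on {0..1}"
    by (rule integrable_continuous_real[OF avg_integrand_cont[OF assms(1,2)]])
  have int': "(\<lambda>t. t\<^sup>2 * trunc (\<theta> (\<xi> * t)) powr n) integrable_on {0..\<tau>}"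
    by (rule integrable_on_subinterval[OF int]) (use assms in auto)
  have I: "((\<lambda>t. (1 / 2) powr n * t\<^sup>2) has_integral ((1 / 2) powr n * (\<tau> ^ 3 / 3))) {0..\<tau>}"
    by (intro has_integral_mult_right has_integral_square) (use assms in auto)
  have "(1 / 2) powr n * (\<tau> ^ 3 / 3) \<le> integral {0..\<tau>} (\<lambda>t. t\<^sup>2 * trunc (\<theta> (\<xi> * t)) powr n)"
  proof (rule has_integral_le[OF I integrable_integral[OF int']])
    fix t assume t: "t \<in> {0..\<tau>}"
    have "\<xi> * t \<le> X * \<tau>" using t assms(2) by (intro mult_mono) auto
    then have "1 / 2 \<le> \<theta> (\<xi> * t)" using t assms(2) by (intro low) (auto simp: mult.commute)
    then have "1 / 2 \<le> trunc (\<theta> (\<xi> * t))" by (auto simp: trunc_def)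
    then have "(1 / 2) powr n \<le> trunc (\<theta> (\<xi> * t)) powr n" using n by (intro powr_mono2) auto
    from mult_left_mono[OF this, of "t\<^sup>2"]
    show "(1 / 2) powr n * t\<^sup>2 \<le> t\<^sup>2 * trunc (\<theta> (\<xi> * t)) powr n" by (simp add: mult.commute)
  qed
  also have "\<dots> \<le> avg n \<theta> \<xi>" unfolding avg_def
    by (rule integral_subset_le[OF _ int' int]) (use assms in \<open>auto intro!: mult_nonneg_nonneg trunc_powr_bounds\<close>)
  finally show ?thesis .
qed

end

text \<open>The arguments of \<open>K\<close> are a position, an average and a value. Averages range
  over [0, 2 powr n], where \<open>avg\<close> lies and where the denominator \<open>kap\<close> can
  be controlled; the value is unrestricted, which truncation inside the kernel makes possible.
  Continuity is required along curves, the form in which the integrands occur.\<close>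

locale volterra =
  fixes K :: "real \<Rightarrow> real \<Rightarrow> real \<Rightarrow> real" and X L n :: real
  assumes X: "X \<ge> 0" and n: "n \<ge> 1" and L: "L > 0"
    and K_cont: "\<And>S w \<theta>. S \<subseteq> {0..X} \<Longrightarrow> continuous_on S w \<Longrightarrow> continuous_on S \<theta> \<Longrightarrow>
      w ` S \<subseteq> {0..2 powr n} \<Longrightarrow> continuous_on S (\<lambda>s. K s (w s) (\<theta> s))"
    and K_lip: "\<And>s v w x y. s \<in> {0..X} \<Longrightarrow> v \<in> {0..2 powr n} \<Longrightarrow> w \<in> {0..2 powr n} \<Longrightarrow>
      \<bar>K s v x - K s w y\<bar> \<le> L * (\<bar>v - w\<bar> + \<bar>x - y\<bar>)"
begin

section \<open>Picard iteration in an exponentially weighted norm\<close>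

definition T :: "(real \<Rightarrow> real) \<Rightarrow> real \<Rightarrow> real" where
  "T \<theta> \<xi> = 1 - integral {0..\<xi>} (\<lambda>s. K s (avg n \<theta> s) (\<theta> s))"

text \<open>The integrand of \<open>T\<close> is Lipschitz with constant L * (n * 2 powr n + 1) in
  the sup norm over [0, s], and integrating exp (M * s) gains 1/M. Twice that constant gives the
  contraction factor 1/2.\<close>

definition M :: real where "M = 2 * (L * (n * 2 powr n + 1))"

lemma M_pos: "M > 0"
  using L n unfolding M_def by (intro mult_pos_pos add_nonneg_pos) auto

lemma integrand_cont:
  assumes "continuous_on {0..X} \<theta>"
  shows "continuous_on {0..X} (\<lambda>s. K s (avg n \<theta> s) (\<theta> s))"
  by (rule K_cont) (use avg_bounds[OF n assms] in \<open>auto intro: continuous_on_avg[OF n] assms\<close>)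

lemma T_deriv:
  assumes "continuous_on {0..X} \<theta>" "\<xi> \<in> {0..X}"
  shows "(T \<theta> has_real_derivative - K \<xi> (avg n \<theta> \<xi>) (\<theta> \<xi>)) (at \<xi> within {0..X})"
proof -
  have "((\<lambda>\<xi>. 1 - integral {0..\<xi>} (\<lambda>s. K s (avg n \<theta> s) (\<theta> s))) has_real_derivative
      0 - K \<xi> (avg n \<theta> \<xi>) (\<theta> \<xi>)) (at \<xi> within {0..X})"
    by (intro DERIV_diff DERIV_const integral_has_real_derivative integrand_cont assms)
  then show ?thesis unfolding T_def[abs_def] by simp
qed

lemma T_cont: "continuous_on {0..X} \<theta> \<Longrightarrow> continuous_on {0..X} (T \<theta>)"
  by (rule DERIV_continuous_on[OF T_deriv])

text \<open>This is a contraction for the supremum of |f t| * exp (- M * t), stated pointwise. As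
  the weight exp (M * t) increases, the bound at s also covers the earlier values seen by
  \<open>avg\<close>.\<close>

lemma T_contraction:
  assumes "continuous_on {0..X} \<theta>\<^sub>1" "continuous_on {0..X} \<theta>\<^sub>2" "m \<ge> 0"
    and close: "\<And>t. t \<in> {0..X} \<Longrightarrow> \<bar>\<theta>\<^sub>1 t - \<theta>\<^sub>2 t\<bar> \<le> m * exp (M * t)"
    and \<xi>: "\<xi> \<in> {0..X}"
  shows "\<bar>T \<theta>\<^sub>1 \<xi> - T \<theta>\<^sub>2 \<xi>\<bar> \<le> m * exp (M * \<xi>) / 2"
proof -
  have int: "(\<lambda>s. K s (avg n \<theta> s) (\<theta> s)) integrable_on {0..\<xi>}" if "continuous_on {0..X} \<theta>" for \<theta>
    by (rule integrable_continuous_real[OF continuous_on_subset[OF integrand_cont[OF that]]]) (use \<xi> in auto)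
  have "((\<lambda>s. m * M / 2 * exp (M * s)) has_integral (m * exp (M * \<xi>) / 2 - m * exp (M * 0) / 2)) {0..\<xi>}"
    by (rule fundamental_theorem_of_calculus)
      (use \<xi> in \<open>auto intro!: derivative_eq_intros simp: has_real_derivative_iff_has_vector_derivative[symmetric]\<close>)
  then have I: "((\<lambda>s. m * M / 2 * exp (M * s)) has_integral (m * exp (M * \<xi>) / 2 - m / 2)) {0..\<xi>}" by simp
  have "\<bar>T \<theta>\<^sub>1 \<xi> - T \<theta>\<^sub>2 \<xi>\<bar> = norm (integral {0..\<xi>} (\<lambda>s. K s (avg n \<theta>\<^sub>1 s) (\<theta>\<^sub>1 s) - K s (avg n \<theta>\<^sub>2 s) (\<theta>\<^sub>2 s)))"
    unfolding T_def using int assms by (subst integral_diff) auto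
  also have "\<dots> \<le> integral {0..\<xi>} (\<lambda>s. m * M / 2 * exp (M * s))"
  proof (rule integral_norm_bound_integral)
    fix s assume s: "s \<in> {0..\<xi>}"
    then have sX: "s \<in> {0..X}" using \<xi> by auto
    have A: "\<bar>avg n \<theta>\<^sub>1 s - avg n \<theta>\<^sub>2 s\<bar> \<le> n * 2 powr n * (m * exp (M * s))"
    proof (rule avg_diff[OF n assms(1,2) sX])
      fix t assume t: "t \<in> {0..s}"
      then have "\<bar>\<theta>\<^sub>1 t - \<theta>\<^sub>2 t\<bar> \<le> m * exp (M * t)" using sX by (intro close) auto
      also have "\<dots> \<le> m * exp (M * s)" using t M_pos \<open>m \<ge> 0\<close> by (intro mult_left_mono) auto
      finally show "\<bar>\<theta>\<^sub>1 t - \<theta>\<^sub>2 t\<bar> \<le> m * exp (M * s)" .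
    qed
    have "\<bar>K s (avg n \<theta>\<^sub>1 s) (\<theta>\<^sub>1 s) - K s (avg n \<theta>\<^sub>2 s) (\<theta>\<^sub>2 s)\<bar>
        \<le> L * (\<bar>avg n \<theta>\<^sub>1 s - avg n \<theta>\<^sub>2 s\<bar> + \<bar>\<theta>\<^sub>1 s - \<theta>\<^sub>2 s\<bar>)"
      using avg_bounds[OF n assms(1) sX] avg_bounds[OF n assms(2) sX] by (intro K_lip[OF sX]) auto
    also have "\<dots> \<le> L * (n * 2 powr n * (m * exp (M * s)) + m * exp (M * s))"
      by (intro mult_left_mono add_mono A close sX) (use L in auto)
    also have "\<dots> = m * M / 2 * exp (M * s)" by (simp add: M_def algebra_simps)
    finally show "norm (K s (avg n \<theta>\<^sub>1 s) (\<theta>\<^sub>1 s) - K s (avg n \<theta>\<^sub>2 s) (\<theta>\<^sub>2 s)) \<le> m * M / 2 * exp (M * s)"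
      by simp
  qed (use int assms I in \<open>auto intro!: integrable_diff\<close>)
  also have "\<dots> = m * exp (M * \<xi>) / 2 - m / 2" using I by (rule integral_unique)
  finally show ?thesis using \<open>m \<ge> 0\<close> by simp
qed

text \<open>The weighted difference attains its maximum, and there it is at most the defect plus
  half of itself. The case d = 0 is uniqueness; d > 0 measures how far an approximate solution is
  from the exact one.\<close>

lemma stability:
  assumes "continuous_on {0..X} \<theta>\<^sub>1" "continuous_on {0..X} \<theta>\<^sub>2"
    and defect: "\<And>\<xi>. \<xi> \<in> {0..X} \<Longrightarrow> \<bar>\<theta>\<^sub>1 \<xi> - T \<theta>\<^sub>1 \<xi>\<bar> \<le> d"
    and fixp: "\<And>\<xi>. \<xi> \<in> {0..X} \<Longrightarrow> \<theta>\<^sub>2 \<xi> = T \<theta>\<^sub>2 \<xi>"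
    and \<xi>: "\<xi> \<in> {0..X}"
  shows "\<bar>\<theta>\<^sub>1 \<xi> - \<theta>\<^sub>2 \<xi>\<bar> \<le> 2 * d * exp (M * X)"
proof -
  define D where "D t = exp (- M * t) * \<bar>\<theta>\<^sub>1 t - \<theta>\<^sub>2 t\<bar>" for t
  have "continuous_on {0..X} D" unfolding D_def by (intro continuous_intros assms)
  then have "\<exists>t\<in>{0..X}. \<forall>s\<in>{0..X}. D s \<le> D t"
    by (intro continuous_attains_sup) (use X in auto)
  then obtain t\<^sub>0 where t0: "t\<^sub>0 \<in> {0..X}" "\<And>t. t \<in> {0..X} \<Longrightarrow> D t \<le> D t\<^sub>0" by blast
  have De: "\<bar>\<theta>\<^sub>1 t - \<theta>\<^sub>2 t\<bar> = D t * exp (M * t)" for t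
    by (simp add: D_def exp_minus field_simps)
  have pos: "D t \<ge> 0" for t by (simp add: D_def)
  have d0: "d \<ge> 0" using defect[OF \<xi>] by linarith
  have "\<bar>T \<theta>\<^sub>1 t\<^sub>0 - T \<theta>\<^sub>2 t\<^sub>0\<bar> \<le> D t\<^sub>0 * exp (M * t\<^sub>0) / 2"
    by (rule T_contraction[OF assms(1,2) pos _ t0(1)]) (auto simp: De t0(2))
  then have "D t\<^sub>0 * exp (M * t\<^sub>0) \<le> d + D t\<^sub>0 * exp (M * t\<^sub>0) / 2"
    using defect[OF t0(1)] fixp[OF t0(1)] De[of t\<^sub>0] by linarith
  moreover have "1 * D t\<^sub>0 \<le> exp (M * t\<^sub>0) * D t\<^sub>0"
    using t0 M_pos pos by (intro mult_right_mono) auto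
  ultimately have le: "D t\<^sub>0 \<le> 2 * d" by (simp add: mult.commute)
  have "D \<xi> * exp (M * \<xi>) \<le> (2 * d) * exp (M * X)"
    using \<xi> M_pos d0 by (intro mult_mono order_trans[OF t0(2) le]) auto
  then show ?thesis using De by simp
qed

lemma fixed_point_exists:
  obtains \<theta> where "continuous_on {0..X} \<theta>" "\<And>\<xi>. \<xi> \<in> {0..X} \<Longrightarrow> \<theta> \<xi> = T \<theta> \<xi>"
proof -
  define F where "F k = (T ^^ k) (\<lambda>_. 1)" for k
  have FS: "F (Suc k) = T (F k)" for k by (simp add: F_def)
  have Fc: "continuous_on {0..X} (F k)" for k
  proof (induction k)
    case 0 show ?case by (simp add: F_def)
  qed (simp add: FS T_cont)
  have "bounded ((\<lambda>t. F 1 t - F 0 t) ` {0..X})"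
    by (intro compact_imp_bounded compact_continuous_image continuous_intros Fc) auto
  then obtain B where B: "B > 0" "\<And>t. t \<in> {0..X} \<Longrightarrow> \<bar>F 1 t - F 0 t\<bar> \<le> B"
    unfolding bounded_pos by auto
  have step: "\<bar>F (Suc k) t - F k t\<bar> \<le> B * (1 / 2) ^ k * exp (M * t)" if "t \<in> {0..X}" for k t
    using that
  proof (induction k arbitrary: t)
    case 0
    have "B * 1 \<le> B * exp (M * t)" using 0 B M_pos by (intro mult_left_mono) auto
    then show ?case using B(2)[OF 0] by simp
  next
    case (Suc k)
    have "\<bar>T (F (Suc k)) t - T (F k) t\<bar> \<le> B * (1 / 2) ^ k * exp (M * t) / 2"
      using B Suc.IH Suc.prems by (intro T_contraction Fc) auto
    then show ?case by (simp add: FS)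
  qed
  have step': "\<bar>F (Suc k) t - F k t\<bar> \<le> B * exp (M * X) * (1 / 2) ^ k" if "t \<in> {0..X}" for k t
  proof -
    have "B * (1 / 2) ^ k * exp (M * t) \<le> B * (1 / 2) ^ k * exp (M * X)"
      using that B M_pos by (intro mult_left_mono) auto
    then show ?thesis using step[OF that, of k] by (simp add: mult_ac)
  qed
  \<comment> \<open>The iterates are written as a telescoping series starting from the constant 1;
    \<open>step'\<close> supplies a geometric majorant for its terms.\<close>
  define \<theta> where "\<theta> t = 1 + (\<Sum>k. F (Suc k) t - F k t)" for t
  have "uniform_limit {0..X} (\<lambda>k t. \<Sum>i<k. F (Suc i) t - F i t) (\<lambda>t. \<Sum>i. F (Suc i) t - F i t) sequentially"
    by (rule Weierstrass_m_test[where M = "\<lambda>k. B * exp (M * X) * (1 / 2) ^ k"])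
      (use step' in \<open>auto intro!: summable_mult summable_geometric\<close>)
  then have "uniform_limit {0..X} (\<lambda>k t. 1 + (\<Sum>i<k. F (Suc i) t - F i t)) \<theta> sequentially"
    unfolding \<theta>_def by (intro uniform_limit_intros)
  moreover have "(\<lambda>k t. 1 + (\<Sum>i<k. F (Suc i) t - F i t)) = F"
  proof (intro ext)
    fix k t
    show "1 + (\<Sum>i<k. F (Suc i) t - F i t) = F k t"
      using sum_lessThan_telescope[of "\<lambda>i. F i t" k] by (simp add: F_def)
  qed
  ultimately have ul: "uniform_limit {0..X} F \<theta> sequentially" by simp
  have c: "continuous_on {0..X} \<theta>"
    by (rule uniform_limit_theorem[OF _ ul]) (auto simp: Fc)
  have "\<theta> \<xi> = T \<theta> \<xi>" if \<xi>: "\<xi> \<in> {0..X}" for \<xi>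
  proof -
    have l1: "(\<lambda>k. F (Suc k) \<xi>) \<longlonglongrightarrow> \<theta> \<xi>"
      using tendsto_uniform_limitI[OF ul \<xi>] by (rule LIMSEQ_Suc)
    have "(\<lambda>k. T (F k) \<xi>) \<longlonglongrightarrow> T \<theta> \<xi>"
    proof (rule LIMSEQ_I)
      fix r :: real assume r: "r > 0"
      \<comment> \<open>\<open>T_contraction\<close> doubles as continuity of \<open>T\<close> under
        uniform convergence; e is scaled so that the weight exp (M * X) turns it back into
        r.\<close>
      define e where "e = r / exp (M * X)"
      have e: "e > 0" using r by (simp add: e_def)
      from uniform_limitD[OF ul e] obtain N where
        N: "\<And>k t. k \<ge> N \<Longrightarrow> t \<in> {0..X} \<Longrightarrow> \<bar>F k t - \<theta> t\<bar> < e"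
        unfolding eventually_sequentially dist_real_def by blast
      have "norm (T (F k) \<xi> - T \<theta> \<xi>) < r" if "k \<ge> N" for k
      proof -
        have "\<bar>T (F k) \<xi> - T \<theta> \<xi>\<bar> \<le> e * exp (M * \<xi>) / 2"
        proof (rule T_contraction[OF Fc c _ _ \<xi>])
          fix t assume t: "t \<in> {0..X}"
          have "e * 1 \<le> e * exp (M * t)" using t e M_pos by (intro mult_left_mono) auto
          then show "\<bar>F k t - \<theta> t\<bar> \<le> e * exp (M * t)" using N[OF that t] by simp
        qed (use e in auto)
        also have "\<dots> \<le> e * exp (M * X) / 2" using \<xi> e M_pos by (intro divide_right_mono mult_left_mono) auto
        also have "\<dots> = r / 2" by (simp add: e_def)
        finally show ?thesis using r by simp
      qed
      then show "\<exists>N. \<forall>k\<ge>N. norm (T (F k) \<xi> - T \<theta> \<xi>) < r" by blast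
    qed
    then show ?thesis using l1 LIMSEQ_unique by (simp add: FS)
  qed
  with c show ?thesis using that by blast
qed

end

text \<open>A competing solution may exist only on a shorter interval [0, Y]; the comparison takes
  place there with the same constants.\<close>

lemma volterra_mono:
  assumes "volterra K X L n" "0 \<le> Y" "Y \<le> X"
  shows "volterra K Y L n"
proof -
  interpret volterra K X L n by fact
  have sub: "{0..Y} \<subseteq> {0..X}" using assms by auto
  show ?thesis
  proof
    show "continuous_on S (\<lambda>s. K s (w s) (\<theta> s))"
      if "S \<subseteq> {0..Y}" "continuous_on S w" "continuous_on S \<theta>" "w ` S \<subseteq> {0..2 powr n}" for S w \<theta>
      by (rule K_cont[OF order_trans[OF that(1) sub] that(2-4)])
    show "\<bar>K s v x - K s w y\<bar> \<le> L * (\<bar>v - w\<bar> + \<bar>x - y\<bar>)"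
      if "s \<in> {0..Y}" "v \<in> {0..2 powr n}" "w \<in> {0..2 powr n}" for s v w x y
      by (rule K_lip[OF subsetD[OF sub that(1)] that(2,3)])
  qed (fact assms n L)+
qed

section \<open>The Lane-Emden equation\<close>

lemma lane_emden_volterra:
  assumes "X \<ge> 0" "n \<ge> 1"
  shows "volterra (\<lambda>s w y. s * w) X (X + 1) n"
proof
  fix s v w x y :: real assume s: "s \<in> {0..X}"
  have "\<bar>s * v - s * w\<bar> = s * \<bar>v - w\<bar>" using s by (simp add: abs_mult right_diff_distrib[symmetric])
  also have "\<dots> \<le> (X + 1) * (\<bar>v - w\<bar> + \<bar>x - y\<bar>)" using s by (intro mult_mono) auto
  finally show "\<bar>s * v - s * w\<bar> \<le> (X + 1) * (\<bar>v - w\<bar> + \<bar>x - y\<bar>)" .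
qed (use assms in \<open>auto intro!: continuous_intros\<close>)

text \<open>Set up for a contradiction: a solution still nonnegative at X satisfies
  \<open>pohozaev_contra\<close>, which fails for large X. The bound X \<ge> 2 places the core
  [0, 1] inside [0, X/2].\<close>

locale lane_emden =
  fixes n X :: real and \<theta> :: "real \<Rightarrow> real"
  assumes n1: "1 < n" and n5: "n < 5" and X: "X \<ge> 2"
    and cont: "continuous_on {0..X} \<theta>"
    and eq: "\<And>\<xi>. \<xi> \<in> {0..X} \<Longrightarrow> \<theta> \<xi> = 1 - integral {0..\<xi>} (\<lambda>s. s * avg n \<theta> s)"
    and end_nonneg: "\<theta> X \<ge> 0"
begin

section \<open>Monotonicity and decay of a nonnegative Lane-Emden solution\<close>

definition \<mu> where "\<mu> \<xi> = \<xi> ^ 3 * avg n \<theta> \<xi>"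

lemma n_ge: "n \<ge> 1" using n1 by simp

lemma avg_cont: "continuous_on {0..X} (avg n \<theta>)"
  by (rule continuous_on_avg[OF n_ge cont])

lemma \<theta>_deriv:
  assumes "0 < \<xi>" "\<xi> < X"
  shows "(\<theta> has_real_derivative - (\<xi> * avg n \<theta> \<xi>)) (at \<xi>)"
proof -
  interpret volterra "\<lambda>s w y. s * w" X "X + 1" n
    using lane_emden_volterra n_ge X by simp
  have "(\<theta> has_real_derivative - (\<xi> * avg n \<theta> \<xi>)) (at \<xi> within {0..X})"
    by (rule has_field_derivative_transform_within[OF T_deriv[OF cont], of _ 1])
      (use assms in \<open>auto simp: T_def eq\<close>)
  then show ?thesis using at_within_Icc_at[of 0 \<xi> X] assms by simp
qed

lemma \<theta>_decreasing: "0 \<le> s \<Longrightarrow> s \<le> t \<Longrightarrow> t \<le> X \<Longrightarrow> \<theta> t \<le> \<theta> s"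
proof (rule DERIV_nonpos_imp_decreasing_open[of s t])
  fix x assume x: "0 \<le> s" "s \<le> t" "t \<le> X" "s < x" "x < t"
  then have "0 \<le> x * avg n \<theta> x" using avg_bounds(1)[OF n_ge cont, of x] by auto
  then show "\<exists>y. (\<theta> has_real_derivative y) (at x) \<and> y \<le> 0"
    using \<theta>_deriv[of x] x by auto
qed (auto intro: continuous_on_subset[OF cont])

lemma \<theta>_0: "\<theta> 0 = 1" using eq[of 0] X by simp

lemma \<theta>_range: "0 \<le> \<xi> \<Longrightarrow> \<xi> \<le> X \<Longrightarrow> 0 \<le> \<theta> \<xi> \<and> \<theta> \<xi> \<le> 1"
  using \<theta>_decreasing[of \<xi> X] \<theta>_decreasing[of 0 \<xi>] end_nonneg \<theta>_0 by auto

lemma trunc_\<theta>: "0 \<le> \<xi> \<Longrightarrow> \<xi> \<le> X \<Longrightarrow> trunc (\<theta> \<xi>) = \<theta> \<xi>"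
  using \<theta>_range[of \<xi>] by (auto simp: trunc_def)

text \<open>As \<open>\<theta>\<close> decreases, the density on [0, \<xi>] lies between its value
  at \<xi> and the central value 1.\<close>

lemma avg_\<theta>:
  assumes "0 \<le> \<xi>" "\<xi> \<le> X"
  shows "\<theta> \<xi> powr n / 3 \<le> avg n \<theta> \<xi>" "avg n \<theta> \<xi> \<le> 1 / 3"
proof -
  have *: "\<theta> \<xi> powr n \<le> trunc (\<theta> s) powr n \<and> trunc (\<theta> s) powr n \<le> 1" if "s \<in> {0..\<xi>}" for s
    using that assms \<theta>_range[of s] \<theta>_range[of \<xi>] \<theta>_decreasing[of s \<xi>] n1
    by (auto simp: trunc_\<theta> powr_le1 intro!: powr_mono2)
  from avg_between[OF n_ge cont, of \<xi>, OF _ *] assms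
  show "\<theta> \<xi> powr n / 3 \<le> avg n \<theta> \<xi>" "avg n \<theta> \<xi> \<le> 1 / 3" by auto
qed

lemma \<theta>_early: "0 \<le> \<xi> \<Longrightarrow> \<xi> \<le> X \<Longrightarrow> 1 - \<xi>\<^sup>2 / 6 \<le> \<theta> \<xi>"
proof -
  assume a: "0 \<le> \<xi>" "\<xi> \<le> X"
  have "\<theta> 0 + 0\<^sup>2 / 6 \<le> \<theta> \<xi> + \<xi>\<^sup>2 / 6"
  proof (rule DERIV_nonneg_imp_increasing_open[of 0 \<xi>])
    fix x assume x: "0 < x" "x < \<xi>"
    have "x * avg n \<theta> x \<le> x * (1 / 3)" using avg_\<theta>[of x] x a by (intro mult_left_mono) auto
    moreover have "((\<lambda>x. \<theta> x + x\<^sup>2 / 6) has_real_derivative (- (x * avg n \<theta> x) + x / 3)) (at x)"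
      using x a by (auto intro!: derivative_eq_intros \<theta>_deriv)
    ultimately show "\<exists>y. ((\<lambda>x. \<theta> x + x\<^sup>2 / 6) has_real_derivative y) (at x) \<and> 0 \<le> y"
      by (intro exI[of _ "- (x * avg n \<theta> x) + x / 3"]) auto
  qed (use a in \<open>auto intro!: continuous_intros continuous_on_subset[OF cont]\<close>)
  then show ?thesis by (simp add: \<theta>_0)
qed

lemma avg_pos:
  assumes "0 \<le> \<xi>" "\<xi> \<le> X"
  shows "0 < avg n \<theta> \<xi>"
proof -
  have "0 < (1 / 2) powr n * ((1 / X) ^ 3 / 3)" using X by simp
  also have "\<dots> \<le> avg n \<theta> \<xi>"
  proof (rule avg_lower[OF n_ge cont])
    \<comment> \<open>With \<tau> = 1 / X the core is [0, 1], where \<open>\<theta>_early\<close>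
      gives at least 5/6.\<close>
    fix t assume "t \<in> {0..1 / X * X}"
    then have t: "0 \<le> t" "t \<le> 1" using X by auto
    then have "t\<^sup>2 \<le> 1" by (simp add: power_le_one)
    then show "1 / 2 \<le> \<theta> t" using \<theta>_early[of t] t X by auto
  qed (use assms X in auto)
  finally show ?thesis .
qed

lemma \<theta>_pos:
  assumes "0 \<le> \<xi>" "\<xi> < X"
  shows "\<theta> \<xi> > 0"
proof -
  have "\<theta> X < \<theta> \<xi>"
  proof (rule DERIV_neg_imp_decreasing_open[OF assms(2)])
    fix x assume x: "\<xi> < x" "x < X"
    then have "0 < x * avg n \<theta> x" using avg_pos[of x] assms by auto
    then show "\<exists>y. (\<theta> has_real_derivative y) (at x) \<and> y < 0"
      using \<theta>_deriv[of x] x assms by auto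
  qed (use assms in \<open>auto intro: continuous_on_subset[OF cont]\<close>)
  then show ?thesis using end_nonneg by simp
qed

lemma \<mu>_deriv:
  assumes "0 < \<xi>" "\<xi> < X"
  shows "(\<mu> has_real_derivative \<xi>\<^sup>2 * \<theta> \<xi> powr n) (at \<xi>)"
  using avg_mass_deriv[OF n_ge cont assms] assms trunc_\<theta>[of \<xi>] unfolding \<mu>_def[abs_def] by simp

lemma \<theta>_deriv':
  assumes "0 < \<xi>" "\<xi> < X"
  shows "(\<theta> has_real_derivative - (\<mu> \<xi> / \<xi>\<^sup>2)) (at \<xi>)"
  using \<theta>_deriv[OF assms] assms by (simp add: \<mu>_def power3_eq_cube power2_eq_square)

text \<open>The mean density dominates the local one, so - \<theta>' \<ge> \<xi> * \<theta>^n / 3.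
  Hence \<theta>^(1-n) grows at least like (n - 1) * \<xi>^2 / 6, and inverting gives the
  decay.\<close>

lemma \<theta>_decay:
  assumes "0 < \<xi>" "\<xi> < X"
  shows "\<theta> \<xi> powr (n - 1) \<le> 6 / ((n - 1) * \<xi>\<^sup>2)"
proof -
  let ?Z = "\<lambda>\<xi>. \<theta> \<xi> powr (1 - n) - (n - 1) * \<xi>\<^sup>2 / 6"
  have "?Z 0 \<le> ?Z \<xi>"
  proof (rule DERIV_nonneg_imp_increasing_open[of 0 \<xi> ?Z])
    fix x assume x: "0 < x" "x < \<xi>"
    have p: "\<theta> x > 0" using \<theta>_pos x assms by auto
    have D: "(?Z has_real_derivative (1 - n) * \<theta> x powr (1 - n - 1) * - (x * avg n \<theta> x) - (n - 1) * (2 * x) / 6) (at x)"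
      using x assms p by (auto intro!: derivative_eq_intros \<theta>_deriv)
    have "x / 3 = x * (\<theta> x powr (- n) * (\<theta> x powr n / 3))"
      using p by (simp add: powr_minus)
    also have "\<dots> \<le> x * (\<theta> x powr (- n) * avg n \<theta> x)"
      using avg_\<theta>(1)[of x] x assms by (intro mult_left_mono) auto
    finally have "(n - 1) * (x / 3) \<le> (n - 1) * (x * (\<theta> x powr (- n) * avg n \<theta> x))"
      using n1 by (intro mult_left_mono) auto
    moreover have "(1 - n) * \<theta> x powr (1 - n - 1) * - (x * avg n \<theta> x) - (n - 1) * (2 * x) / 6 =
        (n - 1) * (x * (\<theta> x powr (- n) * avg n \<theta> x)) - (n - 1) * (x / 3)"
      by (simp add: field_simps)
    ultimately have "0 \<le> (1 - n) * \<theta> x powr (1 - n - 1) * - (x * avg n \<theta> x) - (n - 1) * (2 * x) / 6"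
      by linarith
    with D show "\<exists>y. (?Z has_real_derivative y) (at x) \<and> 0 \<le> y" by blast
  next
    have "\<forall>x\<in>{0..\<xi>}. \<theta> x \<noteq> 0" using \<theta>_pos assms by force
    then show "continuous_on {0..\<xi>} ?Z"
      using assms by (intro continuous_intros continuous_on_subset[OF cont]) auto
  qed (use assms in auto)
  then have "(n - 1) * \<xi>\<^sup>2 / 6 \<le> \<theta> \<xi> powr (1 - n)" using \<theta>_0 by simp
  also have "\<theta> \<xi> powr (1 - n) = inverse (\<theta> \<xi> powr (n - 1))"
    by (simp flip: powr_minus)
  finally have "\<theta> \<xi> powr (n - 1) \<le> inverse ((n - 1) * \<xi>\<^sup>2 / 6)"
    using le_imp_inverse_le[of "(n - 1) * \<xi>\<^sup>2 / 6" "inverse (\<theta> \<xi> powr (n - 1))"] n1 assms by simp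
  then show ?thesis by simp
qed

text \<open>The idea is that $\xi\theta(\xi)$ is concave and nonnegative at $X$.\<close>

lemma \<mu>_bound: "\<mu> (X / 2) \<le> X * \<theta> (X / 2)"
proof -
  have half: "0 < X / 2" "X / 2 < X" using X by auto
  let ?d = "\<lambda>\<xi>. \<theta> \<xi> - \<mu> \<xi> / \<xi>"
  have "\<exists>z. X / 2 < z \<and> z < X \<and> X * \<theta> X - X / 2 * \<theta> (X / 2) = (X - X / 2) * ?d z"
  proof -
    have "\<exists>l z. X / 2 < z \<and> z < X \<and> DERIV (\<lambda>\<xi>. \<xi> * \<theta> \<xi>) z :> l \<and> X * \<theta> X - X / 2 * \<theta> (X / 2) = (X - X / 2) * l"
    proof (rule MVT)
      show "continuous_on {X / 2..X} (\<lambda>\<xi>. \<xi> * \<theta> \<xi>)"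
        using half by (intro continuous_intros continuous_on_subset[OF cont]) auto
      show "(\<lambda>\<xi>. \<xi> * \<theta> \<xi>) differentiable (at x)" if "X / 2 < x" "x < X" for x
        using \<theta>_deriv[of x] that half
        by (intro derivative_intros) (auto simp: real_differentiable_def)
    qed (use half in auto)
    then obtain l z where z: "X / 2 < z" "z < X" and D: "DERIV (\<lambda>\<xi>. \<xi> * \<theta> \<xi>) z :> l"
      and e: "X * \<theta> X - X / 2 * \<theta> (X / 2) = (X - X / 2) * l" by blast
    have "DERIV (\<lambda>\<xi>. \<xi> * \<theta> \<xi>) z :> ?d z"
      using z half by (auto intro!: derivative_eq_intros \<theta>_deriv' simp: power2_eq_square)
    then have "l = ?d z" using D DERIV_unique by blast
    then show ?thesis using z e by blast
  qed
  then obtain z where z: "X / 2 < z" "z < X" "X * \<theta> X - X / 2 * \<theta> (X / 2) = (X - X / 2) * ?d z" by blast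
  \<comment> \<open>\<open>?d\<close> is the derivative of \<xi> * \<theta>. Its decrease keeps the
    chord slope over [X/2, X] below the tangent slope at X/2; as X * \<theta> X \<ge> 0, the tangent
    is nonnegative at X, which says X * \<theta> (X/2) - \<mu> (X/2) \<ge> 0.\<close>
  have "?d z \<le> ?d (X / 2)"
  proof (rule DERIV_nonpos_imp_nonincreasing[of "X / 2" z])
    fix x assume "X / 2 \<le> x" "x \<le> z"
    then have x: "0 < x" "x < X" using z half by auto
    have "(?d has_real_derivative - (\<mu> x / x\<^sup>2) - (x\<^sup>2 * \<theta> x powr n * x - \<mu> x) / (x * x)) (at x)"
      using x by (auto intro!: derivative_eq_intros \<theta>_deriv' \<mu>_deriv)
    moreover have "- (\<mu> x / x\<^sup>2) - (x\<^sup>2 * \<theta> x powr n * x - \<mu> x) / (x * x) = - (x * \<theta> x powr n)"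
      using x by (simp add: field_simps power2_eq_square)
    ultimately show "\<exists>y. (?d has_real_derivative y) (at x) \<and> y \<le> 0"
      using x by (intro exI[of _ "- (x * \<theta> x powr n)"]) auto
  qed (use z in auto)
  then have "X / 2 * ?d z \<le> X / 2 * ?d (X / 2)" using half by (intro mult_left_mono) auto
  moreover have XX: "X - X / 2 = X / 2" by simp
  moreover have "0 \<le> X * \<theta> X" using end_nonneg X by auto
  ultimately have "0 \<le> X / 2 * ?d (X / 2) + X / 2 * \<theta> (X / 2)" using z(3)[unfolded XX] by linarith
  then show ?thesis using X by (simp add: field_simps)
qed

text \<open>With \<theta>' = - \<xi> * avg this is \<xi>^3 \<theta>'^2 / 2 + \<xi>^3 \<theta>^(n+1)
  / (n+1) + \<xi>^2 \<theta> \<theta>' / 2. Written with \<open>avg\<close> it involves no division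
  by \<xi>, so continuity and the value 0 at the centre are immediate.\<close>

definition pohozaev where
  "pohozaev \<xi> = \<xi> ^ 5 * (avg n \<theta> \<xi>)\<^sup>2 / 2 + \<xi> ^ 3 * \<theta> \<xi> powr (n + 1) / (n + 1) - \<xi> ^ 3 * avg n \<theta> \<xi> * \<theta> \<xi> / 2"

lemma pohozaev_\<mu>:
  "0 < \<xi> \<Longrightarrow> pohozaev \<xi> = (\<mu> \<xi>)\<^sup>2 / (2 * \<xi>) + \<xi> ^ 3 * \<theta> \<xi> powr (n + 1) / (n + 1) - \<mu> \<xi> * \<theta> \<xi> / 2"
  by (simp add: pohozaev_def \<mu>_def power2_eq_square power3_eq_cube field_simps eval_nat_numeral)

lemma pohozaev_cont: "\<xi> < X \<Longrightarrow> continuous_on {0..\<xi>} pohozaev"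
proof -
  assume a: "\<xi> < X"
  have "\<forall>x\<in>{0..\<xi>}. \<theta> x \<noteq> 0" using \<theta>_pos a by force
  moreover have "continuous_on {0..\<xi>} \<theta>" "continuous_on {0..\<xi>} (avg n \<theta>)"
    using a by (auto intro: continuous_on_subset[OF cont] continuous_on_subset[OF avg_cont])
  ultimately show ?thesis unfolding pohozaev_def[abs_def] using n1 by (intro continuous_intros) auto
qed

text \<open>In the form of \<open>pohozaev_\<mu>\<close> the terms with \<mu>^2 and those with \<mu>
  * \<theta>^n cancel. Only a multiple of \<xi>^2 \<theta>^(n+1) remains, whose coefficient is
  positive because n < 5.\<close>

lemma pohozaev_deriv:
  assumes "0 < \<xi>" "\<xi> < X"
  shows "(pohozaev has_real_derivative (3 / (n + 1) - 1 / 2) * \<xi>\<^sup>2 * \<theta> \<xi> powr (n + 1)) (at \<xi>)"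
proof -
  have p: "\<theta> \<xi> > 0" using \<theta>_pos assms by auto
  let ?F = "\<lambda>\<xi>. (\<mu> \<xi>)\<^sup>2 / (2 * \<xi>) + \<xi> ^ 3 * \<theta> \<xi> powr (n + 1) / (n + 1) - \<mu> \<xi> * \<theta> \<xi> / 2"
  have pn: "\<theta> \<xi> powr (n + 1) = \<theta> \<xi> powr n * \<theta> \<xi>" using p by (simp add: powr_add)
  have D1: "((\<lambda>\<xi>. (\<mu> \<xi>)\<^sup>2 / (2 * \<xi>)) has_real_derivative \<mu> \<xi> * \<theta> \<xi> powr n * \<xi> - (\<mu> \<xi>)\<^sup>2 / (2 * \<xi>\<^sup>2)) (at \<xi>)"
    using assms by (auto intro!: derivative_eq_intros \<mu>_deriv simp: field_simps power2_eq_square)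
  have D2: "((\<lambda>\<xi>. \<xi> ^ 3 * \<theta> \<xi> powr (n + 1) / (n + 1)) has_real_derivative
      3 / (n + 1) * \<xi>\<^sup>2 * \<theta> \<xi> powr (n + 1) - \<xi> * \<mu> \<xi> * \<theta> \<xi> powr n) (at \<xi>)"
  proof -
    have D: "((\<lambda>\<xi>. \<theta> \<xi> powr (n + 1)) has_real_derivative (n + 1) * \<theta> \<xi> powr n * - (\<mu> \<xi> / \<xi>\<^sup>2)) (at \<xi>)"
      using assms p by (auto intro!: derivative_eq_intros \<theta>_deriv')
    have "((\<lambda>\<xi>. \<xi> ^ 3 * \<theta> \<xi> powr (n + 1) / (n + 1)) has_real_derivative
      (3 * \<xi>\<^sup>2 * \<theta> \<xi> powr (n + 1) + \<xi> ^ 3 * ((n + 1) * \<theta> \<xi> powr n * - (\<mu> \<xi> / \<xi>\<^sup>2))) / (n + 1)) (at \<xi>)"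
      by (rule DERIV_cdivide DERIV_cong[OF DERIV_mult[OF DERIV_pow[of 3 \<xi>] D]])+ simp
    moreover have "(3 * a * b + \<xi> ^ 3 * (N * p * - (m / \<xi>\<^sup>2))) / N = 3 / N * a * b - \<xi> * m * p"
      if "N \<noteq> 0" for a b N p m :: real
      using that assms by (simp add: field_simps power2_eq_square power3_eq_cube)
    ultimately show ?thesis using n1 by simp
  qed
  have D3: "((\<lambda>\<xi>. \<mu> \<xi> * \<theta> \<xi> / 2) has_real_derivative
      \<xi>\<^sup>2 * \<theta> \<xi> powr (n + 1) / 2 - (\<mu> \<xi>)\<^sup>2 / (2 * \<xi>\<^sup>2)) (at \<xi>)"
    using assms by (auto intro!: derivative_eq_intros \<theta>_deriv' \<mu>_deriv simp: pn pn[unfolded add.commute[of n 1]] field_simps power2_eq_square)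
  have "(?F has_real_derivative (3 / (n + 1) - 1 / 2) * \<xi>\<^sup>2 * \<theta> \<xi> powr (n + 1)) (at \<xi>)"
    by (rule DERIV_cong[OF DERIV_diff[OF DERIV_add[OF D1 D2] D3]]) (simp add: algebra_simps)
  moreover have "eventually (\<lambda>x. x \<in> {0<..}) (nhds \<xi>)"
    by (rule eventually_nhds_in_open) (use assms in auto)
  then have "eventually (\<lambda>x. ?F x = pohozaev x) (nhds \<xi>)"
    by eventually_elim (simp add: pohozaev_\<mu>)
  ultimately show ?thesis by (simp add: DERIV_cong_ev[OF refl _ refl])
qed

lemma coeff_pos: "0 < 3 / (n + 1) - 1 / 2"
  using n1 n5 by (simp add: field_simps)

text \<open>The growth over [0, 1], where \<theta> \<ge> 1/2, already gives a bound independent of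
  X; monotonicity carries it on to X/2 \<ge> 1.\<close>

lemma pohozaev_lower: "(3 / (n + 1) - 1 / 2) * (1 / 2) powr (n + 1) / 3 \<le> pohozaev (X / 2)"
proof -
  let ?c = "(3 / (n + 1) - 1 / 2) * (1 / 2) powr (n + 1)"
  have "pohozaev 0 - ?c / 3 * 0 ^ 3 \<le> pohozaev 1 - ?c / 3 * 1 ^ 3"
  proof (rule DERIV_nonneg_imp_increasing_open[of 0 1])
    fix x :: real assume x: "0 < x" "x < 1"
    have D: "((\<lambda>x. pohozaev x - ?c / 3 * x ^ 3) has_real_derivative
      (3 / (n + 1) - 1 / 2) * x\<^sup>2 * \<theta> x powr (n + 1) - ?c * x\<^sup>2) (at x)"
      using x X by (auto intro!: derivative_eq_intros pohozaev_deriv)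
    have "x\<^sup>2 \<le> 1" using x by (simp add: power_le_one)
    then have "1 / 2 \<le> \<theta> x" using \<theta>_early[of x] x X by auto
    then have "(1 / 2) powr (n + 1) \<le> \<theta> x powr (n + 1)" using n1 by (intro powr_mono2) auto
    then have "(3 / (n + 1) - 1 / 2) * x\<^sup>2 * (1 / 2) powr (n + 1) \<le> (3 / (n + 1) - 1 / 2) * x\<^sup>2 * \<theta> x powr (n + 1)"
      using coeff_pos by (intro mult_left_mono) auto
    then show "\<exists>y. ((\<lambda>x. pohozaev x - ?c / 3 * x ^ 3) has_real_derivative y) (at x) \<and> 0 \<le> y"
      using D by (intro exI, intro conjI) (assumption, simp add: algebra_simps)
  qed (use X in \<open>auto intro!: continuous_intros pohozaev_cont\<close>)
  moreover have "pohozaev 1 \<le> pohozaev (X / 2)"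
  proof (rule DERIV_nonneg_imp_increasing_open[of 1 "X / 2"])
    fix x assume x: "1 < x" "x < X / 2"
    then have "(pohozaev has_real_derivative (3 / (n + 1) - 1 / 2) * x\<^sup>2 * \<theta> x powr (n + 1)) (at x)"
      using X by (intro pohozaev_deriv) auto
    then show "\<exists>y. (pohozaev has_real_derivative y) (at x) \<and> 0 \<le> y"
      using coeff_pos by (intro exI, intro conjI) (assumption, auto)
  qed (use X in \<open>auto intro!: continuous_on_subset[OF pohozaev_cont[of "X / 2"]]\<close>)
  ultimately show ?thesis by (simp add: pohozaev_def)
qed

text \<open>The negative term is dropped. At h = X/2, \<open>\<mu>_bound\<close> and
  \<open>\<theta>_decay\<close> turn the other two terms into multiples of h * \<theta>^2.\<close>

lemma pohozaev_upper:
  "pohozaev (X / 2) \<le> (2 + 6 / ((n - 1) * (n + 1))) * (X / 2) * (\<theta> (X / 2))\<^sup>2"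
proof -
  define h where "h = X / 2"
  have half: "0 < h" "h < X" using X by (auto simp: h_def)
  have p: "\<theta> h > 0" using \<theta>_pos half by auto
  have m0: "0 \<le> \<mu> h" using avg_pos[of h] half by (auto simp: \<mu>_def)
  have "\<mu> h \<le> 2 * h * \<theta> h" using \<mu>_bound by (simp add: h_def)
  then have "(\<mu> h)\<^sup>2 \<le> (2 * h * \<theta> h)\<^sup>2" using m0 by (intro power_mono) auto
  then have "(\<mu> h)\<^sup>2 / (2 * h) \<le> (2 * h * \<theta> h)\<^sup>2 / (2 * h)" using half by (intro divide_right_mono) auto
  also have "\<dots> = 2 * (h * (\<theta> h)\<^sup>2)" using half by (simp add: power2_eq_square)
  finally have 1: "(\<mu> h)\<^sup>2 / (2 * h) \<le> 2 * (h * (\<theta> h)\<^sup>2)" .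
  have "\<theta> h powr (n + 1) = \<theta> h powr (n - 1) * \<theta> h powr 2"
    by (simp add: add.commute flip: powr_add)
  then have "h ^ 3 * \<theta> h powr (n + 1) = (h\<^sup>2 * \<theta> h powr (n - 1)) * (h * (\<theta> h)\<^sup>2)"
    using p half by (simp add: powr_numeral power3_eq_cube power2_eq_square)
  also have "\<dots> \<le> (h\<^sup>2 * (6 / ((n - 1) * h\<^sup>2))) * (h * (\<theta> h)\<^sup>2)"
    using \<theta>_decay[OF half] half by (intro mult_right_mono mult_left_mono) auto
  also have "\<dots> = 6 / (n - 1) * (h * (\<theta> h)\<^sup>2)" using half by simp
  finally have "h ^ 3 * \<theta> h powr (n + 1) / (n + 1) \<le> 6 / (n - 1) * (h * (\<theta> h)\<^sup>2) / (n + 1)"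
    using n1 by (intro divide_right_mono) auto
  then have 2: "h ^ 3 * \<theta> h powr (n + 1) / (n + 1) \<le> 6 / ((n - 1) * (n + 1)) * (h * (\<theta> h)\<^sup>2)" by simp
  have "0 \<le> \<mu> h * \<theta> h / 2" using m0 p by simp
  then have "pohozaev h \<le> 2 * (h * (\<theta> h)\<^sup>2) + 6 / ((n - 1) * (n + 1)) * (h * (\<theta> h)\<^sup>2)"
    using 1 2 pohozaev_\<mu>[OF half(1)] by linarith
  also have "\<dots> = (2 + 6 / ((n - 1) * (n + 1))) * h * (\<theta> h)\<^sup>2" by (simp add: algebra_simps)
  finally show ?thesis by (simp add: h_def)
qed

text \<open>Raising \<open>\<theta>_decay\<close> to the power 2/(n-1) bounds h * \<theta>^2 by a
  multiple of h powr (1 - 4/(n-1)). The solution thereby disappears from the inequality, which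
  relates n and X only.\<close>

lemma pohozaev_contra:
  "(3 / (n + 1) - 1 / 2) * (1 / 2) powr (n + 1) / 3 \<le>
    (2 + 6 / ((n - 1) * (n + 1))) * (6 / (n - 1)) powr (2 / (n - 1)) * (X / 2) powr (1 - 4 / (n - 1))"
proof -
  define h where "h = X / 2"
  have half: "0 < h" "h < X" using X by (auto simp: h_def)
  have p: "\<theta> h > 0" using \<theta>_pos half by auto
  have "(\<theta> h)\<^sup>2 = (\<theta> h powr (n - 1)) powr (2 / (n - 1))"
  proof -
    have "(n - 1) * (2 / (n - 1)) = 2" using n1 by (simp add: field_simps)
    then show ?thesis using p by (simp add: powr_powr powr_numeral del: times_divide_eq_right)
  qed
  also have "\<dots> \<le> (6 / ((n - 1) * h\<^sup>2)) powr (2 / (n - 1))"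
    using \<theta>_decay[OF half] n1 by (intro powr_mono2) auto
  also have "\<dots> = (6 / (n - 1)) powr (2 / (n - 1)) * (h\<^sup>2) powr (- (2 / (n - 1)))"
    using n1 half by (simp add: powr_divide powr_mult powr_minus_divide)
  also have "(h\<^sup>2) powr (- (2 / (n - 1))) = h powr (- (4 / (n - 1)))"
    using half by (simp add: powr_powr flip: powr_numeral)
  finally have "h * (\<theta> h)\<^sup>2 \<le> h * ((6 / (n - 1)) powr (2 / (n - 1)) * h powr (- (4 / (n - 1))))"
    using half by (intro mult_left_mono) auto
  also have "\<dots> = (6 / (n - 1)) powr (2 / (n - 1)) * h powr (1 - 4 / (n - 1))"
    using half powr_add[of h 1 "- (4 / (n - 1))"] by simp
  finally have "(2 + 6 / ((n - 1) * (n + 1))) * (h * (\<theta> h)\<^sup>2) \<le>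
      (2 + 6 / ((n - 1) * (n + 1))) * ((6 / (n - 1)) powr (2 / (n - 1)) * h powr (1 - 4 / (n - 1)))"
    using n1 by (intro mult_left_mono) auto
  then show ?thesis using pohozaev_lower pohozaev_upper by (simp add: h_def mult.assoc)
qed

end

lemma lane_emden_zero:
  fixes n :: real
  assumes "1 < n" "n < 5"
  obtains X where "X > 0"
    "\<And>\<theta>. continuous_on {0..X} \<theta> \<Longrightarrow>
      (\<And>\<xi>. \<xi> \<in> {0..X} \<Longrightarrow> \<theta> \<xi> = 1 - integral {0..\<xi>} (\<lambda>s. s * avg n \<theta> s)) \<Longrightarrow> \<theta> X < 0"
proof -
  let ?c = "(3 / (n + 1) - 1 / 2) * (1 / 2) powr (n + 1) / 3"
  let ?C = "(2 + 6 / ((n - 1) * (n + 1))) * (6 / (n - 1)) powr (2 / (n - 1))"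
  have c: "?c > 0" using assms by (simp add: field_simps)
  \<comment> \<open>The exponent is negative since n < 5, so the upper Pohozaev bound tends to 0
    while the lower bound \<open>?c\<close> is fixed.\<close>
  have "((\<lambda>h. ?C * h powr (1 - 4 / (n - 1))) \<longlongrightarrow> ?C * 0) at_top"
    using assms by (intro tendsto_mult tendsto_const tendsto_neg_powr filterlim_ident) (simp add: field_simps)
  then have "eventually (\<lambda>h. ?C * h powr (1 - 4 / (n - 1)) < ?c) at_top"
    using c by (intro order_tendstoD) auto
  then have "eventually (\<lambda>h. ?C * h powr (1 - 4 / (n - 1)) < ?c \<and> 1 \<le> h) at_top"
    using eventually_ge_at_top[of "1 :: real"] by (rule eventually_conj)
  then obtain h where h: "?C * h powr (1 - 4 / (n - 1)) < ?c" "1 \<le> h"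
    by (auto simp: eventually_at_top_linorder)
  show ?thesis
  proof (rule that[of "2 * h"])
    fix \<theta> assume *: "continuous_on {0..2 * h} \<theta>"
      "\<And>\<xi>. \<xi> \<in> {0..2 * h} \<Longrightarrow> \<theta> \<xi> = 1 - integral {0..\<xi>} (\<lambda>s. s * avg n \<theta> s)"
    show "\<theta> (2 * h) < 0"
    proof (rule ccontr)
      assume "\<not> \<theta> (2 * h) < 0"
      then have "?c \<le> ?C * (2 * h / 2) powr (1 - 4 / (n - 1))"
        using assms h * by (intro lane_emden.pohozaev_contra[of n "2 * h" \<theta>] lane_emden.intro) auto
      then show False using h by simp
    qed
  qed (use h in auto)
qed

section \<open>The scaled equations\<close>

text \<open>The quotient bounded here, called \<open>slope\<close> below, is $(n+1)\,dx/d(u/c^2)$ with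
  $x = A\rho^{\gamma-1}/c^2$ and $u = \int dP/(\rho+P/c^2)$.\<close>

locale eos =
  fixes \<gamma> n :: real and \<Omega> \<Omega>' :: "real \<Rightarrow> real" and x\<^sub>0 L\<^sub>0 :: real
  assumes \<gamma>: "6 / 5 < \<gamma>" "\<gamma> < 2" and n_def: "n = 1 / (\<gamma> - 1)"
    and x0: "0 < x\<^sub>0" "x\<^sub>0 \<le> 1" and L0: "0 \<le> L\<^sub>0"
    and \<Omega>_0: "\<Omega> 0 = 1"
    and \<Omega>_deriv: "\<And>x. x \<in> {0..x\<^sub>0} \<Longrightarrow> (\<Omega> has_real_derivative \<Omega>' x) (at x)"
    and \<Omega>_range: "\<And>x. x \<in> {0..x\<^sub>0} \<Longrightarrow> 1 / 2 \<le> \<Omega> x \<and> \<Omega> x \<le> 2"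
    and den_pos: "\<And>x. x \<in> {0..x\<^sub>0} \<Longrightarrow> 0 < \<gamma> * \<Omega> x + (\<gamma> - 1) * x * \<Omega>' x"
    and slope_range': "\<And>x. x \<in> {0..x\<^sub>0} \<Longrightarrow> 1 / 2 \<le> \<gamma> * (1 + x * \<Omega> x) / (\<gamma> * \<Omega> x + (\<gamma> - 1) * x * \<Omega>' x)
      \<and> \<gamma> * (1 + x * \<Omega> x) / (\<gamma> * \<Omega> x + (\<gamma> - 1) * x * \<Omega>' x) \<le> 2"
    and slope_lip': "\<And>x y. x \<in> {0..x\<^sub>0} \<Longrightarrow> y \<in> {0..x\<^sub>0} \<Longrightarrow>
      \<bar>\<gamma> * (1 + x * \<Omega> x) / (\<gamma> * \<Omega> x + (\<gamma> - 1) * x * \<Omega>' x) -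
       \<gamma> * (1 + y * \<Omega> y) / (\<gamma> * \<Omega> y + (\<gamma> - 1) * y * \<Omega>' y)\<bar> \<le> L\<^sub>0 * \<bar>x - y\<bar>"
    and \<Omega>_lip: "\<And>x y. x \<in> {0..x\<^sub>0} \<Longrightarrow> y \<in> {0..x\<^sub>0} \<Longrightarrow> \<bar>\<Omega> x - \<Omega> y\<bar> \<le> L\<^sub>0 * \<bar>x - y\<bar>"

text \<open>At 0 the values of \<Omega> and of the slope are 1 and that of its denominator is
  \<gamma>, so the strict inequalities persist nearby. Two derivatives of \<Omega> enter because the
  slope contains the first one and has to be Lipschitz.\<close>

lemma eos_exists:
  assumes "6 / 5 < \<gamma>" "\<gamma> < 2" "{0..} \<subseteq> U" "real_analytic_on \<Omega> U" "\<Omega> 0 = 1"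
  obtains \<Omega>' x\<^sub>0 L\<^sub>0 where "eos \<gamma> (1 / (\<gamma> - 1)) \<Omega> \<Omega>' x\<^sub>0 L\<^sub>0"
proof -
  have "0 \<in> U" using assms(3) by auto
  then obtain d \<Omega>1 \<Omega>2 where d: "d > 0"
    and D1: "\<And>y. \<bar>y - 0\<bar> < d \<Longrightarrow> (\<Omega> has_real_derivative \<Omega>1 y) (at y)"
    and D2: "\<And>y. \<bar>y - 0\<bar> < d \<Longrightarrow> (\<Omega>1 has_real_derivative \<Omega>2 y) (at y)"
    and C2: "continuous_on {0 - d<..<0 + d} \<Omega>2"
    using real_analytic_imp_C2[OF assms(4)] by metis
  define den where "den x = \<gamma> * \<Omega> x + (\<gamma> - 1) * x * \<Omega>1 x" for x
  define sl where "sl x = \<gamma> * (1 + x * \<Omega> x) / den x" for x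
  have c0: "isCont \<Omega> 0" "isCont \<Omega>1 0" using D1[of 0] D2[of 0] d by (auto intro: DERIV_isCont)
  have cden: "isCont den 0" unfolding den_def[abs_def] by (intro continuous_intros c0)
  have den0: "den 0 = \<gamma>" using assms by (simp add: den_def)
  have csl: "isCont sl 0" unfolding sl_def[abs_def]
    by (intro continuous_intros c0 cden) (use den0 assms in auto)
  have sl0: "sl 0 = 1" using den0 assms by (simp add: sl_def)
  have lim: "(\<Omega> \<longlongrightarrow> 1) (nhds 0)" "(den \<longlongrightarrow> \<gamma>) (nhds 0)" "(sl \<longlongrightarrow> 1) (nhds 0)"
    using c0(1)[unfolded isCont_def tendsto_at_iff_tendsto_nhds] cden[unfolded isCont_def tendsto_at_iff_tendsto_nhds]
      csl[unfolded isCont_def tendsto_at_iff_tendsto_nhds] assms(5) den0 sl0 by simp_all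
  have "eventually (\<lambda>x. 1 / 2 < \<Omega> x \<and> \<Omega> x < 2 \<and> 0 < den x \<and> 1 / 2 < sl x \<and> sl x < 2) (nhds 0)"
    by (intro eventually_conj order_tendstoD[OF lim(1)] order_tendstoD[OF lim(2)] order_tendstoD[OF lim(3)])
      (use assms in auto)
  then obtain e where e: "e > 0" and E: "\<And>x. \<bar>x\<bar> < e \<Longrightarrow>
      1 / 2 < \<Omega> x \<and> \<Omega> x < 2 \<and> 0 < den x \<and> 1 / 2 < sl x \<and> sl x < 2"
    unfolding eventually_nhds_metric by (auto simp: dist_real_def)
  \<comment> \<open>Halving places the closed interval [0, \<open>x\<^sub>0\<close>] strictly inside
    the neighbourhoods of radius d and e.\<close>
  define x\<^sub>0 where "x\<^sub>0 = min (min d e) 1 / 2"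
  have x0: "0 < x\<^sub>0" "x\<^sub>0 \<le> 1" "x\<^sub>0 < d" "x\<^sub>0 < e" using d e by (auto simp: x\<^sub>0_def min_def)
  define sl' where "sl' x = (\<gamma> * (\<Omega> x + x * \<Omega>1 x) * den x - \<gamma> * (1 + x * \<Omega> x) *
      (\<gamma> * \<Omega>1 x + (\<gamma> - 1) * (\<Omega>1 x + x * \<Omega>2 x))) / (den x * den x)" for x
  have c: "continuous_on {0..x\<^sub>0} \<Omega>"
    by (rule DERIV_continuous_on[OF has_field_derivative_at_within[OF D1]]) (use x0 in auto)
  have c1: "continuous_on {0..x\<^sub>0} \<Omega>1"
    by (rule DERIV_continuous_on[OF has_field_derivative_at_within[OF D2]]) (use x0 in auto)
  have c2: "continuous_on {0..x\<^sub>0} \<Omega>2"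
    by (rule continuous_on_subset[OF C2]) (use x0 in auto)
  have Dsl: "(sl has_real_derivative sl' x) (at x)" if "x \<in> {0..x\<^sub>0}" for x
  proof -
    have Dden: "(den has_real_derivative \<gamma> * \<Omega>1 x + (\<gamma> - 1) * (\<Omega>1 x + x * \<Omega>2 x)) (at x)"
      unfolding den_def[abs_def] using that x0
      by (auto intro!: derivative_eq_intros D1 D2 simp: algebra_simps)
    have "den x > 0" using E[of x] that x0 by simp
    then have "den x \<noteq> 0" by simp
    then show ?thesis unfolding sl_def[abs_def] sl'_def using that x0
      by (auto intro!: derivative_eq_intros D1 Dden simp: algebra_simps)
  qed
  have cden': "continuous_on {0..x\<^sub>0} den" unfolding den_def[abs_def] by (intro continuous_intros c c1)
  have "\<forall>x\<in>{0..x\<^sub>0}. den x * den x \<noteq> 0"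
  proof
    fix x assume "x \<in> {0..x\<^sub>0}"
    then have "den x > 0" using E[of x] x0 by simp
    then show "den x * den x \<noteq> 0" by simp
  qed
  then have csl': "continuous_on {0..x\<^sub>0} sl'" unfolding sl'_def[abs_def]
    by (intro continuous_on_divide continuous_on_diff continuous_on_mult continuous_on_add
        continuous_on_const continuous_on_id c c1 c2 cden')
  obtain L1 where L1: "L1 \<ge> 0" "\<And>x y. x \<in> {0..x\<^sub>0} \<Longrightarrow> y \<in> {0..x\<^sub>0} \<Longrightarrow> \<bar>sl x - sl y\<bar> \<le> L1 * \<bar>x - y\<bar>"
    using C1_imp_lipschitz[OF Dsl csl'] by metis
  obtain L2 where L2: "L2 \<ge> 0" "\<And>x y. x \<in> {0..x\<^sub>0} \<Longrightarrow> y \<in> {0..x\<^sub>0} \<Longrightarrow> \<bar>\<Omega> x - \<Omega> y\<bar> \<le> L2 * \<bar>x - y\<bar>"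
    using C1_imp_lipschitz[of 0 x\<^sub>0 \<Omega> \<Omega>1, OF D1 c1] x0 by auto
  have "eos \<gamma> (1 / (\<gamma> - 1)) \<Omega> \<Omega>1 x\<^sub>0 (L1 + L2)"
  proof
    fix x y assume xy: "x \<in> {0..x\<^sub>0}" "y \<in> {0..x\<^sub>0}"
    have "L1 * \<bar>x - y\<bar> \<le> (L1 + L2) * \<bar>x - y\<bar>" "L2 * \<bar>x - y\<bar> \<le> (L1 + L2) * \<bar>x - y\<bar>"
      using L1(1) L2(1) by (auto intro!: mult_right_mono)
    then show "\<bar>\<gamma> * (1 + x * \<Omega> x) / (\<gamma> * \<Omega> x + (\<gamma> - 1) * x * \<Omega>1 x) -
       \<gamma> * (1 + y * \<Omega> y) / (\<gamma> * \<Omega> y + (\<gamma> - 1) * y * \<Omega>1 y)\<bar> \<le> (L1 + L2) * \<bar>x - y\<bar>"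
      "\<bar>\<Omega> x - \<Omega> y\<bar> \<le> (L1 + L2) * \<bar>x - y\<bar>"
      using L1(2)[OF xy] L2(2)[OF xy] by (auto simp: sl_def den_def)
  next
    fix x assume x: "x \<in> {0..x\<^sub>0}"
    then have ex: "\<bar>x\<bar> < e" "\<bar>x\<bar> < d" using x0 by auto
    show "(\<Omega> has_real_derivative \<Omega>1 x) (at x)" using D1[of x] ex by simp
    show "1 / 2 \<le> \<Omega> x \<and> \<Omega> x \<le> 2" using E[OF ex(1)] by simp
    show "0 < \<gamma> * \<Omega> x + (\<gamma> - 1) * x * \<Omega>1 x" using E[OF ex(1)] by (simp add: den_def)
    show "1 / 2 \<le> \<gamma> * (1 + x * \<Omega> x) / (\<gamma> * \<Omega> x + (\<gamma> - 1) * x * \<Omega>1 x)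
      \<and> \<gamma> * (1 + x * \<Omega> x) / (\<gamma> * \<Omega> x + (\<gamma> - 1) * x * \<Omega>1 x) \<le> 2"
      using E[OF ex(1), unfolded sl_def den_def] by (meson less_imp_le)
  qed (use assms x0 L1 L2 in auto)
  then show ?thesis by (rule that)
qed

context eos
begin

lemma n_bounds: "1 < n" "n < 5" "n \<ge> 1"
  using \<gamma> by (auto simp: n_def field_simps)

definition slope where "slope x = \<gamma> * (1 + x * \<Omega> x) / (\<gamma> * \<Omega> x + (\<gamma> - 1) * x * \<Omega>' x)"

lemma slope_range: "x \<in> {0..x\<^sub>0} \<Longrightarrow> 1 / 2 \<le> slope x" "x \<in> {0..x\<^sub>0} \<Longrightarrow> slope x \<le> 2"
  using slope_range' by (auto simp: slope_def)

lemma slope_lip: "x \<in> {0..x\<^sub>0} \<Longrightarrow> y \<in> {0..x\<^sub>0} \<Longrightarrow> \<bar>slope x - slope y\<bar> \<le> L\<^sub>0 * \<bar>x - y\<bar>"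
  using slope_lip' by (auto simp: slope_def)

lemma slope_cont: "continuous_on {0..x\<^sub>0} slope"
proof -
  have "L\<^sub>0-lipschitz_on {0..x\<^sub>0} slope"
    by (rule lipschitz_onI) (simp_all add: dist_real_def slope_lip L0)
  then show ?thesis by (rule lipschitz_on_continuous_on)
qed

lemma slope_0: "slope 0 = 1" using \<gamma> by (simp add: slope_def \<Omega>_0)

text \<open>For $r = a\xi$, $\rho = \rho_c y^n$ and $m = 4\pi\rho_c r^3 w$ with $0 \le y \le 2$, these are
  $P/(c^2\rho_c)$, $\kappa$, $Q/(4\pi G\rho_c r^3)$ and $-dy/d\xi$, where \<open>xc\<close> is the
  central value of $x$ and \<open>\<beta>\<close> is $c^2\Lambda/(4\pi G\rho_c)$.\<close>

definition press where "press xc y = trunc y powr n * (xc * trunc y) * \<Omega> (xc * trunc y)"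

definition kap where "kap xc \<beta> s w = 1 - 2 * ((n + 1) * xc) * s\<^sup>2 * w - \<beta> * ((n + 1) * xc) * s\<^sup>2 / 3"

definition force where "force xc \<beta> w y = w + press xc y - \<beta> / 3"

definition rate where
  "rate xc \<beta> s w y = s * (force xc \<beta> w y * slope (xc * trunc y) * (1 / kap xc \<beta> s w))"

end

text \<open>Values of \<open>trunc\<close> are at most 2, so 2 * xc < \<open>x\<^sub>0\<close> keeps
  every argument of \<open>slope\<close> and \<Omega> inside [0, \<open>x\<^sub>0\<close>]. The left
  side of \<open>kap_small\<close> dominates 1 - \<open>kap\<close> over all positions and averages,
  so \<open>kap\<close> stays above 1/2.\<close>

locale scaled = eos +
  fixes xc \<beta> X :: real
  assumes xc: "0 < xc" "2 * xc < x\<^sub>0" and \<beta>: "0 \<le> \<beta>" "\<beta> \<le> 1" and Xpos: "0 < X"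
    and kap_small: "2 * ((n + 1) * xc) * X\<^sup>2 * 2 powr n + \<beta> * ((n + 1) * xc) * X\<^sup>2 / 3 \<le> 1 / 2"
begin

section \<open>Bounds and Lipschitz estimates for the scaled kernel\<close>

lemma x_range: "xc * trunc y \<in> {0..x\<^sub>0}" "xc * trunc y \<le> 2 * xc" "0 \<le> xc * trunc y"
proof -
  show 1: "xc * trunc y \<le> 2 * xc" using trunc_range[of y] xc by simp
  show 2: "0 \<le> xc * trunc y" using trunc_range[of y] xc by simp
  show "xc * trunc y \<in> {0..x\<^sub>0}" using 1 2 xc unfolding atLeastAtMost_iff by linarith
qed

lemma one_minus_kap:
  assumes "s \<in> {0..X}" "w \<in> {0..2 powr n}"
  shows "0 \<le> 1 - kap xc \<beta> s w"
    "1 - kap xc \<beta> s w \<le> 2 * ((n + 1) * xc) * X\<^sup>2 * 2 powr n + \<beta> * ((n + 1) * xc) * X\<^sup>2 / 3"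
proof -
  have l: "0 \<le> (n + 1) * xc" using xc n_bounds by auto
  have s: "s\<^sup>2 \<le> X\<^sup>2" using assms by (intro power_mono) auto
  have "2 * ((n + 1) * xc) * s\<^sup>2 * w \<le> 2 * ((n + 1) * xc) * X\<^sup>2 * 2 powr n"
    "\<beta> * ((n + 1) * xc) * s\<^sup>2 \<le> \<beta> * ((n + 1) * xc) * X\<^sup>2"
    using assms l s \<beta> xc n_bounds by (auto intro!: mult_mono mult_nonneg_nonneg)
  moreover have "0 \<le> 2 * ((n + 1) * xc) * s\<^sup>2 * w" "0 \<le> \<beta> * ((n + 1) * xc) * s\<^sup>2"
    using assms l \<beta> xc n_bounds by (auto intro!: mult_nonneg_nonneg)
  ultimately show "0 \<le> 1 - kap xc \<beta> s w"
    "1 - kap xc \<beta> s w \<le> 2 * ((n + 1) * xc) * X\<^sup>2 * 2 powr n + \<beta> * ((n + 1) * xc) * X\<^sup>2 / 3"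
    unfolding kap_def by linarith+
qed

lemma kap_half: "s \<in> {0..X} \<Longrightarrow> w \<in> {0..2 powr n} \<Longrightarrow> 1 / 2 \<le> kap xc \<beta> s w"
  using one_minus_kap(2)[of s w] kap_small by simp

lemma inv_kap: "s \<in> {0..X} \<Longrightarrow> w \<in> {0..2 powr n} \<Longrightarrow> \<bar>1 / kap xc \<beta> s w\<bar> \<le> 2"
  using kap_half[of s w] by (simp add: field_simps)

lemma press_range: "0 \<le> press xc y" "press xc y \<le> 2 powr n * (4 * xc)"
proof -
  have "(xc * trunc y) * \<Omega> (xc * trunc y) \<le> (2 * xc) * 2"
    by (rule mult_mono) (use \<Omega>_range[OF x_range(1)[of y]] x_range(2)[of y] xc in auto)
  moreover have "0 \<le> (xc * trunc y) * \<Omega> (xc * trunc y)"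
    by (rule mult_nonneg_nonneg[OF x_range(3)]) (use \<Omega>_range[OF x_range(1)[of y]] in auto)
  ultimately have "trunc y powr n * ((xc * trunc y) * \<Omega> (xc * trunc y)) \<le> 2 powr n * ((2 * xc) * 2)"
    by (intro mult_mono[OF trunc_powr_bounds(2)[OF n_bounds(3)]]) auto
  then show "press xc y \<le> 2 powr n * (4 * xc)" by (simp add: press_def mult.assoc)
  show "0 \<le> press xc y" unfolding press_def
  proof (rule mult_nonneg_nonneg[OF mult_nonneg_nonneg[OF _ x_range(3)]])
    show "0 \<le> \<Omega> (xc * trunc y)" using \<Omega>_range[OF x_range(1)[of y]] by linarith
  qed simp
qed

lemma xc_le: "xc \<le> 1" "2 * xc \<le> 1" using xc x0 by auto

lemma x_lip: "\<bar>xc * trunc x - xc * trunc y\<bar> \<le> \<bar>x - y\<bar>"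
proof -
  have "xc * \<bar>trunc x - trunc y\<bar> \<le> 1 * \<bar>x - y\<bar>"
    using xc xc_le trunc_lipschitz by (intro mult_mono) auto
  then show ?thesis using xc by (simp add: abs_mult right_diff_distrib[symmetric])
qed

lemma press_lip: "\<bar>press xc x - press xc y\<bar> \<le> (n * 2 powr n * 2 + 2 powr n * 2 + 2 powr n * L\<^sub>0) * \<bar>x - y\<bar>"
proof -
  have p: "\<bar>trunc x powr n - trunc y powr n\<bar> \<le> n * 2 powr n * \<bar>x - y\<bar>"
    using powr_lipschitz[OF n_bounds(3), of "trunc x" "trunc y"] n_bounds
    by (intro order_trans[OF _ mult_left_mono[OF trunc_lipschitz[of x y], of "n * 2 powr n"]]) (auto simp: trunc_range)
  have o: "\<bar>\<Omega> (xc * trunc x) - \<Omega> (xc * trunc y)\<bar> \<le> L\<^sub>0 * \<bar>x - y\<bar>"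
    by (rule order_trans[OF \<Omega>_lip[OF x_range(1) x_range(1)] mult_left_mono[OF x_lip L0]])
  have r: "\<bar>xc * trunc z\<bar> \<le> 1" for z using x_range[of z] xc_le by auto
  have r2: "\<bar>\<Omega> (xc * trunc z)\<bar> \<le> 2" for z using \<Omega>_range[OF x_range(1)[of z]] by auto
  have r3: "\<bar>trunc z powr n\<bar> \<le> 2 powr n" for z using trunc_powr_bounds[OF n_bounds(3), of z] by auto
  have "\<bar>press xc x - press xc y\<bar> \<le> \<bar>trunc x powr n - trunc y powr n\<bar> * (1 * 2)
      + 2 powr n * \<bar>xc * trunc x - xc * trunc y\<bar> * 2
      + 2 powr n * 1 * \<bar>\<Omega> (xc * trunc x) - \<Omega> (xc * trunc y)\<bar>"
    unfolding press_def by (rule product3_diff[OF r r2 r3 r])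
  also have "\<dots> \<le> (n * 2 powr n * \<bar>x - y\<bar>) * (1 * 2) + 2 powr n * \<bar>x - y\<bar> * 2 + 2 powr n * 1 * (L\<^sub>0 * \<bar>x - y\<bar>)"
    by (intro add_mono mult_left_mono mult_right_mono p x_lip o) auto
  finally show ?thesis by (simp add: algebra_simps)
qed

lemma force_bound: "w \<in> {0..2 powr n} \<Longrightarrow> \<bar>force xc \<beta> w y\<bar> \<le> 3 * 2 powr n + 1"
proof -
  assume w: "w \<in> {0..2 powr n}"
  have "2 powr n * (4 * xc) \<le> 2 powr n * 2" using xc_le by (intro mult_left_mono) auto
  then have "press xc y \<le> 2 * 2 powr n" using press_range(2)[of y] by linarith
  then show ?thesis using press_range(1)[of y] w \<beta> unfolding force_def atLeastAtMost_iff by linarith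
qed

lemma slope_bound: "\<bar>slope (xc * trunc y)\<bar> \<le> 2"
  using slope_range[OF x_range(1)[of y]] by simp

lemma rate_bound:
  assumes "s \<in> {0..X}" "w \<in> {0..2 powr n}"
  shows "\<bar>rate xc \<beta> s w y\<bar> \<le> s * (4 * (3 * 2 powr n + 1))"
proof -
  have "\<bar>force xc \<beta> w y\<bar> * \<bar>slope (xc * trunc y)\<bar> * \<bar>1 / kap xc \<beta> s w\<bar> \<le> (3 * 2 powr n + 1) * 2 * 2"
    by (intro mult_mono force_bound slope_bound inv_kap assms) auto
  then have "s * (\<bar>force xc \<beta> w y\<bar> * \<bar>slope (xc * trunc y)\<bar> * \<bar>1 / kap xc \<beta> s w\<bar>) \<le> s * ((3 * 2 powr n + 1) * 2 * 2)"
    using assms by (intro mult_left_mono) auto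
  then show ?thesis using assms by (simp add: rate_def abs_mult algebra_simps)
qed

lemma inv_kap_lip:
  assumes "s \<in> {0..X}" "v \<in> {0..2 powr n}" "w \<in> {0..2 powr n}"
  shows "\<bar>1 / kap xc \<beta> s v - 1 / kap xc \<beta> s w\<bar> \<le> 4 * (2 * ((n + 1) * xc) * X\<^sup>2 * \<bar>v - w\<bar>)"
proof -
  have kv: "1 / 2 \<le> kap xc \<beta> s v" and kw: "1 / 2 \<le> kap xc \<beta> s w" using assms kap_half by auto
  have l: "0 \<le> (n + 1) * xc" using xc n_bounds by auto
  have s: "s\<^sup>2 \<le> X\<^sup>2" using assms by (intro power_mono) auto
  have "1 / kap xc \<beta> s v - 1 / kap xc \<beta> s w = (1 / kap xc \<beta> s v) * (1 / kap xc \<beta> s w) * (kap xc \<beta> s w - kap xc \<beta> s v)"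
    using kv kw by (simp add: field_simps)
  also have "kap xc \<beta> s w - kap xc \<beta> s v = 2 * ((n + 1) * xc) * s\<^sup>2 * (v - w)"
    by (simp add: kap_def algebra_simps)
  finally have e: "1 / kap xc \<beta> s v - 1 / kap xc \<beta> s w =
    1 / kap xc \<beta> s v * (1 / kap xc \<beta> s w) * (2 * ((n + 1) * xc) * s\<^sup>2 * (v - w))" .
  have "\<bar>1 / kap xc \<beta> s v - 1 / kap xc \<beta> s w\<bar>
      = \<bar>1 / kap xc \<beta> s v\<bar> * \<bar>1 / kap xc \<beta> s w\<bar> * (2 * ((n + 1) * xc) * s\<^sup>2 * \<bar>v - w\<bar>)"
  proof -
    have "\<bar>a * b * (c * d)\<bar> = \<bar>a\<bar> * \<bar>b\<bar> * (c * \<bar>d\<bar>)" if "0 \<le> c" for a b c d :: real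
      using that by (simp add: abs_mult)
    moreover have "0 \<le> 2 * ((n + 1) * xc) * s\<^sup>2" using l by simp
    ultimately show ?thesis unfolding e by blast
  qed
  also have "\<dots> \<le> 2 * 2 * (2 * ((n + 1) * xc) * X\<^sup>2 * \<bar>v - w\<bar>)"
    using assms l s xc n_bounds by (intro mult_mono inv_kap) (auto intro!: mult_nonneg_nonneg)
  finally show ?thesis by simp
qed

text \<open>L may depend on \<open>xc\<close> and \<open>\<beta>\<close>: it serves existence and
  uniqueness for a single star, whereas the uniform comparison runs with the constant of the
  Lane-Emden kernel.\<close>

lemma scaled_volterra: "\<exists>L. volterra (rate xc \<beta>) X L n"
proof -
  define B where "B = 3 * 2 powr n + 1"
  define P where "P = n * 2 powr n * 2 + 2 powr n * 2 + 2 powr n * L\<^sub>0"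
  define R where "R = 4 * (2 * ((n + 1) * xc) * X\<^sup>2)"
  define C where "C = (1 + P) * 4 + B * L\<^sub>0 * 2 + B * 2 * R"
  define L where "L = X * C + 1"
  have B: "0 \<le> B" by (simp add: B_def)
  have P: "0 \<le> P" using n_bounds L0 by (simp add: P_def)
  have R: "0 \<le> R" using n_bounds xc by (simp add: R_def)
  have C: "0 \<le> C" unfolding C_def using B P R L0 by simp
  have sl: "\<bar>slope (xc * trunc x) - slope (xc * trunc y)\<bar> \<le> L\<^sub>0 * \<bar>x - y\<bar>" for x y
    by (rule order_trans[OF slope_lip[OF x_range(1) x_range(1)] mult_left_mono[OF x_lip L0]])
  have "volterra (rate xc \<beta>) X L n"
  proof
    show "0 < L" unfolding L_def using C Xpos by (simp add: add_nonneg_pos)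
    show "\<bar>rate xc \<beta> s v x - rate xc \<beta> s w y\<bar> \<le> L * (\<bar>v - w\<bar> + \<bar>x - y\<bar>)"
      if s: "s \<in> {0..X}" and v: "v \<in> {0..2 powr n}" and w: "w \<in> {0..2 powr n}" for s v w x y
    proof -
      define D where "D = \<bar>v - w\<bar> + \<bar>x - y\<bar>"
      have Dv: "\<bar>v - w\<bar> \<le> D" and Dx: "\<bar>x - y\<bar> \<le> D" and D0: "0 \<le> D" by (auto simp: D_def)
      have "\<bar>force xc \<beta> v x - force xc \<beta> w y\<bar> \<le> \<bar>v - w\<bar> + \<bar>press xc x - press xc y\<bar>"
        by (simp add: force_def)
      also have "\<dots> \<le> D + P * D"
        using press_lip[of x y] mult_left_mono[OF Dx P] Dv by (simp add: P_def)
      finally have f: "\<bar>force xc \<beta> v x - force xc \<beta> w y\<bar> \<le> (1 + P) * D" by (simp add: algebra_simps)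
      have sl': "\<bar>slope (xc * trunc x) - slope (xc * trunc y)\<bar> \<le> L\<^sub>0 * D"
        by (rule order_trans[OF sl mult_left_mono[OF Dx L0]])
      have ik: "\<bar>1 / kap xc \<beta> s v - 1 / kap xc \<beta> s w\<bar> \<le> R * D"
        using inv_kap_lip[OF s v w] mult_left_mono[OF Dv R] by (simp add: R_def)
      have "\<bar>force xc \<beta> v x * slope (xc * trunc x) * (1 / kap xc \<beta> s v) -
          force xc \<beta> w y * slope (xc * trunc y) * (1 / kap xc \<beta> s w)\<bar>
          \<le> \<bar>force xc \<beta> v x - force xc \<beta> w y\<bar> * (2 * 2)
            + B * \<bar>slope (xc * trunc x) - slope (xc * trunc y)\<bar> * 2
            + B * 2 * \<bar>1 / kap xc \<beta> s v - 1 / kap xc \<beta> s w\<bar>"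
        unfolding B_def by (rule product3_diff[OF slope_bound inv_kap[OF s v] force_bound[OF w] slope_bound])
      also have "\<dots> \<le> ((1 + P) * D) * (2 * 2) + B * (L\<^sub>0 * D) * 2 + B * 2 * (R * D)"
        by (intro add_mono mult_left_mono mult_right_mono f sl' ik) (use B in auto)
      also have "\<dots> = C * D" by (simp add: C_def algebra_simps)
      finally have "s * \<bar>force xc \<beta> v x * slope (xc * trunc x) * (1 / kap xc \<beta> s v) -
          force xc \<beta> w y * slope (xc * trunc y) * (1 / kap xc \<beta> s w)\<bar>
          \<le> X * (C * D)"
        using s C D0 by (intro mult_mono[of s X]) auto
      also have "\<dots> \<le> L * D" unfolding L_def using D0 by (simp add: algebra_simps)
      finally have "s * \<bar>force xc \<beta> v x * slope (xc * trunc x) * (1 / kap xc \<beta> s v) -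
          force xc \<beta> w y * slope (xc * trunc y) * (1 / kap xc \<beta> s w)\<bar> \<le> L * D" .
      moreover have "\<bar>s * a - s * b\<bar> = s * \<bar>a - b\<bar>" for a b
        using s by (simp add: abs_mult flip: right_diff_distrib)
      ultimately show ?thesis by (simp only: rate_def D_def)
    qed
    show "continuous_on S (\<lambda>s. rate xc \<beta> s (w s) (\<theta> s))"
      if S: "S \<subseteq> {0..X}" and w: "continuous_on S w" "w ` S \<subseteq> {0..2 powr n}" and \<theta>: "continuous_on S \<theta>" for S w \<theta>
    proof -
      have c\<Omega>: "continuous_on {0..x\<^sub>0} \<Omega>"
        by (rule DERIV_continuous_on[OF has_field_derivative_at_within[OF \<Omega>_deriv]])
      have xr: "(\<lambda>s. xc * trunc (\<theta> s)) ` S \<subseteq> {0..x\<^sub>0}"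
        by (rule image_subsetI) (rule x_range(1))
      have ct: "continuous_on S (\<lambda>s. xc * trunc (\<theta> s))" by (intro continuous_intros \<theta>)
      have ck: "continuous_on S (\<lambda>s. kap xc \<beta> s (w s))" unfolding kap_def
        by (intro continuous_on_diff continuous_on_mult continuous_on_divide continuous_on_power
            continuous_on_const continuous_on_id w) simp
      have kn: "\<forall>s\<in>S. kap xc \<beta> s (w s) \<noteq> 0"
      proof
        fix s assume "s \<in> S"
        then have "1 / 2 \<le> kap xc \<beta> s (w s)" using S w(2) by (intro kap_half) auto
        then show "kap xc \<beta> s (w s) \<noteq> 0" by auto
      qed
      have cp: "continuous_on S (\<lambda>s. press xc (\<theta> s))" unfolding press_def
        by (rule continuous_on_mult[OF continuous_on_mult[OF continuous_on_trunc_powr[OF n_bounds(3) \<theta>] ct]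
            continuous_on_compose2[OF c\<Omega> ct xr]])
      have csl: "continuous_on S (\<lambda>s. slope (xc * trunc (\<theta> s)))"
        by (rule continuous_on_compose2[OF slope_cont ct xr])
      have cik: "continuous_on S (\<lambda>s. 1 / kap xc \<beta> s (w s))"
        by (rule continuous_on_divide[OF continuous_on_const ck kn])
      show ?thesis unfolding rate_def force_def
        by (intro continuous_on_mult[OF continuous_on_id continuous_on_mult[OF continuous_on_mult[OF _ csl] cik]]
            continuous_on_diff[OF continuous_on_add[OF w(1) cp] continuous_on_const])
    qed
  qed (use Xpos n_bounds in auto)
  then show ?thesis ..
qed

text \<open>The Lane-Emden kernel is s times the product w * 1 * 1, and \<open>force\<close>,
  \<open>slope\<close> and 1 / \<open>kap\<close> differ from w, 1 and 1 by multiples of \<epsilon>.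
  The constant is free of \<open>xc\<close> and \<open>\<beta>\<close>, so \<epsilon> can be chosen
  after it.\<close>

lemma rate_lane_emden:
  assumes e: "xc \<le> \<epsilon>" "\<beta> \<le> \<epsilon>" and s: "s \<in> {0..X}" and w: "w \<in> {0..2 powr n}"
  shows "\<bar>rate xc \<beta> s w y - s * w\<bar> \<le> \<epsilon> * (X * (4 * (4 * 2 powr n + 1) + 2 powr n * (2 * L\<^sub>0) * 2
    + 2 powr n * 2 * (2 * (2 * (n + 1) * X\<^sup>2 * 2 powr n + (n + 1) * X\<^sup>2))))"
proof -
  have e0: "0 < \<epsilon>" using xc e by linarith
  have "2 powr n * (4 * xc) \<le> 2 powr n * (4 * \<epsilon>)" using e by (intro mult_left_mono) auto
  then have "press xc y \<le> 2 powr n * (4 * \<epsilon>)" using press_range[of y] by linarith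
  then have f: "\<bar>force xc \<beta> w y - w\<bar> \<le> \<epsilon> * (4 * 2 powr n + 1)"
    using press_range(1)[of y] \<beta> e unfolding force_def by (simp add: algebra_simps)
  have "\<bar>slope (xc * trunc y) - 1\<bar> \<le> L\<^sub>0 * \<bar>xc * trunc y - 0\<bar>"
    using slope_lip[OF x_range(1)[of y], of 0] x0 slope_0 by auto
  also have "\<dots> \<le> L\<^sub>0 * (2 * \<epsilon>)" using x_range(2,3)[of y] e L0 by (intro mult_left_mono) auto
  finally have sl: "\<bar>slope (xc * trunc y) - 1\<bar> \<le> \<epsilon> * (2 * L\<^sub>0)" by (simp add: mult_ac)
  have kh: "1 / 2 \<le> kap xc \<beta> s w" using kap_half s w by auto
  have n0: "0 \<le> n + 1" using n_bounds by simp
  have "1 / kap xc \<beta> s w - 1 = 1 / kap xc \<beta> s w * (1 - kap xc \<beta> s w)" using kh by (simp add: field_simps)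
  then have "\<bar>1 / kap xc \<beta> s w - 1\<bar> = \<bar>1 / kap xc \<beta> s w\<bar> * \<bar>1 - kap xc \<beta> s w\<bar>"
    by (simp only: abs_mult)
  also have "\<dots> \<le> 2 * (2 * ((n + 1) * xc) * X\<^sup>2 * 2 powr n + \<beta> * ((n + 1) * xc) * X\<^sup>2 / 3)"
    using one_minus_kap[OF s w] by (intro mult_mono inv_kap s w) auto
  also have "\<dots> \<le> 2 * (2 * ((n + 1) * \<epsilon>) * X\<^sup>2 * 2 powr n + (n + 1) * \<epsilon> * X\<^sup>2)"
  proof -
    have l: "(n + 1) * xc \<le> (n + 1) * \<epsilon>" using e n0 by (intro mult_left_mono) auto
    then have a: "2 * ((n + 1) * xc) * X\<^sup>2 * 2 powr n \<le> 2 * ((n + 1) * \<epsilon>) * X\<^sup>2 * 2 powr n"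
      by (intro mult_right_mono) auto
    have l0: "0 \<le> (n + 1) * xc" using n0 xc by simp
    have "\<beta> * ((n + 1) * xc) \<le> 1 * ((n + 1) * \<epsilon>)" by (rule mult_mono) (use \<beta> l l0 in simp_all)
    then have b: "\<beta> * ((n + 1) * xc) * X\<^sup>2 \<le> (n + 1) * \<epsilon> * X\<^sup>2" by (intro mult_right_mono) auto
    have "0 \<le> (n + 1) * \<epsilon> * X\<^sup>2" using n0 e0 by simp
    moreover have "y / 3 \<le> y'" if "0 \<le> y'" "y \<le> y'" for y y' :: real
      using that by simp
    ultimately have "\<beta> * ((n + 1) * xc) * X\<^sup>2 / 3 \<le> (n + 1) * \<epsilon> * X\<^sup>2" using b by blast
    then show ?thesis by (intro mult_left_mono add_mono a) auto
  qed
  finally have ik: "\<bar>1 / kap xc \<beta> s w - 1\<bar> \<le> \<epsilon> * (2 * (2 * (n + 1) * X\<^sup>2 * 2 powr n + (n + 1) * X\<^sup>2))"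
    by (simp only: mult_ac distrib_left distrib_right)
  have w': "\<bar>w\<bar> \<le> 2 powr n" using w by auto
  have "\<bar>force xc \<beta> w y * slope (xc * trunc y) * (1 / kap xc \<beta> s w) - w * 1 * 1\<bar> \<le>
     \<bar>force xc \<beta> w y - w\<bar> * (2 * 2) + 2 powr n * \<bar>slope (xc * trunc y) - 1\<bar> * 2
      + 2 powr n * 2 * \<bar>1 / kap xc \<beta> s w - 1\<bar>"
    by (rule product3_diff[OF slope_bound inv_kap[OF s w] w']) simp
  also have "\<dots> \<le> (\<epsilon> * (4 * 2 powr n + 1)) * (2 * 2) + 2 powr n * (\<epsilon> * (2 * L\<^sub>0)) * 2
      + 2 powr n * 2 * (\<epsilon> * (2 * (2 * (n + 1) * X\<^sup>2 * 2 powr n + (n + 1) * X\<^sup>2)))"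
    by (intro add_mono mult_left_mono mult_right_mono f sl ik) auto
  also have "\<dots> = \<epsilon> * (4 * (4 * 2 powr n + 1) + 2 powr n * (2 * L\<^sub>0) * 2
      + 2 powr n * 2 * (2 * (2 * (n + 1) * X\<^sup>2 * 2 powr n + (n + 1) * X\<^sup>2)))" (is "_ = \<epsilon> * ?D")
    by (simp add: algebra_simps)
  finally have "s * \<bar>force xc \<beta> w y * slope (xc * trunc y) * (1 / kap xc \<beta> s w) - w * 1 * 1\<bar> \<le> X * (\<epsilon> * ?D)"
    using s e0 L0 n0 by (intro mult_mono) (auto intro!: mult_nonneg_nonneg add_nonneg_nonneg)
  moreover have "\<bar>s * a - s * b\<bar> = s * \<bar>a - b\<bar>" for a b
    using s by (simp add: abs_mult flip: right_diff_distrib)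
  ultimately show ?thesis by (simp only: rate_def mult_1_right mult.left_commute[of X \<epsilon>])
qed


text \<open>The kernel is at most a constant times s, and integrating gives \<xi>^2. Uniformity in
  \<open>xc\<close> and \<open>\<beta>\<close> yields a common core on which \<open>\<theta>\<close>
  \<ge> 1/2; the same bound starts the expansion at the centre.\<close>

lemma fixed_point_near_one:
  assumes "continuous_on {0..X} \<theta>"
    and "\<And>\<xi>. \<xi> \<in> {0..X} \<Longrightarrow> \<theta> \<xi> = 1 - integral {0..\<xi>} (\<lambda>s. rate xc \<beta> s (avg n \<theta> s) (\<theta> s))"
    and \<xi>: "\<xi> \<in> {0..X}"
  shows "\<bar>\<theta> \<xi> - 1\<bar> \<le> 2 * (3 * 2 powr n + 1) * \<xi>\<^sup>2"
proof -
  obtain L where "volterra (rate xc \<beta>) X L n" using scaled_volterra by blast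
  then interpret volterra "rate xc \<beta>" X L n .
  define k where "k = 4 * (3 * 2 powr n + 1)"
  have I: "((\<lambda>s. s * k) has_integral (\<xi>\<^sup>2 / 2 * k)) {0..\<xi>}"
    using has_integral_mult_left[OF ident_has_integral[of 0 \<xi>], of k] \<xi> by simp
  have "norm (integral {0..\<xi>} (\<lambda>s. rate xc \<beta> s (avg n \<theta> s) (\<theta> s))) \<le> integral {0..\<xi>} (\<lambda>s. s * k)"
  proof (rule integral_norm_bound_integral)
    show "(\<lambda>s. rate xc \<beta> s (avg n \<theta> s) (\<theta> s)) integrable_on {0..\<xi>}"
      by (rule integrable_continuous_real[OF continuous_on_subset[OF integrand_cont[OF assms(1)]]]) (use \<xi> in auto)
    show "norm (rate xc \<beta> s (avg n \<theta> s) (\<theta> s)) \<le> s * k" if "s \<in> {0..\<xi>}" for s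
    proof -
      have s: "s \<in> {0..X}" using that \<xi> by auto
      then show ?thesis
        unfolding real_norm_def k_def using avg_bounds[OF n_bounds(3) assms(1) s] by (intro rate_bound) auto
    qed
  qed (use I in auto)
  also have "\<dots> = \<xi>\<^sup>2 / 2 * k" using I by (rule integral_unique)
  finally show ?thesis using assms(2)[OF \<xi>] by (simp add: k_def algebra_simps)
qed

end

section \<open>Profiles with a zero, uniformly for small xc and \<beta>\<close>

locale profile = scaled +
  fixes \<theta> :: "real \<Rightarrow> real" and z L :: real
  assumes volt: "volterra (rate xc \<beta>) X L n"
    and cont: "continuous_on {0..X} \<theta>"
    and fixp: "\<And>\<xi>. \<xi> \<in> {0..X} \<Longrightarrow> \<theta> \<xi> = 1 - integral {0..\<xi>} (\<lambda>s. rate xc \<beta> s (avg n \<theta> s) (\<theta> s))"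
    and z: "0 < z" "z < X" "\<theta> z = 0"
    and force_pos: "\<And>\<xi>. \<xi> \<in> {0..X} \<Longrightarrow> 0 < force xc \<beta> (avg n \<theta> \<xi>) (\<theta> \<xi>)"

context eos
begin

text \<open>All constants are fixed before \<open>xc\<close> and \<open>\<beta>\<close> appear: X
  and the negative value - d at X belong to the Lane-Emden solution, and the others are built from
  n, X, \<open>L\<^sub>0\<close> and \<open>x\<^sub>0\<close>.\<close>

lemma profile_exists:
  "\<exists>\<epsilon>>0. \<exists>X. \<forall>xc \<beta>. 0 < xc \<and> xc \<le> \<epsilon> \<and> 0 \<le> \<beta> \<and> \<beta> \<le> \<epsilon> \<longrightarrow>
      (\<exists>\<theta> z L. profile \<gamma> n \<Omega> \<Omega>' x\<^sub>0 L\<^sub>0 xc \<beta> X \<theta> z L)"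
proof -
  obtain X where X: "X > 0" and LE: "\<And>\<theta>. continuous_on {0..X} \<theta> \<Longrightarrow>
      (\<And>\<xi>. \<xi> \<in> {0..X} \<Longrightarrow> \<theta> \<xi> = 1 - integral {0..\<xi>} (\<lambda>s. s * avg n \<theta> s)) \<Longrightarrow> \<theta> X < 0"
    using lane_emden_zero[OF n_bounds(1,2)] by blast
  interpret LE: volterra "\<lambda>s w y. s * w" X "X + 1" n
    using lane_emden_volterra X n_bounds by simp
  obtain \<theta>\<^sub>0 where \<theta>0: "continuous_on {0..X} \<theta>\<^sub>0" "\<And>\<xi>. \<xi> \<in> {0..X} \<Longrightarrow> \<theta>\<^sub>0 \<xi> = LE.T \<theta>\<^sub>0 \<xi>"
    using LE.fixed_point_exists by blast
  define d where "d = - \<theta>\<^sub>0 X"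
  have d: "d > 0" using LE[OF \<theta>0(1)] \<theta>0(2) unfolding LE.T_def d_def by simp
  define D where "D = X * (4 * (4 * 2 powr n + 1) + 2 powr n * (2 * L\<^sub>0) * 2
    + 2 powr n * 2 * (2 * (2 * (n + 1) * X\<^sup>2 * 2 powr n + (n + 1) * X\<^sup>2)))"
  define E where "E = 2 * (X * D) * exp (LE.M * X)"
  define C where "C = 2 * (3 * 2 powr n + 1)"
  \<comment> \<open>Chosen so that C * (\<tau> * X)^2 \<le> 1/2, which gives \<open>\<theta>\<close>
    \<ge> 1/2 on [0, \<tau> * X]; the summand 1 ensures \<tau> \<le> 1.\<close>
  define \<tau> where "\<tau> = 1 / (1 + 2 * C * X\<^sup>2)"
  define wmin where "wmin = (1 / 2) powr n * (\<tau> ^ 3 / 3)"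
  define Kc where "Kc = (n + 1) * X\<^sup>2 * (2 * 2 powr n + 1)"
  have n0: "0 < n + 1" using n_bounds by simp
  have D: "0 \<le> D" unfolding D_def using X L0 n0 by simp
  have E: "0 \<le> E" unfolding E_def using X D by simp
  have C: "0 < C" unfolding C_def by (simp add: add_pos_pos)
  have CX: "0 \<le> C * X\<^sup>2" using C by simp
  have \<tau>: "0 < \<tau>" "\<tau> \<le> 1" unfolding \<tau>_def using CX by (auto simp: field_simps)
  have wmin: "0 < wmin" unfolding wmin_def using \<tau> by simp
  have Kc: "0 < Kc" unfolding Kc_def using n0 X by (simp add: add_pos_pos)
  \<comment> \<open>The entries 1 and \<open>x\<^sub>0\<close> / 4 give \<beta> \<le> 1 and 2 * xc <
    \<open>x\<^sub>0\<close>; \<open>wmin\<close> keeps \<beta> / 3 below the mean density; 1 / (2 *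
    Kc) gives the bound on \<open>kap\<close>; d / (E + 1) keeps the perturbed value at X less than
    d away from - d.\<close>
  define \<epsilon> where "\<epsilon> = min (min 1 (x\<^sub>0 / 4)) (min wmin (min (1 / (2 * Kc)) (d / (E + 1))))"
  have "\<epsilon> \<le> min 1 (x\<^sub>0 / 4)" "\<epsilon> \<le> min wmin (min (1 / (2 * Kc)) (d / (E + 1)))"
    unfolding \<epsilon>_def by (rule min.cobounded1, rule min.cobounded2)
  then have \<epsilon>_le: "\<epsilon> \<le> 1" "\<epsilon> \<le> x\<^sub>0 / 4" "\<epsilon> \<le> wmin" "\<epsilon> \<le> 1 / (2 * Kc)" "\<epsilon> \<le> d / (E + 1)"
    unfolding min.bounded_iff by blast+
  have "0 < \<epsilon>" using x0 wmin Kc d E by (simp add: \<epsilon>_def)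
  note \<epsilon> = this \<epsilon>_le
  have \<epsilon>K: "\<epsilon> * Kc \<le> 1 / 2" using \<epsilon>(5) Kc by (simp add: field_simps)
  have "\<epsilon> * (E + 1) \<le> d" using \<epsilon>(6) E by (simp add: field_simps)
  then have \<epsilon>E: "\<epsilon> * E < d" using \<epsilon>(1) by (simp add: algebra_simps)
  have "\<exists>\<theta> z L. profile \<gamma> n \<Omega> \<Omega>' x\<^sub>0 L\<^sub>0 xc \<beta> X \<theta> z L"
    if xc: "0 < xc" "xc \<le> \<epsilon>" and \<beta>: "0 \<le> \<beta>" "\<beta> \<le> \<epsilon>" for xc \<beta>
  proof -
    have kap: "2 * ((n + 1) * xc) * X\<^sup>2 * 2 powr n + \<beta> * ((n + 1) * xc) * X\<^sup>2 / 3 \<le> 1 / 2"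
    proof -
      have l: "0 \<le> (n + 1) * xc" "(n + 1) * xc \<le> (n + 1) * \<epsilon>" using xc n0 by simp_all
      have a: "((n + 1) * xc) * (2 * X\<^sup>2 * 2 powr n) \<le> ((n + 1) * \<epsilon>) * (2 * X\<^sup>2 * 2 powr n)"
        by (rule mult_right_mono[OF l(2)]) simp
      have "\<beta> * ((n + 1) * xc) \<le> 1 * ((n + 1) * \<epsilon>)"
        by (rule mult_mono) (use l \<beta> \<epsilon>(2) in simp_all)
      then have "\<beta> * ((n + 1) * xc) * X\<^sup>2 \<le> 1 * ((n + 1) * \<epsilon>) * X\<^sup>2"
        by (rule mult_right_mono) simp
      moreover have "0 \<le> \<beta> * ((n + 1) * xc) * X\<^sup>2" using \<beta> l by simp
      ultimately have b: "\<beta> * ((n + 1) * xc) * X\<^sup>2 / 3 \<le> (n + 1) * \<epsilon> * X\<^sup>2" by linarith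
      have "((n + 1) * \<epsilon>) * (2 * X\<^sup>2 * 2 powr n) + (n + 1) * \<epsilon> * X\<^sup>2 = \<epsilon> * Kc"
        by (simp add: Kc_def algebra_simps)
      moreover have "((n + 1) * xc) * (2 * X\<^sup>2 * 2 powr n) = 2 * ((n + 1) * xc) * X\<^sup>2 * 2 powr n"
        by simp
      moreover have "p'' + q \<le> 1 / 2" if "p' + q' = e" "p = p''" "p \<le> p'" "q \<le> q'" "e \<le> 1 / 2"
        for p q p' q' p'' e :: real using that by linarith
      ultimately show ?thesis using a b \<epsilon>K by blast
    qed
    have \<beta>1: "\<beta> \<le> 1" using \<beta> \<epsilon> by linarith
    have xc2: "2 * xc < x\<^sub>0" using xc \<epsilon> x0 by linarith
    interpret S: scaled \<gamma> n \<Omega> \<Omega>' x\<^sub>0 L\<^sub>0 xc \<beta> X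
      by unfold_locales (fact xc(1) xc2 \<beta>(1) \<beta>1 X kap)+
    obtain L where V: "volterra (rate xc \<beta>) X L n" using S.scaled_volterra by blast
    interpret V: volterra "rate xc \<beta>" X L n by (rule V)
    obtain \<theta> where cont: "continuous_on {0..X} \<theta>" and fp: "\<And>\<xi>. \<xi> \<in> {0..X} \<Longrightarrow> \<theta> \<xi> = V.T \<theta> \<xi>"
      using V.fixed_point_exists by blast
    have fp': "\<theta> \<xi> = 1 - integral {0..\<xi>} (\<lambda>s. rate xc \<beta> s (avg n \<theta> s) (\<theta> s))" if "\<xi> \<in> {0..X}" for \<xi>
      using fp[OF that] by (simp add: V.T_def)
    \<comment> \<open>The perturbed profile is inserted into the Lane-Emden operator and not
      conversely, so that \<open>LE.stability\<close> applies with constants independent of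
      \<open>xc\<close> and \<open>\<beta>\<close>.\<close>
    have defect: "\<bar>\<theta> \<xi> - LE.T \<theta> \<xi>\<bar> \<le> X * (\<epsilon> * D)" if \<xi>: "\<xi> \<in> {0..X}" for \<xi>
    proof -
      have i1: "(\<lambda>s. rate xc \<beta> s (avg n \<theta> s) (\<theta> s)) integrable_on {0..\<xi>}"
        by (rule integrable_continuous_real[OF continuous_on_subset[OF V.integrand_cont[OF cont]]]) (use \<xi> in auto)
      have i2: "(\<lambda>s. s * avg n \<theta> s) integrable_on {0..\<xi>}"
        by (rule integrable_continuous_real[OF continuous_on_subset[OF LE.integrand_cont[OF cont]]]) (use \<xi> in auto)
      have "\<bar>\<theta> \<xi> - LE.T \<theta> \<xi>\<bar> = norm (integral {0..\<xi>} (\<lambda>s. rate xc \<beta> s (avg n \<theta> s) (\<theta> s) - s * avg n \<theta> s))"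
        using i1 i2 by (subst integral_diff) (auto simp: fp'[OF \<xi>] LE.T_def)
      also have "\<dots> \<le> integral {0..\<xi>} (\<lambda>s. \<epsilon> * D)"
      proof (rule integral_norm_bound_integral)
        show "norm (rate xc \<beta> s (avg n \<theta> s) (\<theta> s) - s * avg n \<theta> s) \<le> \<epsilon> * D" if "s \<in> {0..\<xi>}" for s
        proof -
          have s: "s \<in> {0..X}" using that \<xi> by auto
          show ?thesis unfolding real_norm_def D_def
            by (rule S.rate_lane_emden[OF xc(2) \<beta>(2) s]) (use avg_bounds[OF n_bounds(3) cont s] in auto)
        qed
      qed (use i1 i2 in \<open>auto intro!: integrable_diff\<close>)
      also have "\<dots> = \<xi> * (\<epsilon> * D)" using \<xi> by simp
      also have "\<dots> \<le> X * (\<epsilon> * D)" by (rule mult_right_mono) (use \<xi> \<epsilon> D in auto)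
      finally show ?thesis .
    qed
    have "\<bar>\<theta> X - \<theta>\<^sub>0 X\<bar> \<le> 2 * (X * (\<epsilon> * D)) * exp (LE.M * X)"
      by (rule LE.stability[OF cont \<theta>0(1) defect \<theta>0(2)]) (use X in auto)
    also have "\<dots> = \<epsilon> * E" by (simp add: E_def)
    finally have neg: "\<theta> X < 0" using \<epsilon>E by (simp add: d_def)
    have \<theta>1: "\<theta> 0 = 1" using fp'[of 0] X by simp
    have "\<exists>z\<ge>0. z \<le> X \<and> \<theta> z = 0"
      by (rule IVT2') (use neg \<theta>1 X cont in auto)
    then obtain z where z: "0 \<le> z" "z \<le> X" "\<theta> z = 0" by blast
    have z': "0 < z" "z < X" using z neg \<theta>1 by (auto simp: less_le)
    \<comment> \<open>The pressure term is nonnegative, so it is enough that the mean density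
      exceeds \<beta> / 3; \<open>avg_lower\<close> ensures this on all of [0, X], beyond the zero
      as well.\<close>
    have fpos: "0 < force xc \<beta> (avg n \<theta> \<xi>) (\<theta> \<xi>)" if \<xi>: "\<xi> \<in> {0..X}" for \<xi>
    proof -
      have "wmin \<le> avg n \<theta> \<xi>" unfolding wmin_def
      proof (rule avg_lower[OF n_bounds(3) cont \<xi> \<tau>])
        fix t assume t: "t \<in> {0..\<tau> * X}"
        have "\<tau> * X \<le> 1 * X" using \<tau> X by (intro mult_right_mono) auto
        then have tX: "t \<in> {0..X}" using t by auto
        have "t\<^sup>2 \<le> (\<tau> * X)\<^sup>2" using t by (intro power_mono) auto
        then have "C * t\<^sup>2 \<le> C * (\<tau> * X)\<^sup>2" using C by (intro mult_left_mono) auto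
        also have "\<dots> = (C * X\<^sup>2 * \<tau>) * \<tau>" by (simp add: power2_eq_square)
        also have "\<dots> \<le> (1 / 2) * 1"
        proof (rule mult_mono)
          show "C * X\<^sup>2 * \<tau> \<le> 1 / 2" using CX by (simp add: \<tau>_def divide_simps add_pos_nonneg)
        qed (use \<tau> in auto)
        finally have "\<bar>\<theta> t - 1\<bar> \<le> 1 / 2"
          using S.fixed_point_near_one[OF cont fp' tX] by (simp add: C_def)
        then show "1 / 2 \<le> \<theta> t" by linarith
      qed
      then show ?thesis using S.press_range(1)[of "\<theta> \<xi>"] \<beta> \<epsilon> wmin by (simp add: force_def)
    qed
    have "profile \<gamma> n \<Omega> \<Omega>' x\<^sub>0 L\<^sub>0 xc \<beta> X \<theta> z L"
      by unfold_locales (fact V cont fp' z'(1) z'(2) z(3) fpos)+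
    then show ?thesis by blast
  qed
  then have "\<forall>xc \<beta>. 0 < xc \<and> xc \<le> \<epsilon> \<and> 0 \<le> \<beta> \<and> \<beta> \<le> \<epsilon> \<longrightarrow>
      (\<exists>\<theta> z L. profile \<gamma> n \<Omega> \<Omega>' x\<^sub>0 L\<^sub>0 xc \<beta> X \<theta> z L)" by simp
  then show ?thesis using \<epsilon>(1) by blast
qed

end

section \<open>The equation of state and the potential\<close>

locale gas = eos +
  fixes c A :: real
  assumes c: "0 < c" and A: "0 < A" and adm: "admissible_pressure c (gas_pressure c A \<gamma> \<Omega>)"
begin

abbreviation "Pf \<equiv> gas_pressure c A \<gamma> \<Omega>"

definition x_of :: "real \<Rightarrow> real" where "x_of \<rho> = A * \<rho> powr (\<gamma> - 1) / c\<^sup>2"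

lemma \<gamma>_n: "(\<gamma> - 1) * n = 1" "n * (\<gamma> - 1) = 1" "(\<gamma> - 1) * (n + 1) = \<gamma>"
  using \<gamma> by (auto simp: n_def field_simps)

lemma x_of_pos: "\<rho> > 0 \<Longrightarrow> x_of \<rho> > 0" using A c by (simp add: x_of_def)

lemma x_of_mono: "0 \<le> \<rho> \<Longrightarrow> \<rho> < \<sigma> \<Longrightarrow> x_of \<rho> < x_of \<sigma>"
  using A c \<gamma> by (simp add: x_of_def divide_strict_right_mono powr_less_mono2)

lemma x_of_inverse: "0 < \<rho> \<Longrightarrow> (c\<^sup>2 * x_of \<rho> / A) powr n = \<rho>"
  using A c \<gamma>_n by (simp add: x_of_def powr_powr)

lemma x_of_inverse': "0 < x \<Longrightarrow> x_of ((c\<^sup>2 * x / A) powr n) = x"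
  using A c \<gamma>_n by (simp add: x_of_def powr_powr)

lemma x_of_scale: "0 \<le> \<rho> \<Longrightarrow> 0 \<le> y \<Longrightarrow> x_of (\<rho> * y powr n) = x_of \<rho> * y"
  using \<gamma>_n by (cases "y = 0") (simp_all add: x_of_def powr_mult powr_powr)

lemma Pf_x: "\<rho> \<ge> 0 \<Longrightarrow> Pf \<rho> = c\<^sup>2 * \<rho> * x_of \<rho> * \<Omega> (x_of \<rho>)"
proof (cases "\<rho> = 0")
  case False
  assume "\<rho> \<ge> 0"
  then have "\<rho> powr \<gamma> = \<rho> * \<rho> powr (\<gamma> - 1)" using False by (simp add: powr_diff)
  then show ?thesis using c by (simp add: gas_pressure_def x_of_def)
qed (simp add: gas_pressure_def)

lemma Pf_pos: "\<rho> > 0 \<Longrightarrow> Pf \<rho> > 0"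
  and Pf_has_deriv: "\<rho> > 0 \<Longrightarrow> (Pf has_real_derivative deriv Pf \<rho>) (at \<rho>)"
  and Pf_deriv_pos: "\<rho> > 0 \<Longrightarrow> deriv Pf \<rho> > 0"
  and Pf_at_0: "(Pf \<longlongrightarrow> 0) (at_right 0)"
  using adm unfolding admissible_pressure_def
  by (auto simp: DERIV_deriv_iff_real_differentiable)

lemma Pf_strict_mono: "0 < \<rho> \<Longrightarrow> \<rho> < \<sigma> \<Longrightarrow> Pf \<rho> < Pf \<sigma>"
proof (rule DERIV_pos_imp_increasing[of \<rho> \<sigma>])
  fix x assume "0 < \<rho>" "\<rho> \<le> x"
  then have "0 < x" by simp
  then show "\<exists>y. (Pf has_real_derivative y) (at x) \<and> 0 < y" using Pf_has_deriv Pf_deriv_pos by blast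
qed

lemma x_of_deriv: "\<rho> > 0 \<Longrightarrow> (x_of has_real_derivative (\<gamma> - 1) * x_of \<rho> / \<rho>) (at \<rho>)"
proof -
  assume \<rho>: "\<rho> > 0"
  have "(x_of has_real_derivative A * ((\<gamma> - 1) * \<rho> powr (\<gamma> - 1 - 1)) / c\<^sup>2) (at \<rho>)"
    unfolding x_of_def[abs_def] by (intro DERIV_cdivide DERIV_cmult has_real_derivative_powr \<rho>)
  moreover have "\<rho> powr (\<gamma> - 1 - 1) = \<rho> powr (\<gamma> - 1) / \<rho>"
    using \<rho> powr_diff[of \<rho> "\<gamma> - 1" 1] by simp
  ultimately show ?thesis by (simp add: x_of_def mult_ac)
qed

text \<open>From P = c^2 * \<rho> * x * \<Omega> x and \<rho> * dx/d\<rho> = (\<gamma> - 1) * x, the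
  derivative is c^2 * x times the denominator of \<open>slope\<close>.\<close>

lemma Pf_deriv:
  assumes "\<rho> > 0" "x_of \<rho> \<le> x\<^sub>0"
  shows "deriv Pf \<rho> = c\<^sup>2 * \<gamma> * x_of \<rho> * (1 + x_of \<rho> * \<Omega> (x_of \<rho>)) / slope (x_of \<rho>)"
proof -
  define x where "x = x_of \<rho>"
  have x: "x \<in> {0..x\<^sub>0}" using assms x_of_pos[of \<rho>] by (simp add: x_def)
  have \<Omega>x: "((\<lambda>\<rho>. \<Omega> (x_of \<rho>)) has_real_derivative \<Omega>' x * ((\<gamma> - 1) * x / \<rho>)) (at \<rho>)"
    unfolding x_def by (rule DERIV_chain2[OF \<Omega>_deriv x_of_deriv]) (use x assms in \<open>auto simp: x_def\<close>)
  have D0: "((\<lambda>\<rho>. c\<^sup>2 * (\<rho> * (x_of \<rho> * \<Omega> (x_of \<rho>)))) has_real_derivative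
      c\<^sup>2 * (x * \<Omega> x + \<rho> * (((\<gamma> - 1) * x / \<rho>) * \<Omega> x + x * (\<Omega>' x * ((\<gamma> - 1) * x / \<rho>))))) (at \<rho>)"
    using DERIV_cmult[OF DERIV_mult[OF DERIV_ident DERIV_mult[OF x_of_deriv[OF assms(1)] \<Omega>x]], of "c\<^sup>2"]
    by (simp add: x_def algebra_simps)
  have e: "c\<^sup>2 * (x * \<Omega> x + \<rho> * (((\<gamma> - 1) * x / \<rho>) * \<Omega> x + x * (\<Omega>' x * ((\<gamma> - 1) * x / \<rho>))))
      = c\<^sup>2 * x * (\<gamma> * \<Omega> x + (\<gamma> - 1) * x * \<Omega>' x)"
    using assms by (simp add: field_simps)
  have ev: "eventually (\<lambda>\<rho>. c\<^sup>2 * (\<rho> * (x_of \<rho> * \<Omega> (x_of \<rho>))) = Pf \<rho>) (nhds \<rho>)"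
    using eventually_nhds_in_open[of "{0<..}" \<rho>] assms(1) by (auto elim!: eventually_mono simp: Pf_x)
  have D: "(Pf has_real_derivative c\<^sup>2 * x * (\<gamma> * \<Omega> x + (\<gamma> - 1) * x * \<Omega>' x)) (at \<rho>)"
    by (rule DERIV_cong_ev[OF refl ev refl, THEN iffD1, OF D0[unfolded e]])
  have pos: "1 + x * \<Omega> x > 0" using x \<Omega>_range[OF x] by (intro add_pos_nonneg mult_nonneg_nonneg) auto
  have "c\<^sup>2 * x * (\<gamma> * \<Omega> x + (\<gamma> - 1) * x * \<Omega>' x) = c\<^sup>2 * \<gamma> * x * (1 + x * \<Omega> x) / slope x"
    using den_pos[OF x] pos \<gamma> by (simp add: slope_def)
  then show ?thesis using DERIV_imp_deriv[OF D] by (simp add: x_def)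
qed

text \<open>The potential divided by c^2 * (n + 1), as a function of x. Since \<open>slope\<close>
  lies between 1/2 and 2, it is comparable with x itself.\<close>

definition V where "V x = integral {0..x} (\<lambda>x. 1 / slope x)"

lemma inv_slope_cont: "continuous_on {0..x\<^sub>0} (\<lambda>x. 1 / slope x)"
proof (intro continuous_on_divide continuous_on_const slope_cont ballI)
  show "slope x \<noteq> 0" if "x \<in> {0..x\<^sub>0}" for x using slope_range[OF that] by auto
qed

lemma V_bounds:
  assumes "x \<in> {0..x\<^sub>0}"
  shows "x / 2 \<le> V x" "V x \<le> 2 * x"
proof -
  have int: "((\<lambda>x. 1 / slope x) has_integral V x) {0..x}"
    unfolding V_def
    by (rule integrable_integral[OF integrable_continuous_real[OF continuous_on_subset[OF inv_slope_cont]]]) (use assms in auto)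
  have k: "((\<lambda>_. k) has_integral x * k) {0..x}" for k :: real
    using has_integral_const_real[of k 0 x] assms by simp
  have b: "1 / 2 \<le> 1 / slope y \<and> 1 / slope y \<le> 2" if "y \<in> {0..x}" for y
  proof -
    have "y \<in> {0..x\<^sub>0}" using that assms by auto
    from slope_range[OF this] show ?thesis by (auto simp: field_simps)
  qed
  show "x / 2 \<le> V x" using has_integral_le[OF k[of "1 / 2"] int] b by auto
  show "V x \<le> 2 * x" using has_integral_le[OF int k[of 2]] b by auto
qed

abbreviation "du \<equiv> \<lambda>\<rho>. deriv Pf \<rho> / (\<rho> + Pf \<rho> / c\<^sup>2)"

text \<open>The integrand may be singular at 0, but its primitive is continuous up to 0, so the
  fundamental theorem is applied on the interior. The factor n + 1 equals \<gamma> / (\<gamma> -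
  1).\<close>

lemma du_has_integral:
  assumes "\<rho> > 0" "x_of \<rho> \<le> x\<^sub>0"
  shows "(du has_integral c\<^sup>2 * (n + 1) * V (x_of \<rho>)) {0..\<rho>}"
proof -
  have Vc: "continuous_on {0..x\<^sub>0} V" unfolding V_def[abs_def]
    by (rule indefinite_integral_continuous_1[OF integrable_continuous_real[OF inv_slope_cont]])
  have xc: "continuous_on {0..\<rho>} x_of" unfolding x_of_def[abs_def]
    by (intro continuous_on_divide continuous_on_mult continuous_on_const continuous_on_powr' continuous_on_id)
      (use c \<gamma> in auto)
  have le: "x_of \<sigma> \<le> x\<^sub>0" if "0 \<le> \<sigma>" "\<sigma> \<le> \<rho>" for \<sigma>
    using x_of_mono[of \<sigma> \<rho>] that assms by (cases "\<sigma> = \<rho>") auto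
  have nn: "0 \<le> x_of \<sigma>" for \<sigma> using A by (simp add: x_of_def)
  have "(du has_integral c\<^sup>2 * (n + 1) * V (x_of \<rho>) - c\<^sup>2 * (n + 1) * V (x_of 0)) {0..\<rho>}"
  proof (rule fundamental_theorem_of_calculus_interior)
    show "continuous_on {0..\<rho>} (\<lambda>\<rho>. c\<^sup>2 * (n + 1) * V (x_of \<rho>))"
      by (intro continuous_on_mult continuous_on_const continuous_on_compose2[OF Vc xc]) (use nn le in auto)
    fix \<sigma> assume \<sigma>: "\<sigma> \<in> {0<..<\<rho>}"
    have x: "0 < x_of \<sigma>" "x_of \<sigma> < x\<^sub>0" using \<sigma> x_of_pos[of \<sigma>] x_of_mono[of \<sigma> \<rho>] assms by auto
    have DV: "(V has_real_derivative 1 / slope (x_of \<sigma>)) (at (x_of \<sigma>))"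
      using integral_has_real_derivative[OF inv_slope_cont, of "x_of \<sigma>"] x at_within_Icc_at[of 0 "x_of \<sigma>" x\<^sub>0]
      unfolding V_def[abs_def] by simp
    have "((\<lambda>\<rho>. c\<^sup>2 * (n + 1) * V (x_of \<rho>)) has_real_derivative
        c\<^sup>2 * (n + 1) * (1 / slope (x_of \<sigma>) * ((\<gamma> - 1) * x_of \<sigma> / \<sigma>))) (at \<sigma>)"
      by (rule DERIV_cmult[OF DERIV_chain2[OF DV x_of_deriv]]) (use \<sigma> in auto)
    moreover have "c\<^sup>2 * (n + 1) * (1 / slope (x_of \<sigma>) * ((\<gamma> - 1) * x_of \<sigma> / \<sigma>)) = du \<sigma>"
    proof -
      define x where "x = x_of \<sigma>"
      have pos: "1 + x * \<Omega> x > 0"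
        using \<Omega>_range[of x] x by (intro add_pos_nonneg mult_nonneg_nonneg) (auto simp: x_def)
      have "\<sigma> + Pf \<sigma> / c\<^sup>2 = \<sigma> * (1 + x * \<Omega> x)" using \<sigma> c by (simp add: Pf_x x_def algebra_simps)
      then have "du \<sigma> = c\<^sup>2 * \<gamma> * x / (slope x * \<sigma>)"
        using Pf_deriv[of \<sigma>] \<sigma> x pos by (simp add: x_def)
      also have "\<dots> = c\<^sup>2 * ((\<gamma> - 1) * (n + 1)) * x / (slope x * \<sigma>)" by (simp add: \<gamma>_n)
      finally show ?thesis by (simp add: x_def mult_ac)
    qed
    ultimately show "((\<lambda>\<rho>. c\<^sup>2 * (n + 1) * V (x_of \<rho>)) has_vector_derivative du \<sigma>) (at \<sigma>)"
      by (simp add: has_real_derivative_iff_has_vector_derivative[symmetric])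
  qed (use assms in auto)
  moreover have "V (x_of 0) = 0" by (simp add: x_of_def V_def)
  ultimately show ?thesis by simp
qed

text \<open>Writing the integrand as $c^2\bigl((\ln(\rho+P/c^2))' - 1/(\rho+P/c^2)\bigr)$ avoids any
  continuity of the derivative of the pressure.\<close>

lemma du_integrable:
  assumes "0 < \<rho>" "\<rho> \<le> \<sigma>"
  shows "du integrable_on {\<rho>..\<sigma>}"
proof -
  have pos: "0 < \<tau> + Pf \<tau> / c\<^sup>2" if "\<tau> \<in> {\<rho>..\<sigma>}" for \<tau>
    using that assms Pf_pos[of \<tau>] c by (intro add_pos_pos) auto
  have "((\<lambda>\<tau>. (1 + deriv Pf \<tau> / c\<^sup>2) / (\<tau> + Pf \<tau> / c\<^sup>2)) has_integral
      ln (\<sigma> + Pf \<sigma> / c\<^sup>2) - ln (\<rho> + Pf \<rho> / c\<^sup>2)) {\<rho>..\<sigma>}"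
  proof (rule fundamental_theorem_of_calculus[OF assms(2)])
    fix \<tau> assume \<tau>: "\<tau> \<in> {\<rho>..\<sigma>}"
    have "((\<lambda>\<tau>. ln (\<tau> + Pf \<tau> / c\<^sup>2)) has_real_derivative
        (1 / (\<tau> + Pf \<tau> / c\<^sup>2)) * (1 + deriv Pf \<tau> / c\<^sup>2)) (at \<tau>)"
      by (rule DERIV_chain2[OF DERIV_ln_divide[OF pos[OF \<tau>]]
            DERIV_add[OF DERIV_ident DERIV_cdivide[OF Pf_has_deriv]]]) (use \<tau> assms in auto)
    then show "((\<lambda>\<tau>. ln (\<tau> + Pf \<tau> / c\<^sup>2)) has_vector_derivative
        (1 + deriv Pf \<tau> / c\<^sup>2) / (\<tau> + Pf \<tau> / c\<^sup>2)) (at \<tau> within {\<rho>..\<sigma>})"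
      by (simp add: has_real_derivative_iff_has_vector_derivative[symmetric] has_field_derivative_at_within)
  qed
  then have i1: "(\<lambda>\<tau>. (1 + deriv Pf \<tau> / c\<^sup>2) / (\<tau> + Pf \<tau> / c\<^sup>2)) integrable_on {\<rho>..\<sigma>}" by blast
  have cP: "continuous_on {\<rho>..\<sigma>} Pf"
    by (rule DERIV_continuous_on[OF has_field_derivative_at_within[OF Pf_has_deriv]]) (use assms in auto)
  have "\<tau> + Pf \<tau> / c\<^sup>2 \<noteq> 0" if "\<tau> \<in> {\<rho>..\<sigma>}" for \<tau> using pos[OF that] by simp
  then have "continuous_on {\<rho>..\<sigma>} (\<lambda>\<tau>. 1 / (\<tau> + Pf \<tau> / c\<^sup>2))"
    by (intro continuous_on_divide continuous_on_add continuous_on_const continuous_on_id cP) (use c in auto)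
  then have i2: "(\<lambda>\<tau>. 1 / (\<tau> + Pf \<tau> / c\<^sup>2)) integrable_on {\<rho>..\<sigma>}" by (rule integrable_continuous_real)
  have "(\<lambda>\<tau>. c\<^sup>2 * ((1 + deriv Pf \<tau> / c\<^sup>2) / (\<tau> + Pf \<tau> / c\<^sup>2) - 1 / (\<tau> + Pf \<tau> / c\<^sup>2))) integrable_on {\<rho>..\<sigma>}"
    by (intro integrable_on_mult_right integrable_diff i1 i2)
  moreover have "c\<^sup>2 * ((1 + deriv Pf \<tau> / c\<^sup>2) / (\<tau> + Pf \<tau> / c\<^sup>2) - 1 / (\<tau> + Pf \<tau> / c\<^sup>2)) = du \<tau>" for \<tau>
  proof -
    have "c\<^sup>2 * ((1 + p / c\<^sup>2) / b - 1 / b) = p / b" for p b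
      using c by (simp add: diff_divide_distrib[symmetric])
    then show ?thesis .
  qed
  ultimately show ?thesis by simp
qed

text \<open>Smallness is assumed of the potential, while \<Omega> is controlled only for x \<le>
  \<open>x\<^sub>0\<close>. As the integrand is nonnegative, a central density beyond the one with x
  = \<open>x\<^sub>0\<close> would force the potential to be at least c^2 * (n + 1) *
  \<open>x\<^sub>0\<close> / 2, against the hypothesis.\<close>

lemma central_potential_bounds:
  assumes \<rho>c: "0 < \<rho>c" and small: "central_potential c Pf \<rho>c \<le> c\<^sup>2 * \<epsilon>" "\<epsilon> < (n + 1) * x\<^sub>0 / 2"
  shows "x_of \<rho>c \<le> \<epsilon>" "0 < central_potential c Pf \<rho>c"
    "central_potential c Pf \<rho>c \<le> 2 * c\<^sup>2 * (n + 1) * x_of \<rho>c"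
proof -
  have c2: "0 < c\<^sup>2" using c by simp
  have n1: "1 \<le> (n + 1) / 2" "0 < n + 1" using n_bounds by auto
  have x_le: "x_of \<rho>c \<le> x\<^sub>0"
  proof (rule ccontr)
    assume "\<not> x_of \<rho>c \<le> x\<^sub>0"
    define \<rho>0 where "\<rho>0 = (c\<^sup>2 * x\<^sub>0 / A) powr n"
    have \<rho>0: "0 < \<rho>0" "x_of \<rho>0 = x\<^sub>0" using x0 A c x_of_inverse'[of x\<^sub>0] by (auto simp: \<rho>0_def)
    have lt: "\<rho>0 < \<rho>c"
    proof (rule ccontr)
      assume "\<not> \<rho>0 < \<rho>c"
      then have "\<rho>c < \<rho>0 \<or> \<rho>c = \<rho>0" by auto
      then have "x_of \<rho>c \<le> x\<^sub>0" using x_of_mono[of \<rho>c \<rho>0] \<rho>c \<rho>0 by auto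
      with \<open>\<not> x_of \<rho>c \<le> x\<^sub>0\<close> show False by simp
    qed
    have I1: "(du has_integral c\<^sup>2 * (n + 1) * V x\<^sub>0) {0..\<rho>0}" using du_has_integral[of \<rho>0] \<rho>0 by simp
    have I2: "(du has_integral integral {\<rho>0..\<rho>c} du) {\<rho>0..\<rho>c}"
      by (rule integrable_integral[OF du_integrable]) (use \<rho>0 lt in auto)
    have "(du has_integral c\<^sup>2 * (n + 1) * V x\<^sub>0 + integral {\<rho>0..\<rho>c} du) {0..\<rho>c}"
      by (rule has_integral_combine[OF _ _ I1 I2]) (use \<rho>0 lt in auto)
    then have "central_potential c Pf \<rho>c = c\<^sup>2 * (n + 1) * V x\<^sub>0 + integral {\<rho>0..\<rho>c} du"
      unfolding central_potential_def by (rule integral_unique)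
    moreover have "0 \<le> integral {\<rho>0..\<rho>c} du"
    proof (rule has_integral_nonneg[OF I2])
      fix \<tau> assume "\<tau> \<in> {\<rho>0..\<rho>c}"
      then have "0 < \<tau>" using \<rho>0 by auto
      then show "0 \<le> du \<tau>" using Pf_pos[of \<tau>] Pf_deriv_pos[of \<tau>] c by (simp add: less_imp_le)
    qed
    moreover have "c\<^sup>2 * (n + 1) * (x\<^sub>0 / 2) \<le> c\<^sup>2 * (n + 1) * V x\<^sub>0"
      using V_bounds(1)[of x\<^sub>0] x0 c2 n1 by (intro mult_left_mono) auto
    ultimately have "c\<^sup>2 * ((n + 1) * x\<^sub>0 / 2) \<le> c\<^sup>2 * \<epsilon>" using small(1) by simp
    then show False using small(2) c2 by simp
  qed
  define x where "x = x_of \<rho>c"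
  have x: "x \<in> {0..x\<^sub>0}" "0 < x" using x_le x_of_pos[OF \<rho>c] by (auto simp: x_def)
  have eq: "central_potential c Pf \<rho>c = c\<^sup>2 * (n + 1) * V x"
    unfolding central_potential_def x_def by (rule integral_unique[OF du_has_integral[OF \<rho>c x_le]])
  have k: "0 < c\<^sup>2 * (n + 1)" using c2 n1 by simp
  have lo: "c\<^sup>2 * (n + 1) * (x / 2) \<le> c\<^sup>2 * (n + 1) * V x"
    using V_bounds(1)[OF x(1)] k by (intro mult_left_mono) auto
  have hi: "c\<^sup>2 * (n + 1) * V x \<le> c\<^sup>2 * (n + 1) * (2 * x)"
    using V_bounds(2)[OF x(1)] k by (intro mult_left_mono) auto
  have "1 * x \<le> (n + 1) / 2 * x" using n1 x by (intro mult_right_mono) auto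
  then have "c\<^sup>2 * x \<le> c\<^sup>2 * ((n + 1) / 2 * x)" using c2 by (intro mult_left_mono) auto
  also have "\<dots> \<le> c\<^sup>2 * \<epsilon>" using lo small(1) eq by simp
  finally show "x_of \<rho>c \<le> \<epsilon>" using c2 by (simp add: x_def)
  have "0 < c\<^sup>2 * (n + 1) * (x / 2)" using k x(2) by simp
  then show "0 < central_potential c Pf \<rho>c" using lo eq by linarith
  show "central_potential c Pf \<rho>c \<le> 2 * c\<^sup>2 * (n + 1) * x_of \<rho>c" using hi eq by (simp add: x_def mult_ac)
qed

text \<open>To leading order u = c^2 * (n + 1) * x, and for this value ((\<gamma> - 1) / (\<gamma> *
  A) * u) powr n is exactly the density; this explains the form of the bound on \<Lambda>. The true
  potential is at most twice as large, whence the factor 2 powr n.\<close>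

lemma cosmological_bound:
  assumes \<rho>c: "0 < \<rho>c" and G: "0 < G" and \<epsilon>: "0 < \<epsilon>"
    and uc: "0 < uc" "uc \<le> 2 * c\<^sup>2 * (n + 1) * x_of \<rho>c"
    and \<Lambda>: "\<Lambda> \<le> 4 * pi / c\<^sup>2 * G * ((\<gamma> - 1) / (\<gamma> * A)) powr (1 / (\<gamma> - 1)) * uc powr (1 / (\<gamma> - 1)) * \<epsilon>"
  shows "c\<^sup>2 * \<Lambda> / (4 * pi * G * \<rho>c) \<le> 2 powr n * \<epsilon>"
proof -
  have n1: "0 < n + 1" using n_bounds by auto
  have "(\<gamma> - 1) / (\<gamma> * A) * uc = uc / ((n + 1) * A)"
    using \<gamma> n1 A by (simp add: n_def field_simps)
  also have "\<dots> \<le> (2 * c\<^sup>2 * (n + 1) * x_of \<rho>c) / ((n + 1) * A)"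
    using uc n1 A by (intro divide_right_mono) auto
  also have "\<dots> = 2 * (c\<^sup>2 * x_of \<rho>c / A)" using n1 by simp
  finally have "((\<gamma> - 1) / (\<gamma> * A) * uc) powr n \<le> (2 * (c\<^sup>2 * x_of \<rho>c / A)) powr n"
    using n_bounds \<gamma> A uc by (intro powr_mono2) auto
  also have "\<dots> = 2 powr n * \<rho>c"
    using x_of_inverse[OF \<rho>c] x_of_pos[OF \<rho>c] A c by (subst powr_mult) auto
  finally have "((\<gamma> - 1) / (\<gamma> * A)) powr n * uc powr n \<le> 2 powr n * \<rho>c"
    using \<gamma> A uc by (subst (asm) powr_mult) auto
  then have "4 * pi / c\<^sup>2 * G * \<epsilon> * (((\<gamma> - 1) / (\<gamma> * A)) powr n * uc powr n) \<le> 4 * pi / c\<^sup>2 * G * \<epsilon> * (2 powr n * \<rho>c)"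
    using G \<epsilon> by (intro mult_left_mono) auto
  then have "\<Lambda> \<le> 4 * pi / c\<^sup>2 * G * \<epsilon> * (2 powr n * \<rho>c)"
    using \<Lambda> by (simp add: n_def[symmetric] mult_ac)
  then have "c\<^sup>2 * \<Lambda> \<le> c\<^sup>2 * (4 * pi / c\<^sup>2 * G * \<epsilon> * (2 powr n * \<rho>c))" by (intro mult_left_mono) auto
  also have "\<dots> = 2 powr n * \<epsilon> * (4 * pi * G * \<rho>c)" using c by simp
  finally show ?thesis using G \<rho>c by (subst pos_divide_le_eq) auto
qed

section \<open>The density as a function of the pressure\<close>

lemma inj_Pf: "inj_on Pf {0<..}"
proof (rule linorder_inj_onI)
  fix x y :: real assume "x < y" "x \<in> {0<..}" "y \<in> {0<..}"
  then show "Pf x \<noteq> Pf y" using Pf_strict_mono[of x y] by simp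
qed auto

lemma density_Pf: "\<rho> > 0 \<Longrightarrow> density_of Pf (Pf \<rho>) = \<rho>"
  unfolding density_of_def by (rule the_inv_into_f_f[OF inj_Pf]) simp

lemma density_range:
  assumes "p \<in> Pf ` {0<..}"
  shows "0 < density_of Pf p" "Pf (density_of Pf p) = p"
  using assms density_Pf by auto

lemma density_deriv:
  assumes "\<rho> > 0"
  shows "(density_of Pf has_real_derivative inverse (deriv Pf \<rho>)) (at (Pf \<rho>))"
proof (rule DERIV_inverse_function[where f = Pf and a = "Pf (\<rho> / 2)" and b = "Pf (2 * \<rho>)"])
  show "(Pf has_real_derivative deriv Pf \<rho>) (at (density_of Pf (Pf \<rho>)))"
    using Pf_has_deriv[OF assms] density_Pf[OF assms] by simp
  show "deriv Pf \<rho> \<noteq> 0" using Pf_deriv_pos[OF assms] by simp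
  show "Pf (\<rho> / 2) < Pf \<rho>" "Pf \<rho> < Pf (2 * \<rho>)" using assms by (auto intro!: Pf_strict_mono)
  show "Pf (density_of Pf y) = y" if y: "Pf (\<rho> / 2) < y" "y < Pf (2 * \<rho>)" for y
  proof -
    have "continuous_on {\<rho> / 2..2 * \<rho>} Pf"
      by (rule DERIV_continuous_on[OF has_field_derivative_at_within[OF Pf_has_deriv]]) (use assms in auto)
    then have "\<exists>x\<ge>\<rho> / 2. x \<le> 2 * \<rho> \<and> Pf x = y"
      by (intro IVT') (use y assms in auto)
    then obtain x where "\<rho> / 2 \<le> x" "Pf x = y" by blast
    then show ?thesis using assms density_Pf[of x] by auto
  qed
  show "isCont (density_of Pf) (Pf \<rho>)"
  proof (rule isCont_inverse_function2[where f = Pf and a = "\<rho> / 2" and b = "2 * \<rho>"])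
    show "density_of Pf (Pf x) = x" "isCont Pf x" if "\<rho> / 2 \<le> x" for x
      using that assms by (auto intro!: density_Pf DERIV_isCont[OF Pf_has_deriv])
  qed (use assms in auto)
qed

end

section \<open>Solutions of the Tolman-Oppenheimer-Volkoff-de Sitter equation\<close>

locale star = gas \<gamma> n \<Omega> \<Omega>' x\<^sub>0 L\<^sub>0 c A + profile \<gamma> n \<Omega> \<Omega>' x\<^sub>0 L\<^sub>0 xc \<beta> X \<theta> z L
  for \<gamma> n \<Omega> \<Omega>' x\<^sub>0 L\<^sub>0 c A xc \<beta> X \<theta> z L +
  fixes G \<Lambda> \<rho>c :: real
  assumes G: "0 < G" and \<Lambda>: "0 < \<Lambda>" and \<rho>c: "0 < \<rho>c"
    and xc_eq: "xc = x_of \<rho>c" and \<beta>_eq: "\<beta> = c\<^sup>2 * \<Lambda> / (4 * pi * G * \<rho>c)"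
begin

text \<open>The Lane-Emden unit of length: as c^2 * xc = A * \<rho>c powr (\<gamma> - 1), its square
  is (n + 1) * A * \<rho>c powr (1/n - 1) / (4 * pi * G).\<close>

definition a where "a = sqrt ((n + 1) * c\<^sup>2 * xc / (4 * pi * G * \<rho>c))"

lemma a_pos: "0 < a"
  unfolding a_def using n_bounds c xc(1) G \<rho>c by (intro real_sqrt_gt_zero divide_pos_pos mult_pos_pos) auto

lemma a_square: "4 * pi * G * \<rho>c * a\<^sup>2 = (n + 1) * c\<^sup>2 * xc"
proof -
  have "a\<^sup>2 = (n + 1) * c\<^sup>2 * xc / (4 * pi * G * \<rho>c)"
    unfolding a_def using n_bounds c xc(1) G \<rho>c by (intro real_sqrt_pow2 divide_nonneg_nonneg mult_nonneg_nonneg) auto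
  then show ?thesis using G \<rho>c by simp
qed

lemma \<Lambda>_eq: "c\<^sup>2 * \<Lambda> = 4 * pi * G * \<rho>c * \<beta>"
  using G \<rho>c by (simp add: \<beta>_eq)

lemma kappa_scaled: "r \<noteq> 0 \<Longrightarrow> kappa c G \<Lambda> r (4 * pi * \<rho>c * r ^ 3 * w) = kap xc \<beta> (r / a) w"
proof -
  assume r: "r \<noteq> 0"
  define q where "q = 4 * pi * G * \<rho>c"
  have c2: "c\<^sup>2 \<noteq> 0" using c by simp
  have qa: "q * a\<^sup>2 = (n + 1) * c\<^sup>2 * xc" using a_square by (simp add: q_def)
  have q: "q = (n + 1) * c\<^sup>2 * xc / a\<^sup>2" using qa a_pos by (simp add: field_simps)
  have L: "\<Lambda> = q * \<beta> / c\<^sup>2" using \<Lambda>_eq c2 by (simp add: q_def field_simps)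
  have "2 * G * (4 * pi * \<rho>c * r ^ 3 * w) / (c\<^sup>2 * r) = 2 * q * r\<^sup>2 * w / c\<^sup>2"
    using r c2 by (simp add: q_def field_simps power3_eq_cube power2_eq_square)
  also have "\<dots> = 2 * ((n + 1) * xc) * (r / a)\<^sup>2 * w" unfolding q using c2 by (simp add: power_divide)
  finally have 1: "2 * G * (4 * pi * \<rho>c * r ^ 3 * w) / (c\<^sup>2 * r) = 2 * ((n + 1) * xc) * (r / a)\<^sup>2 * w" .
  have 2: "\<Lambda> / 3 * r\<^sup>2 = \<beta> * ((n + 1) * xc) * (r / a)\<^sup>2 / 3"
    unfolding L q using c2 by (simp add: power_divide)
  show ?thesis unfolding kappa_def kap_def 1 2 ..
qed

lemma pressure_scaled:
  assumes "0 \<le> y" "y \<le> 2"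
  shows "Pf (\<rho>c * y powr n) = c\<^sup>2 * \<rho>c * press xc y"
  using assms \<rho>c by (simp add: Pf_x x_of_scale xc_eq[symmetric] press_def trunc_id mult_ac)

lemma tov_Q_scaled:
  assumes "0 \<le> y" "y \<le> 2"
  shows "tov_Q c G \<Lambda> r (4 * pi * \<rho>c * r ^ 3 * w) (Pf (\<rho>c * y powr n)) = 4 * pi * G * \<rho>c * r ^ 3 * force xc \<beta> w y"
proof -
  have "tov_Q c G \<Lambda> r (4 * pi * \<rho>c * r ^ 3 * w) (Pf (\<rho>c * y powr n)) =
      G * (4 * pi * \<rho>c * r ^ 3 * w + 4 * pi * r ^ 3 / c\<^sup>2 * (c\<^sup>2 * \<rho>c * press xc y)) - (c\<^sup>2 * \<Lambda>) / 3 * r ^ 3"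
    by (simp add: tov_Q_def pressure_scaled[OF assms])
  also have "\<dots> = 4 * pi * G * \<rho>c * r ^ 3 * force xc \<beta> w y"
    unfolding \<Lambda>_eq using c by (simp add: force_def algebra_simps)
  finally show ?thesis .
qed

definition dPdr where
  "dPdr r m p = - (density_of Pf p + p / c\<^sup>2) * (tov_Q c G \<Lambda> r m p / (r\<^sup>2 * kappa c G \<Lambda> r m))"

text \<open>By the chain rule, the first equation turns the pressure equation for $P(\rho_c y^n)$
  into $a\,dy/dr = -\mbox{rate}$.\<close>

lemma dPdr_scaled:
  assumes y: "0 < y" "y \<le> 2" and r: "0 < r"
  shows "dPdr r (4 * pi * \<rho>c * r ^ 3 * w) (Pf (\<rho>c * y powr n)) =
     deriv Pf (\<rho>c * y powr n) * (\<rho>c * (n * y powr (n - 1))) * (- rate xc \<beta> (r / a) w y / a)"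
    and "dPdr r (4 * pi * \<rho>c * r ^ 3 * w) (Pf (\<rho>c * y powr n)) =
     - (\<rho>c * (y powr n + press xc y)) * (4 * pi * G * \<rho>c * r * force xc \<beta> w y / kap xc \<beta> (r / a) w)"
proof -
  define \<rho> where "\<rho> = \<rho>c * y powr n"
  define k where "k = kap xc \<beta> (r / a) w"
  define f where "f = force xc \<beta> w y"
  define x where "x = xc * y"
  have \<rho>: "0 < \<rho>" using y \<rho>c by (simp add: \<rho>_def)
  have x\<rho>: "x_of \<rho> = x" using x_of_scale[of \<rho>c y] \<rho>c y by (simp add: \<rho>_def x_def xc_eq)
  have x: "0 < x" "x \<le> x\<^sub>0"
  proof -
    have "xc * y \<le> xc * 2" using y xc by (intro mult_left_mono) auto
    then show "x \<le> x\<^sub>0" using xc unfolding x_def by linarith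
    show "0 < x" using y xc by (simp add: x_def)
  qed
  have sl: "slope x \<noteq> 0" using slope_range[of x] x by auto
  have P: "Pf \<rho> = c\<^sup>2 * \<rho> * x * \<Omega> x" using \<rho> by (simp add: Pf_x x\<rho>)
  have dens: "density_of Pf (Pf \<rho>) + Pf \<rho> / c\<^sup>2 = \<rho> * (1 + x * \<Omega> x)"
    using density_Pf[OF \<rho>] c by (simp add: P algebra_simps)
  have Qk: "tov_Q c G \<Lambda> r (4 * pi * \<rho>c * r ^ 3 * w) (Pf \<rho>) / (r\<^sup>2 * kappa c G \<Lambda> r (4 * pi * \<rho>c * r ^ 3 * w))
      = 4 * pi * G * \<rho>c * r * f / k"
    using tov_Q_scaled[of y r w] kappa_scaled[of r w] y r
    by (simp add: \<rho>_def f_def k_def power3_eq_cube power2_eq_square)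
  have "\<rho> * (1 + x * \<Omega> x) = \<rho>c * (y powr n + press xc y)"
    using y by (simp add: \<rho>_def press_def trunc_id x_def algebra_simps)
  then show "dPdr r (4 * pi * \<rho>c * r ^ 3 * w) (Pf (\<rho>c * y powr n)) =
     - (\<rho>c * (y powr n + press xc y)) * (4 * pi * G * \<rho>c * r * force xc \<beta> w y / kap xc \<beta> (r / a) w)"
    using Qk dens by (simp add: dPdr_def \<rho>_def k_def f_def)
  have qa: "4 * pi * G * \<rho>c = (n + 1) * c\<^sup>2 * xc / a\<^sup>2"
    using a_square a_pos by (simp add: field_simps)
  have \<gamma>n: "\<gamma> * n = n + 1" using \<gamma>_n by (metis mult.assoc mult.commute mult_1)
  have yn: "y powr n = y * y powr (n - 1)" using y by (simp add: powr_diff)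
  have rt: "rate xc \<beta> (r / a) w y = r / a * (f * slope x * (1 / k))"
    using y by (simp add: rate_def f_def k_def x_def trunc_id)
  have "deriv Pf \<rho> * (\<rho>c * (n * y powr (n - 1))) * (- rate xc \<beta> (r / a) w y / a)
      = - ((\<gamma> * n) * c\<^sup>2 * xc / a\<^sup>2) * r * (\<rho>c * (y * y powr (n - 1))) * (1 + x * \<Omega> x) * (f / k)"
    using Pf_deriv[OF \<rho>] x sl by (simp add: x\<rho> rt x_def power2_eq_square mult_ac)
  also have "\<dots> = - (\<rho> * (1 + x * \<Omega> x)) * (4 * pi * G * \<rho>c * r * f / k)"
    unfolding \<gamma>n qa by (simp add: \<rho>_def yn)
  finally show "dPdr r (4 * pi * \<rho>c * r ^ 3 * w) (Pf (\<rho>c * y powr n)) =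
     deriv Pf (\<rho>c * y powr n) * (\<rho>c * (n * y powr (n - 1))) * (- rate xc \<beta> (r / a) w y / a)"
    using Qk dens by (simp add: dPdr_def \<rho>_def[symmetric])
qed

section \<open>The physical solution built from the profile\<close>

sublocale volterra "rate xc \<beta>" X L n by (rule volt)

abbreviation "w \<equiv> avg n \<theta>"

lemma w_range: "\<xi> \<in> {0..X} \<Longrightarrow> w \<xi> \<in> {0..2 powr n}"
  using avg_bounds[OF n_bounds(3) cont, of \<xi>] by auto

lemma \<theta>_0: "\<theta> 0 = 1" using fixp[of 0] Xpos by simp

lemma \<theta>_deriv:
  assumes "0 < \<xi>" "\<xi> < X"
  shows "(\<theta> has_real_derivative - rate xc \<beta> \<xi> (w \<xi>) (\<theta> \<xi>)) (at \<xi>)"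
proof -
  have "(\<theta> has_real_derivative - rate xc \<beta> \<xi> (w \<xi>) (\<theta> \<xi>)) (at \<xi> within {0..X})"
    by (rule has_field_derivative_transform_within[OF T_deriv[OF cont], of _ 1])
      (use assms fixp in \<open>auto simp: T_def\<close>)
  then show ?thesis using at_within_Icc_at[of 0 \<xi> X] assms by simp
qed

lemma rate_pos: "0 < \<xi> \<Longrightarrow> \<xi> \<le> X \<Longrightarrow> 0 < rate xc \<beta> \<xi> (w \<xi>) (\<theta> \<xi>)"
proof -
  assume \<xi>: "0 < \<xi>" "\<xi> \<le> X"
  have "0 < slope (xc * trunc (\<theta> \<xi>))" using slope_range[OF x_range(1)[of "\<theta> \<xi>"]] by linarith
  moreover have "0 < kap xc \<beta> \<xi> (w \<xi>)" using kap_half[of \<xi> "w \<xi>"] w_range[of \<xi>] \<xi> by auto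
  moreover have "0 < force xc \<beta> (w \<xi>) (\<theta> \<xi>)" using force_pos[of \<xi>] \<xi> by auto
  ultimately show ?thesis unfolding rate_def using \<xi> by (intro mult_pos_pos divide_pos_pos) auto
qed

lemma \<theta>_strict: "0 \<le> s \<Longrightarrow> s < t \<Longrightarrow> t \<le> X \<Longrightarrow> \<theta> t < \<theta> s"
proof (rule DERIV_neg_imp_decreasing_open[of s t])
  fix x assume x: "0 \<le> s" "s < t" "t \<le> X" "s < x" "x < t"
  then show "\<exists>y. (\<theta> has_real_derivative y) (at x) \<and> y < 0"
    using \<theta>_deriv[of x] rate_pos[of x] by (intro exI[of _ "- rate xc \<beta> x (w x) (\<theta> x)"]) auto
qed (auto intro: continuous_on_subset[OF cont])

lemma \<theta>_pos: "0 \<le> \<xi> \<Longrightarrow> \<xi> < z \<Longrightarrow> 0 < \<theta> \<xi>"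
  using \<theta>_strict[of \<xi> z] z by simp

lemma \<theta>_le: "0 \<le> \<xi> \<Longrightarrow> \<xi> \<le> X \<Longrightarrow> \<theta> \<xi> \<le> 1"
  using \<theta>_strict[of 0 \<xi>] \<theta>_0 by (cases "\<xi> = 0") auto

definition mS where "mS r = 4 * pi * \<rho>c * r ^ 3 * w (r / a)"
definition pS where "pS r = Pf (\<rho>c * \<theta> (r / a) powr n)"
definition rS where "rS = a * z"

lemma rS_pos: "0 < rS" using a_pos z by (simp add: rS_def)

lemma scaled_range: "0 < r \<Longrightarrow> r < rS \<Longrightarrow> 0 < r / a \<and> r / a < z \<and> r / a < X"
  using a_pos z by (auto simp: rS_def field_simps intro: less_trans)

lemma mS_deriv:
  assumes "0 < r" "r < rS"
  shows "(mS has_real_derivative 4 * pi * r\<^sup>2 * density_of Pf (pS r)) (at r)"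
proof -
  have s: "0 < r / a" "r / a < z" "r / a < X" using scaled_range[OF assms] by auto
  have t: "trunc (\<theta> (r / a)) = \<theta> (r / a)" using \<theta>_pos[of "r / a"] \<theta>_le[of "r / a"] s by (intro trunc_id) auto
  have "((\<lambda>r. (r / a) ^ 3 * w (r / a)) has_real_derivative ((r / a)\<^sup>2 * trunc (\<theta> (r / a)) powr n) * (1 / a)) (at r)"
    by (rule DERIV_chain2[OF avg_mass_deriv[OF n_bounds(3) cont s(1,3)] DERIV_cdivide[OF DERIV_ident]])
  then have "((\<lambda>r. 4 * pi * \<rho>c * a ^ 3 * ((r / a) ^ 3 * w (r / a))) has_real_derivative
      4 * pi * \<rho>c * a ^ 3 * (((r / a)\<^sup>2 * trunc (\<theta> (r / a)) powr n) * (1 / a))) (at r)"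
    by (rule DERIV_cmult)
  moreover have "(\<lambda>r. 4 * pi * \<rho>c * a ^ 3 * ((r / a) ^ 3 * w (r / a))) = mS"
    using a_pos by (simp add: mS_def[abs_def] power_divide mult.assoc)
  moreover have "4 * pi * \<rho>c * a ^ 3 * (((r / a)\<^sup>2 * trunc (\<theta> (r / a)) powr n) * (1 / a)) = 4 * pi * r\<^sup>2 * (\<rho>c * \<theta> (r / a) powr n)"
    using a_pos t by (simp add: power_divide power3_eq_cube power2_eq_square)
  moreover have "density_of Pf (pS r) = \<rho>c * \<theta> (r / a) powr n"
    unfolding pS_def using \<rho>c \<theta>_pos[of "r / a"] s by (intro density_Pf) auto
  ultimately show ?thesis by simp
qed

lemma pS_deriv:
  assumes "0 < r" "r < rS"
  shows "(pS has_real_derivative dPdr r (mS r) (pS r)) (at r)"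
proof -
  have s: "0 < r / a" "r / a < z" "r / a < X" using scaled_range[OF assms] by auto
  have p: "0 < \<theta> (r / a)" "\<theta> (r / a) \<le> 2" using \<theta>_pos[of "r / a"] \<theta>_le[of "r / a"] s by auto
  have D: "((\<lambda>r. \<theta> (r / a)) has_real_derivative - rate xc \<beta> (r / a) (w (r / a)) (\<theta> (r / a)) * (1 / a)) (at r)"
    by (rule DERIV_chain2[OF \<theta>_deriv[OF s(1,3)] DERIV_cdivide[OF DERIV_ident]])
  have D': "((\<lambda>r. \<theta> (r / a) powr n) has_real_derivative
      n * \<theta> (r / a) powr (n - 1) * (- rate xc \<beta> (r / a) (w (r / a)) (\<theta> (r / a)) * (1 / a))) (at r)"
    by (rule DERIV_chain2[OF has_real_derivative_powr[OF p(1)] D])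
  have "(pS has_real_derivative deriv Pf (\<rho>c * \<theta> (r / a) powr n) *
      (\<rho>c * (n * \<theta> (r / a) powr (n - 1) * (- rate xc \<beta> (r / a) (w (r / a)) (\<theta> (r / a)) * (1 / a))))) (at r)"
    unfolding pS_def[abs_def]
    by (rule DERIV_chain2[OF Pf_has_deriv DERIV_cmult[OF D']]) (use p \<rho>c in simp)
  then show ?thesis
    by (rule DERIV_cong) (simp add: mS_def pS_def dPdr_scaled(1)[OF p assms(1)])
qed

lemma mS_kappa: "0 < r \<Longrightarrow> r \<le> rS \<Longrightarrow> 1 / 2 \<le> kappa c G \<Lambda> r (mS r)"
proof -
  assume r: "0 < r" "r \<le> rS"
  have "r / a \<in> {0..X}" using r a_pos z by (auto simp: rS_def field_simps intro: order_trans)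
  then show ?thesis using kap_half[OF _ w_range] r by (simp add: mS_def kappa_scaled)
qed

lemma solution: "tov_solution c G \<Lambda> Pf (ereal rS) mS pS"
  unfolding tov_solution_def
proof (intro allI impI conjI)
  fix r assume "0 < r \<and> ereal r < ereal rS"
  then have r: "0 < r" "r < rS" by auto
  have "0 < \<rho>c * \<theta> (r / a) powr n" using \<rho>c \<theta>_pos[of "r / a"] scaled_range[OF r] by simp
  then have "pS r \<in> Pf ` {0<..}" unfolding pS_def by blast
  moreover have "0 < kappa c G \<Lambda> r (mS r)" using mS_kappa[of r] r by simp
  ultimately show "(r, mS r, pS r) \<in> tov_domain c G \<Lambda> Pf" using r by (simp add: tov_domain_def)
  show "(mS has_real_derivative 4 * pi * r\<^sup>2 * density_of Pf (pS r)) (at r)" by (rule mS_deriv[OF r])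
  show "(pS has_real_derivative - (density_of Pf (pS r) + pS r / c\<^sup>2) *
     (tov_Q c G \<Lambda> r (mS r) (pS r) / (r\<^sup>2 * kappa c G \<Lambda> r (mS r)))) (at r)"
    using pS_deriv[OF r] by (simp add: dPdr_def)
qed

lemma pS_limit: "(pS \<longlongrightarrow> 0) (at_left rS)"
proof -
  have "isCont \<theta> z" using \<theta>_deriv[of z] z by (intro DERIV_isCont) auto
  then have "(\<theta> \<longlongrightarrow> 0) (at z)" using z by (simp add: isCont_def)
  moreover have "filterlim (\<lambda>r. r / a) (at z) (at_left rS)"
  proof (rule filterlim_atI)
    show "((\<lambda>r. r / a) \<longlongrightarrow> z) (at_left rS)"
      using a_pos by (auto intro!: tendsto_eq_intros simp: rS_def)
    show "eventually (\<lambda>r. r / a \<noteq> z) (at_left rS)"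
      unfolding eventually_at_left_field using a_pos
      by (intro exI[of _ 0]) (auto simp: rS_def field_simps z)
  qed
  ultimately have "((\<lambda>r. \<theta> (r / a)) \<longlongrightarrow> 0) (at_left rS)" by (rule filterlim_compose)
  moreover have ev: "eventually (\<lambda>r. 0 < r \<and> r < rS) (at_left rS)"
    unfolding eventually_at_left_field using rS_pos by blast
  ultimately have "((\<lambda>r. \<rho>c * \<theta> (r / a) powr n) \<longlongrightarrow> \<rho>c * 0 powr n) (at_left rS)"
    using n_bounds ev \<theta>_pos scaled_range
    by (intro tendsto_mult tendsto_const tendsto_powr2) (auto elim!: eventually_mono intro!: less_imp_le)
  \<comment> \<open>Admissibility provides the limit of \<open>Pf\<close> at 0 from the right, so
    the density has to approach 0 through positive values.\<close>
  then have "filterlim (\<lambda>r. \<rho>c * \<theta> (r / a) powr n) (at_right 0) (at_left rS)"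
    unfolding filterlim_at using ev
  proof (intro conjI)
    show "eventually (\<lambda>r. \<rho>c * \<theta> (r / a) powr n \<in> {0<..} \<and> \<rho>c * \<theta> (r / a) powr n \<noteq> 0) (at_left rS)"
      using ev
    proof eventually_elim
      case (elim r)
      then show ?case using \<rho>c \<theta>_pos[of "r / a"] scaled_range[of r] by auto
    qed
  qed simp
  from filterlim_compose[OF Pf_at_0 this] show ?thesis unfolding pS_def[abs_def] .
qed

lemma trunc_\<theta>: "0 \<le> \<xi> \<Longrightarrow> \<xi> \<le> z \<Longrightarrow> trunc (\<theta> \<xi>) = \<theta> \<xi>"
  using \<theta>_pos[of \<xi>] \<theta>_le[of \<xi>] z by (cases "\<xi> = z") (auto simp: trunc_def)

section \<open>Expansion of the solution at the centre\<close>

definition C\<^sub>1 where "C\<^sub>1 = 2 * (3 * 2 powr n + 1)"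
definition C\<^sub>2 where "C\<^sub>2 = n * 2 powr n * C\<^sub>1"

lemma C_nonneg: "0 \<le> C\<^sub>1" "0 \<le> C\<^sub>2"
proof -
  show "0 \<le> C\<^sub>1" by (simp add: C\<^sub>1_def add_nonneg_nonneg)
  then show "0 \<le> C\<^sub>2" using n_bounds by (simp add: C\<^sub>2_def)
qed

lemma \<theta>_near: "\<xi> \<in> {0..X} \<Longrightarrow> \<bar>\<theta> \<xi> - 1\<bar> \<le> C\<^sub>1 * \<xi>\<^sup>2"
  using fixed_point_near_one[OF cont fixp] by (simp add: C\<^sub>1_def)

lemma powr_near:
  assumes "\<xi> \<in> {0..X}"
  shows "\<bar>trunc (\<theta> \<xi>) powr n - 1\<bar> \<le> C\<^sub>2 * \<xi>\<^sup>2"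
proof -
  have "\<bar>trunc (\<theta> \<xi>) powr n - trunc 1 powr n\<bar> \<le> n * 2 powr n * \<bar>trunc (\<theta> \<xi>) - trunc 1\<bar>"
    using n_bounds by (intro powr_lipschitz trunc_range) auto
  also have "\<dots> \<le> n * 2 powr n * (C\<^sub>1 * \<xi>\<^sup>2)"
    using n_bounds by (intro mult_left_mono order_trans[OF trunc_lipschitz \<theta>_near[OF assms]]) auto
  finally show ?thesis by (simp add: trunc_id C\<^sub>2_def)
qed

lemma w_near:
  assumes "\<xi> \<in> {0..X}"
  shows "\<bar>w \<xi> - 1 / 3\<bar> \<le> C\<^sub>2 * \<xi>\<^sup>2"
proof -
  have *: "1 - C\<^sub>2 * \<xi>\<^sup>2 \<le> trunc (\<theta> s) powr n \<and> trunc (\<theta> s) powr n \<le> 1 + C\<^sub>2 * \<xi>\<^sup>2" if "s \<in> {0..\<xi>}" for s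
  proof -
    have "\<bar>trunc (\<theta> s) powr n - 1\<bar> \<le> C\<^sub>2 * s\<^sup>2" using that assms by (intro powr_near) auto
    moreover have "C\<^sub>2 * s\<^sup>2 \<le> C\<^sub>2 * \<xi>\<^sup>2"
      using that C_nonneg by (intro mult_left_mono power_mono) auto
    ultimately show ?thesis by linarith
  qed
  have "(1 - C\<^sub>2 * \<xi>\<^sup>2) / 3 \<le> w \<xi>" "w \<xi> \<le> (1 + C\<^sub>2 * \<xi>\<^sup>2) / 3"
    using avg_between[OF n_bounds(3) cont assms *] by auto
  moreover have "0 \<le> C\<^sub>2 * \<xi>\<^sup>2" using C_nonneg by simp
  ultimately show ?thesis unfolding abs_le_iff diff_divide_distrib add_divide_distrib by linarith
qed

lemma mS_expansion: "(\<lambda>r. mS r - 4 * pi / 3 * \<rho>c * r ^ 3) \<in> O[at_right 0](\<lambda>r. r ^ 5)"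
proof (rule bigo_O_at_right_0I[OF rS_pos])
  fix r assume r: "0 < r" "r < rS"
  have "\<bar>w (r / a) - 1 / 3\<bar> \<le> C\<^sub>2 * (r / a)\<^sup>2" using scaled_range[OF r] by (intro w_near) auto
  then have "(4 * pi * \<rho>c * r ^ 3) * \<bar>w (r / a) - 1 / 3\<bar> \<le> (4 * pi * \<rho>c * r ^ 3) * (C\<^sub>2 * (r / a)\<^sup>2)"
    using \<rho>c r by (intro mult_left_mono) auto
  moreover have "mS r - 4 * pi / 3 * \<rho>c * r ^ 3 = (4 * pi * \<rho>c * r ^ 3) * (w (r / a) - 1 / 3)"
    by (simp add: mS_def algebra_simps)
  moreover have "(4 * pi * \<rho>c * r ^ 3) * (C\<^sub>2 * (r / a)\<^sup>2) = 4 * pi * \<rho>c * C\<^sub>2 / a\<^sup>2 * r ^ 5"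
    by (simp add: power_divide power2_eq_square eval_nat_numeral)
  ultimately show "\<bar>mS r - 4 * pi / 3 * \<rho>c * r ^ 3\<bar> \<le> 4 * pi * \<rho>c * C\<^sub>2 / a\<^sup>2 * r ^ 5"
    using \<rho>c r by (simp add: abs_mult)
qed

text \<open>By \<open>dPdr_scaled\<close>, dP/dr = - 4 * pi * G * \<rho>c^2 * r * H (r / a), and
  \<open>H\<^sub>0\<close> is the value of H at the centre, where the average is 1/3.\<close>

definition H where "H \<xi> = (trunc (\<theta> \<xi>) powr n + press xc (\<theta> \<xi>)) * force xc \<beta> (w \<xi>) (\<theta> \<xi>) * (1 / kap xc \<beta> \<xi> (w \<xi>))"
definition H\<^sub>0 where "H\<^sub>0 = (1 + press xc 1) * force xc \<beta> (1 / 3) 1 * 1"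

lemma H_near:
  obtains C where "0 \<le> C" "\<And>\<xi>. \<xi> \<in> {0..X} \<Longrightarrow> \<bar>H \<xi> - H\<^sub>0\<bar> \<le> C * \<xi>\<^sup>2"
proof -
  define P where "P = n * 2 powr n * 2 + 2 powr n * 2 + 2 powr n * L\<^sub>0"
  define B where "B = 3 * 2 powr n + (1 :: real)"
  define A\<^sub>0 where "A\<^sub>0 = 1 + press xc 1"
  define K where "K = 2 * (2 * ((n + 1) * xc) * 2 powr n + \<beta> * ((n + 1) * xc) / 3)"
  have P: "0 \<le> P" using n_bounds L0 by (simp add: P_def)
  have B: "0 \<le> B" by (simp add: B_def)
  have A0: "0 \<le> A\<^sub>0" using press_range(1)[of 1] by (simp add: A\<^sub>0_def)
  have K: "0 \<le> K" using n_bounds xc \<beta> by (simp add: K_def)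
  have p: "\<bar>press xc (\<theta> \<xi>) - press xc 1\<bar> \<le> P * C\<^sub>1 * \<xi>\<^sup>2" if "\<xi> \<in> {0..X}" for \<xi>
  proof -
    have "\<bar>press xc (\<theta> \<xi>) - press xc 1\<bar> \<le> P * \<bar>\<theta> \<xi> - 1\<bar>" unfolding P_def by (rule press_lip)
    also have "\<dots> \<le> P * (C\<^sub>1 * \<xi>\<^sup>2)" using P that by (intro mult_left_mono \<theta>_near) auto
    finally show ?thesis by (simp add: mult.assoc)
  qed
  have "\<bar>H \<xi> - H\<^sub>0\<bar> \<le> ((C\<^sub>2 + P * C\<^sub>1) * (B * 2) + A\<^sub>0 * (C\<^sub>2 + P * C\<^sub>1) * 2 + A\<^sub>0 * B * K) * \<xi>\<^sup>2"
    if \<xi>: "\<xi> \<in> {0..X}" for \<xi>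
  proof -
    have d1: "\<bar>(trunc (\<theta> \<xi>) powr n + press xc (\<theta> \<xi>)) - (1 + press xc 1)\<bar> \<le> (C\<^sub>2 + P * C\<^sub>1) * \<xi>\<^sup>2"
      using p[OF \<xi>] powr_near[OF \<xi>] by (simp add: distrib_right)
    have d2: "\<bar>force xc \<beta> (w \<xi>) (\<theta> \<xi>) - force xc \<beta> (1 / 3) 1\<bar> \<le> (C\<^sub>2 + P * C\<^sub>1) * \<xi>\<^sup>2"
      using p[OF \<xi>] w_near[OF \<xi>] by (simp add: force_def distrib_right)
    have kh: "1 / 2 \<le> kap xc \<beta> \<xi> (w \<xi>)" by (rule kap_half[OF \<xi> w_range[OF \<xi>]])
    have d3: "\<bar>1 / kap xc \<beta> \<xi> (w \<xi>) - 1\<bar> \<le> K * \<xi>\<^sup>2"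
    proof -
      have l: "0 \<le> (n + 1) * xc" using n_bounds xc by simp
      have "2 * ((n + 1) * xc) * \<xi>\<^sup>2 * w \<xi> \<le> 2 * ((n + 1) * xc) * \<xi>\<^sup>2 * 2 powr n"
        using l w_range[OF \<xi>] by (intro mult_left_mono) auto
      then have "1 - kap xc \<beta> \<xi> (w \<xi>) \<le> 2 * ((n + 1) * xc) * \<xi>\<^sup>2 * 2 powr n + \<beta> * ((n + 1) * xc) * \<xi>\<^sup>2 / 3"
        by (simp add: kap_def)
      also have "\<dots> = K / 2 * \<xi>\<^sup>2" by (simp add: K_def algebra_simps)
      finally have k: "\<bar>1 - kap xc \<beta> \<xi> (w \<xi>)\<bar> \<le> K / 2 * \<xi>\<^sup>2"
        using one_minus_kap(1)[OF \<xi> w_range[OF \<xi>]] by simp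
      have "1 / kap xc \<beta> \<xi> (w \<xi>) - 1 = 1 / kap xc \<beta> \<xi> (w \<xi>) * (1 - kap xc \<beta> \<xi> (w \<xi>))"
        using kh by (simp add: field_simps)
      then have "\<bar>1 / kap xc \<beta> \<xi> (w \<xi>) - 1\<bar> = \<bar>1 / kap xc \<beta> \<xi> (w \<xi>)\<bar> * \<bar>1 - kap xc \<beta> \<xi> (w \<xi>)\<bar>"
        by (simp only: abs_mult)
      also have "\<dots> \<le> 2 * (K / 2 * \<xi>\<^sup>2)" by (intro mult_mono inv_kap[OF \<xi> w_range[OF \<xi>]] k) auto
      finally show ?thesis by simp
    qed
    have "\<bar>H \<xi> - H\<^sub>0\<bar> \<le> \<bar>(trunc (\<theta> \<xi>) powr n + press xc (\<theta> \<xi>)) - (1 + press xc 1)\<bar> * (B * 2)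
        + A\<^sub>0 * \<bar>force xc \<beta> (w \<xi>) (\<theta> \<xi>) - force xc \<beta> (1 / 3) 1\<bar> * 2
        + A\<^sub>0 * B * \<bar>1 / kap xc \<beta> \<xi> (w \<xi>) - 1\<bar>"
      unfolding H_def H\<^sub>0_def
    proof (rule product3_diff)
      show "\<bar>force xc \<beta> (w \<xi>) (\<theta> \<xi>)\<bar> \<le> B" unfolding B_def by (rule force_bound[OF w_range[OF \<xi>]])
      have "(1 :: real) \<le> 2 powr n" using n_bounds by (simp add: ge_one_powr_ge_zero)
      then show "\<bar>force xc \<beta> (1 / 3) 1\<bar> \<le> B" unfolding B_def by (intro force_bound) auto
      show "\<bar>1 + press xc 1\<bar> \<le> A\<^sub>0" using A0 by (simp add: A\<^sub>0_def)
    qed (rule inv_kap[OF \<xi> w_range[OF \<xi>]])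
    also have "\<dots> \<le> (C\<^sub>2 + P * C\<^sub>1) * \<xi>\<^sup>2 * (B * 2) + A\<^sub>0 * ((C\<^sub>2 + P * C\<^sub>1) * \<xi>\<^sup>2) * 2 + A\<^sub>0 * B * (K * \<xi>\<^sup>2)"
      using B A0 by (intro add_mono mult_left_mono mult_right_mono d1 d2 d3 mult_nonneg_nonneg) auto
    also have "\<dots> = ((C\<^sub>2 + P * C\<^sub>1) * (B * 2) + A\<^sub>0 * (C\<^sub>2 + P * C\<^sub>1) * 2 + A\<^sub>0 * B * K) * \<xi>\<^sup>2"
      by (simp add: algebra_simps)
    finally show ?thesis .
  qed
  moreover have "0 \<le> (C\<^sub>2 + P * C\<^sub>1) * (B * 2) + A\<^sub>0 * (C\<^sub>2 + P * C\<^sub>1) * 2 + A\<^sub>0 * B * K"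
    using C_nonneg P B A0 K by simp
  ultimately show ?thesis by (rule that[rotated])
qed

text \<open>The remainder E vanishes at 0 and has derivative - k * s * (H (s / a) -
  \<open>H\<^sub>0\<close>), which is O(s^3) by \<open>H_near\<close>; the mean value theorem adds
  the fourth power.\<close>

lemma pS_expansion:
  "(\<lambda>r. pS r - (Pf \<rho>c - (\<rho>c + Pf \<rho>c / c\<^sup>2) *
     (4 * pi * G * (\<rho>c + 3 * Pf \<rho>c / c\<^sup>2) - c\<^sup>2 * \<Lambda>) * r\<^sup>2 / 6)) \<in> O[at_right 0](\<lambda>r. r ^ 4)"
proof -
  obtain C where C: "0 \<le> C" "\<And>\<xi>. \<xi> \<in> {0..X} \<Longrightarrow> \<bar>H \<xi> - H\<^sub>0\<bar> \<le> C * \<xi>\<^sup>2" by (rule H_near) blast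
  define k where "k = 4 * pi * G * \<rho>c\<^sup>2"
  define E where "E r = pS r - (Pf \<rho>c - k * H\<^sub>0 * r\<^sup>2 / 2)" for r
  have k: "0 \<le> k" using G by (simp add: k_def)
  have P1: "Pf \<rho>c = c\<^sup>2 * \<rho>c * press xc 1" using pressure_scaled[of 1] by simp
  \<comment> \<open>With q = \<open>press xc 1\<close>, both sides equal k * (1 + q) * (1/3 + q -
    \<beta>/3) / 2.\<close>
  have coeff: "(\<rho>c + Pf \<rho>c / c\<^sup>2) * (4 * pi * G * (\<rho>c + 3 * Pf \<rho>c / c\<^sup>2) - c\<^sup>2 * \<Lambda>) / 6 = k * H\<^sub>0 / 2"
  proof -
    have e: "\<rho>c + Pf \<rho>c / c\<^sup>2 = \<rho>c * (1 + press xc 1)" "\<rho>c + 3 * Pf \<rho>c / c\<^sup>2 = \<rho>c * (1 + 3 * press xc 1)"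
      using c unfolding P1 by (simp_all add: algebra_simps)
    show ?thesis unfolding e \<Lambda>_eq k_def H\<^sub>0_def force_def by (simp add: power2_eq_square field_simps)
  qed
  have E0: "E 0 = 0" by (simp add: E_def pS_def \<theta>_0)
  have "(\<lambda>r. E r) \<in> O[at_right 0](\<lambda>r. r ^ 4)"
  proof (rule bigo_O_at_right_0I[OF rS_pos, of _ "k * C / a\<^sup>2"])
    fix r assume r: "0 < r" "r < rS"
    have rng: "s / a \<in> {0..X}" "0 < \<theta> (s / a)" if "s \<in> {0..r}" for s
    proof -
      have "s / a \<le> r / a" "0 \<le> s / a" using that a_pos by (auto intro: divide_right_mono)
      then have "0 \<le> s / a" "s / a < z" using scaled_range[OF r] by linarith+
      then show "s / a \<in> {0..X}" "0 < \<theta> (s / a)" using \<theta>_pos[of "s / a"] z by auto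
    qed
    have cE: "continuous_on {0..r} E"
    proof -
      have cd: "continuous_on {0..r} (\<lambda>r. r / a)" using a_pos by (intro continuous_intros) simp
      have c1: "continuous_on {0..r} (\<lambda>r. \<theta> (r / a))"
        by (rule continuous_on_compose2[OF cont cd]) (rule image_subsetI, rule rng(1))
      have nz: "\<theta> (s / a) \<noteq> 0" if "s \<in> {0..r}" for s using rng(2)[OF that] by simp
      have c2: "continuous_on {0..r} (\<lambda>r. \<rho>c * \<theta> (r / a) powr n)"
        by (intro continuous_on_mult continuous_on_const continuous_on_powr c1 ballI nz)
      have c3: "continuous_on {0<..} Pf"
        by (rule DERIV_continuous_on[OF has_field_derivative_at_within[OF Pf_has_deriv]]) simp
      have im: "(\<lambda>r. \<rho>c * \<theta> (r / a) powr n) ` {0..r} \<subseteq> {0<..}"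
      proof (rule image_subsetI)
        fix s assume "s \<in> {0..r}"
        then show "\<rho>c * \<theta> (s / a) powr n \<in> {0<..}" using rng(2)[of s] \<rho>c by simp
      qed
      have c4: "continuous_on {0..r} pS" unfolding pS_def[abs_def]
        by (rule continuous_on_compose2[OF c3 c2 im])
      show ?thesis unfolding E_def[abs_def]
        by (intro continuous_on_diff c4 continuous_on_const continuous_on_divide continuous_on_mult
            continuous_on_power continuous_on_id) simp
    qed
    have D: "(E has_real_derivative - k * s * (H (s / a) - H\<^sub>0)) (at s)" if s: "0 < s" "s < r" for s
    proof -
      have s': "0 < s" "s < rS" using s r by auto
      have sr: "0 < s / a" "s / a < z" "s / a < X" using scaled_range[OF s'] by auto
      have t: "0 < \<theta> (s / a)" "\<theta> (s / a) \<le> 2" using \<theta>_pos[of "s / a"] \<theta>_le[of "s / a"] sr by auto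
      have "dPdr s (mS s) (pS s) = - k * s * H (s / a)"
        unfolding mS_def pS_def dPdr_scaled(2)[OF t s'(1)]
        using t by (simp add: H_def k_def trunc_id power2_eq_square)
      then have D1: "(pS has_real_derivative - k * s * H (s / a)) (at s)" using pS_deriv[OF s'] by simp
      have D2: "((\<lambda>r. Pf \<rho>c - k * H\<^sub>0 * r\<^sup>2 / 2) has_real_derivative - (k * H\<^sub>0 * s)) (at s)"
        by (auto intro!: derivative_eq_intros)
      show ?thesis unfolding E_def[abs_def]
        by (rule DERIV_cong[OF DERIV_diff[OF D1 D2]]) (simp add: algebra_simps)
    qed
    have "\<exists>s. 0 < s \<and> s < r \<and> E r - E 0 = (r - 0) * (- k * s * (H (s / a) - H\<^sub>0))"
    proof -
      have "\<exists>l s. 0 < s \<and> s < r \<and> DERIV E s :> l \<and> E r - E 0 = (r - 0) * l"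
      proof (rule MVT[OF r(1) cE])
        show "E differentiable (at s)" if "0 < s" "s < r" for s
          using D[OF that] unfolding real_differentiable_def by blast
      qed
      then obtain l s where s: "0 < s" "s < r" "DERIV E s :> l" "E r - E 0 = (r - 0) * l" by blast
      then have "l = - k * s * (H (s / a) - H\<^sub>0)" using DERIV_unique[OF s(3) D[OF s(1,2)]] by simp
      with s show ?thesis by blast
    qed
    then obtain s where s: "0 < s" "s < r" "E r = r * (- k * s * (H (s / a) - H\<^sub>0))" using E0 by auto
    have sX: "s / a \<in> {0..X}" using scaled_range[of s] s r by auto
    have "\<bar>E r\<bar> = r * k * s * \<bar>H (s / a) - H\<^sub>0\<bar>" using s r k by (simp add: abs_mult)
    also have "\<dots> \<le> r * k * r * (C * (r / a)\<^sup>2)"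
    proof (rule mult_mono)
      show "r * k * s \<le> r * k * r" using s r k by (intro mult_left_mono) auto
      have "(s / a)\<^sup>2 \<le> (r / a)\<^sup>2" using s a_pos by (intro power_mono divide_right_mono) auto
      then have "C * (s / a)\<^sup>2 \<le> C * (r / a)\<^sup>2" using C by (intro mult_left_mono) auto
      then show "\<bar>H (s / a) - H\<^sub>0\<bar> \<le> C * (r / a)\<^sup>2" using C(2)[OF sX] by simp
    qed (use s r k in auto)
    also have "\<dots> = k * C / a\<^sup>2 * r ^ 4" by (simp add: power_divide eval_nat_numeral)
    finally show "\<bar>E r\<bar> \<le> k * C / a\<^sup>2 * r ^ 4" .
  qed
  moreover have "E = (\<lambda>r. pS r - (Pf \<rho>c - (\<rho>c + Pf \<rho>c / c\<^sup>2) *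
     (4 * pi * G * (\<rho>c + 3 * Pf \<rho>c / c\<^sup>2) - c\<^sup>2 * \<Lambda>) * r\<^sup>2 / 6))"
  proof
    fix r
    have "(\<rho>c + Pf \<rho>c / c\<^sup>2) * (4 * pi * G * (\<rho>c + 3 * Pf \<rho>c / c\<^sup>2) - c\<^sup>2 * \<Lambda>) * r\<^sup>2 / 6 = k * H\<^sub>0 * r\<^sup>2 / 2"
      using arg_cong[OF coeff, of "\<lambda>t. t * r\<^sup>2"] by (simp only: times_divide_eq_left)
    then show "E r = pS r - (Pf \<rho>c - (\<rho>c + Pf \<rho>c / c\<^sup>2) *
     (4 * pi * G * (\<rho>c + 3 * Pf \<rho>c / c\<^sup>2) - c\<^sup>2 * \<Lambda>) * r\<^sup>2 / 6)" by (simp only: E_def)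
  qed
  ultimately show ?thesis by simp
qed

text \<open>A longer solution would be continuous at \<open>rS\<close> with limiting pressure 0,
  while the domain admits only pressures of positive densities.\<close>

lemma maximal:
  assumes "ereal rS \<le> R" "tov_solution c G \<Lambda> Pf R m p"
    and eq: "\<And>r. 0 < r \<Longrightarrow> r < rS \<Longrightarrow> m r = mS r \<and> p r = pS r"
  shows "R = ereal rS"
proof (rule ccontr)
  assume "R \<noteq> ereal rS"
  then have "ereal rS < R" using assms(1) by simp
  from assms(2)[unfolded tov_solution_def, rule_format, OF conjI[OF rS_pos this]]
  have dom: "(rS, m rS, p rS) \<in> tov_domain c G \<Lambda> Pf"
    and D: "\<exists>D. (p has_real_derivative D) (at rS)"
    by blast+
  from dom obtain \<rho> where "0 < \<rho>" "p rS = Pf \<rho>" by (auto simp: tov_domain_def)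
  then have "0 < p rS" using Pf_pos[of \<rho>] by simp
  have "isCont p rS" using D DERIV_isCont by blast
  then have "(p \<longlongrightarrow> p rS) (at_left rS)" unfolding isCont_def by (rule tendsto_within_subset) simp
  moreover have "eventually (\<lambda>r. pS r = p r) (at_left rS)"
    unfolding eventually_at_left_field using rS_pos eq by (intro exI[of _ 0]) auto
  then have "(p \<longlongrightarrow> 0) (at_left rS)" using pS_limit by (rule Lim_transform_eventually[rotated])
  ultimately have "p rS = 0" using tendsto_unique[of "at_left rS"] by (simp add: trivial_limit_at_left_real)
  with \<open>0 < p rS\<close> show False by simp
qed

lemma prolongation: "tov_prolongation c G \<Lambda> Pf \<rho>c (ereal rS) mS pS"
  unfolding tov_prolongation_def tov_central_expansion_def
proof (intro conjI allI impI)
  fix R m p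
  assume "ereal rS \<le> R \<and> tov_solution c G \<Lambda> Pf R m p \<and>
    (\<forall>r. 0 < r \<and> ereal r < ereal rS \<longrightarrow> m r = mS r \<and> p r = pS r)"
  then show "R = ereal rS" by (intro maximal[of R m p]) auto
qed (use rS_pos solution mS_expansion pS_expansion in simp_all)

section \<open>Uniqueness of solutions with the given germ\<close>

context
  fixes R :: ereal and m p :: "real \<Rightarrow> real"
  assumes sol: "tov_solution c G \<Lambda> Pf R m p" and germ: "tov_central_expansion c G \<Lambda> Pf \<rho>c m p" and R: "0 < R"
begin

definition dens where "dens r = density_of Pf (p r)"
text \<open>The scaled unknown x / xc of an arbitrary solution, in the variable \<xi> = r / a. The
  value of p at 0 is arbitrary, so the limit 1 is put in by hand.\<close>

definition \<psi> where "\<psi> \<xi> = (if \<xi> = 0 then 1 else x_of (dens (a * \<xi>)) / xc)"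

lemma sol_at:
  assumes "0 < r" "ereal r < R"
  shows "0 < dens r" "p r = Pf (dens r)" "0 < kappa c G \<Lambda> r (m r)"
    "(m has_real_derivative 4 * pi * r\<^sup>2 * dens r) (at r)"
    "(p has_real_derivative dPdr r (m r) (p r)) (at r)"
proof -
  note s = sol[unfolded tov_solution_def, rule_format, OF conjI[OF assms]]
  note dom = s[THEN conjunct1, unfolded tov_domain_def]
  have pr: "p r \<in> Pf ` {0<..}" using dom by simp
  show "0 < dens r" "p r = Pf (dens r)" unfolding dens_def using density_range[OF pr] by simp_all
  show "0 < kappa c G \<Lambda> r (m r)" using dom by simp
  show "(m has_real_derivative 4 * pi * r\<^sup>2 * dens r) (at r)"
    unfolding dens_def by (rule s[THEN conjunct2, THEN conjunct1])
  show "(p has_real_derivative dPdr r (m r) (p r)) (at r)"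
    unfolding dPdr_def by (rule s[THEN conjunct2, THEN conjunct2])
qed

lemma dens_deriv:
  assumes "0 < r" "ereal r < R"
  shows "(dens has_real_derivative inverse (deriv Pf (dens r)) * dPdr r (m r) (p r)) (at r)"
proof -
  have "(density_of Pf has_real_derivative inverse (deriv Pf (dens r))) (at (p r))"
    using density_deriv[OF sol_at(1)[OF assms]] unfolding sol_at(2)[OF assms, symmetric] .
  from DERIV_chain2[OF this sol_at(5)[OF assms]] show ?thesis unfolding dens_def .
qed

lemma \<psi>_deriv':
  assumes "0 < \<xi>" "ereal (a * \<xi>) < R"
  shows "(\<psi> has_real_derivative
    ((\<gamma> - 1) * x_of (dens (a * \<xi>)) / dens (a * \<xi>)) *
    (inverse (deriv Pf (dens (a * \<xi>))) * dPdr (a * \<xi>) (m (a * \<xi>)) (p (a * \<xi>)) * a) / xc) (at \<xi>)"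
proof -
  have r: "0 < a * \<xi>" using assms a_pos by simp
  have Da: "((\<lambda>\<xi>. a * \<xi>) has_real_derivative a) (at \<xi>)" by (auto intro!: derivative_eq_intros)
  have D: "((\<lambda>\<xi>. x_of (dens (a * \<xi>)) / xc) has_real_derivative
    ((\<gamma> - 1) * x_of (dens (a * \<xi>)) / dens (a * \<xi>)) *
    (inverse (deriv Pf (dens (a * \<xi>))) * dPdr (a * \<xi>) (m (a * \<xi>)) (p (a * \<xi>)) * a) / xc) (at \<xi>)"
    by (rule DERIV_cdivide[OF DERIV_chain2[OF x_of_deriv[OF sol_at(1)[OF r assms(2)]]
        DERIV_chain2[OF dens_deriv[OF r assms(2)] Da]]])
  have "eventually (\<lambda>\<xi>. \<xi> \<in> {0<..}) (nhds \<xi>)"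
    by (rule eventually_nhds_in_open) (use assms in auto)
  then have ev: "eventually (\<lambda>\<xi>. x_of (dens (a * \<xi>)) / xc = \<psi> \<xi>) (nhds \<xi>)"
    by eventually_elim (simp add: \<psi>_def)
  show ?thesis by (rule DERIV_cong_ev[OF refl ev refl, THEN iffD1, OF D])
qed

lemma m_at_0: "(m \<longlongrightarrow> 0) (at_right 0)"
proof -
  have "(\<lambda>r. m r - 4 * pi / 3 * \<rho>c * r ^ 3) \<in> O[at_right 0](\<lambda>r. r ^ 5)"
    using germ by (simp add: tov_central_expansion_def)
  moreover have "((\<lambda>r :: real. r ^ 5) \<longlongrightarrow> 0) (at_right 0)" by (auto intro!: tendsto_eq_intros)
  then have "(\<lambda>r :: real. r ^ 5) \<in> o[at_right 0](\<lambda>_. 1 :: real)" by (intro smalloI_tendsto) auto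
  ultimately have "(\<lambda>r. m r - 4 * pi / 3 * \<rho>c * r ^ 3) \<in> o[at_right 0](\<lambda>_. 1 :: real)"
    by (rule landau_o.big_small_trans)
  from smalloD_tendsto[OF this]
  have "((\<lambda>r. m r - 4 * pi / 3 * \<rho>c * r ^ 3) \<longlongrightarrow> 0) (at_right 0)" by simp
  moreover have "((\<lambda>r. 4 * pi / 3 * \<rho>c * r ^ 3) \<longlongrightarrow> 0) (at_right 0)" by (auto intro!: tendsto_eq_intros)
  ultimately have "((\<lambda>r. m r - 4 * pi / 3 * \<rho>c * r ^ 3 + 4 * pi / 3 * \<rho>c * r ^ 3) \<longlongrightarrow> 0 + 0) (at_right 0)"
    by (rule tendsto_add)
  then show ?thesis by simp
qed

lemma p_at_0: "(p \<longlongrightarrow> Pf \<rho>c) (at_right 0)"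
proof -
  define q where "q r = Pf \<rho>c - (\<rho>c + Pf \<rho>c / c\<^sup>2) *
     (4 * pi * G * (\<rho>c + 3 * Pf \<rho>c / c\<^sup>2) - c\<^sup>2 * \<Lambda>) * r\<^sup>2 / 6" for r
  have "(\<lambda>r. p r - q r) \<in> O[at_right 0](\<lambda>r. r ^ 4)"
    using germ by (simp add: tov_central_expansion_def q_def)
  moreover have "((\<lambda>r :: real. r ^ 4) \<longlongrightarrow> 0) (at_right 0)" by (auto intro!: tendsto_eq_intros)
  then have "(\<lambda>r :: real. r ^ 4) \<in> o[at_right 0](\<lambda>_. 1 :: real)" by (intro smalloI_tendsto) auto
  ultimately have "(\<lambda>r. p r - q r) \<in> o[at_right 0](\<lambda>_. 1 :: real)"
    by (rule landau_o.big_small_trans)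
  from smalloD_tendsto[OF this]
  have "((\<lambda>r. p r - q r) \<longlongrightarrow> 0) (at_right 0)" by simp
  moreover have "(q \<longlongrightarrow> Pf \<rho>c) (at_right 0)" unfolding q_def[abs_def] by (auto intro!: tendsto_eq_intros)
  ultimately have "((\<lambda>r. p r - q r + q r) \<longlongrightarrow> 0 + Pf \<rho>c) (at_right 0)"
    by (rule tendsto_add)
  then show ?thesis by simp
qed

lemma scale_filter: "filterlim (\<lambda>\<xi>. a * \<xi>) (at_right 0) (at_right 0)"
  unfolding filterlim_at
proof
  show "((\<lambda>\<xi>. a * \<xi>) \<longlongrightarrow> 0) (at_right 0)" by (auto intro!: tendsto_eq_intros)
  show "eventually (\<lambda>\<xi>. a * \<xi> \<in> {0<..} \<and> a * \<xi> \<noteq> 0) (at_right 0)"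
    unfolding eventually_at_right_field using a_pos by (intro exI[of _ 1]) auto
qed

lemma \<psi>_at_0: "(\<psi> \<longlongrightarrow> 1) (at_right 0)"
proof -
  have "isCont (density_of Pf) (Pf \<rho>c)" by (rule DERIV_isCont[OF density_deriv[OF \<rho>c]])
  from isCont_tendsto_compose[OF this p_at_0]
  have "(dens \<longlongrightarrow> \<rho>c) (at_right 0)" unfolding dens_def[abs_def] density_Pf[OF \<rho>c] .
  from isCont_tendsto_compose[OF DERIV_isCont[OF x_of_deriv[OF \<rho>c]] this]
  have "((\<lambda>r. x_of (dens r)) \<longlongrightarrow> xc) (at_right 0)" by (simp add: xc_eq)
  from filterlim_compose[OF this scale_filter]
  have "((\<lambda>\<xi>. x_of (dens (a * \<xi>)) / xc) \<longlongrightarrow> xc / xc) (at_right 0)"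
    using xc by (intro tendsto_divide tendsto_const) auto
  then have "((\<lambda>\<xi>. x_of (dens (a * \<xi>)) / xc) \<longlongrightarrow> 1) (at_right 0)" using xc by simp
  moreover have "eventually (\<lambda>\<xi>. x_of (dens (a * \<xi>)) / xc = \<psi> \<xi>) (at_right 0)"
    unfolding eventually_at_right_field by (intro exI[of _ 1]) (auto simp: \<psi>_def)
  ultimately show ?thesis by (rule Lim_transform_eventually)
qed

lemma in_R: "ereal (a * Y) < R \<Longrightarrow> \<xi> \<le> Y \<Longrightarrow> ereal (a * \<xi>) < R"
  using a_pos by (elim le_less_trans[rotated]) simp

lemma \<psi>_cont:
  assumes "0 < Y" "ereal (a * Y) < R"
  shows "continuous_on {0..Y} \<psi>"
  unfolding continuous_on_eq_continuous_within
proof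
  fix \<xi> assume \<xi>: "\<xi> \<in> {0..Y}"
  show "continuous (at \<xi> within {0..Y}) \<psi>"
  proof (cases "\<xi> = 0")
    case True
    have "(\<psi> \<longlongrightarrow> \<psi> 0) (at 0 within {0..Y})"
      using \<psi>_at_0 assms at_within_Icc_at_right[of 0 Y] by (simp add: \<psi>_def)
    then show ?thesis using True by (simp add: continuous_within)
  next
    case False
    then have "0 < \<xi>" using \<xi> by auto
    moreover have "ereal (a * \<xi>) < R" using in_R[OF assms(2)] \<xi> by auto
    ultimately show ?thesis using DERIV_isCont[OF \<psi>_deriv'] by (blast intro: continuous_at_imp_continuous_at_within)
  qed
qed

lemma \<psi>_pos:
  assumes "0 < \<xi>" "ereal (a * \<xi>) < R"
  shows "0 < \<psi> \<xi>" "dens (a * \<xi>) = \<rho>c * \<psi> \<xi> powr n"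
proof -
  have r: "0 < a * \<xi>" using assms a_pos by simp
  have d: "0 < dens (a * \<xi>)" by (rule sol_at(1)[OF r assms(2)])
  have x: "0 < x_of (dens (a * \<xi>))" by (rule x_of_pos[OF d])
  show "0 < \<psi> \<xi>" using x assms xc by (simp add: \<psi>_def)
  have e: "c\<^sup>2 * x_of (dens (a * \<xi>)) / A = (c\<^sup>2 * x_of \<rho>c / A) * \<psi> \<xi>"
    using assms xc by (simp add: \<psi>_def xc_eq[symmetric])
  have "(c\<^sup>2 * x_of (dens (a * \<xi>)) / A) powr n = (c\<^sup>2 * x_of \<rho>c / A) powr n * \<psi> \<xi> powr n"
    unfolding e by (subst powr_mult) (use A x_of_pos[OF \<rho>c] \<open>0 < \<psi> \<xi>\<close> in auto)
  then show "dens (a * \<xi>) = \<rho>c * \<psi> \<xi> powr n" using x_of_inverse[OF d] x_of_inverse[OF \<rho>c] by simp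
qed

text \<open>As long as \<open>\<psi>\<close> \<le> 2 the truncation is inactive, so the given
  solution obeys the same truncated Volterra equation as \<open>\<theta>\<close>.\<close>

context
  fixes Y :: real
  assumes Y: "0 < Y" "Y \<le> X" "ereal (a * Y) < R" and \<psi>_le: "\<And>\<xi>. \<xi> \<in> {0..Y} \<Longrightarrow> \<psi> \<xi> \<le> 2"
begin

lemma trunc_\<psi>: "0 < \<xi> \<Longrightarrow> \<xi> \<le> Y \<Longrightarrow> trunc (\<psi> \<xi>) = \<psi> \<xi>"
  using \<psi>_pos(1)[of \<xi>] in_R[OF Y(3), of \<xi>] \<psi>_le[of \<xi>] by (intro trunc_id) auto

lemma m_\<psi>:
  assumes "0 < \<xi>" "\<xi> \<le> Y"
  shows "m (a * \<xi>) = 4 * pi * \<rho>c * (a * \<xi>) ^ 3 * avg n \<psi> \<xi>"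
proof -
  \<comment> \<open>The value of m at 0 is arbitrary; replacing it by the limit 0 makes the function
    continuous on the closed interval.\<close>
  define f where "f \<xi> = (if \<xi> = 0 then 0 else m (a * \<xi>))" for \<xi>
  have fd: "(f has_real_derivative 4 * pi * \<rho>c * a ^ 3 * (s\<^sup>2 * trunc (\<psi> s) powr n)) (at s)"
    if s: "0 < s" "s \<le> Y" for s
  proof -
    have sR: "ereal (a * s) < R" by (rule in_R[OF Y(3) s(2)])
    have r: "0 < a * s" using s a_pos by simp
    have Da: "((\<lambda>\<xi>. a * \<xi>) has_real_derivative a) (at s)" by (auto intro!: derivative_eq_intros)
    have D: "((\<lambda>\<xi>. m (a * \<xi>)) has_real_derivative 4 * pi * (a * s)\<^sup>2 * dens (a * s) * a) (at s)"
      by (rule DERIV_chain2[OF sol_at(4)[OF r sR] Da])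
    have e: "4 * pi * (a * s)\<^sup>2 * dens (a * s) * a = 4 * pi * \<rho>c * a ^ 3 * (s\<^sup>2 * trunc (\<psi> s) powr n)"
      unfolding \<psi>_pos(2)[OF s(1) sR] trunc_\<psi>[OF s] by (simp add: power2_eq_square power3_eq_cube)
    have "eventually (\<lambda>\<xi>. \<xi> \<in> {0<..}) (nhds s)"
      by (rule eventually_nhds_in_open) (use s in auto)
    then have ev: "eventually (\<lambda>\<xi>. m (a * \<xi>) = f \<xi>) (nhds s)"
      by eventually_elim (simp add: f_def)
    show ?thesis by (rule DERIV_cong_ev[OF refl ev refl, THEN iffD1, OF D[unfolded e]])
  qed
  have fc: "continuous_on {0..\<xi>} f"
    unfolding continuous_on_eq_continuous_within
  proof
    fix s assume s: "s \<in> {0..\<xi>}"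
    show "continuous (at s within {0..\<xi>}) f"
    proof (cases "s = 0")
      case True
      have "((\<lambda>\<xi>. m (a * \<xi>)) \<longlongrightarrow> 0) (at_right 0)" by (rule filterlim_compose[OF m_at_0 scale_filter])
      moreover have "eventually (\<lambda>\<xi>. m (a * \<xi>) = f \<xi>) (at_right 0)"
        unfolding eventually_at_right_field by (intro exI[of _ 1]) (auto simp: f_def)
      ultimately have "(f \<longlongrightarrow> 0) (at_right 0)" by (rule Lim_transform_eventually)
      then show ?thesis using True assms at_within_Icc_at_right[of 0 \<xi>] by (simp add: continuous_within f_def)
    next
      case False
      then have "0 < s" "s \<le> Y" using s assms by auto
      then show ?thesis using DERIV_isCont[OF fd] by (blast intro: continuous_at_imp_continuous_at_within)
    qed
  qed
  have "((\<lambda>s. 4 * pi * \<rho>c * a ^ 3 * (s\<^sup>2 * trunc (\<psi> s) powr n)) has_integral f \<xi> - f 0) {0..\<xi>}"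
    by (rule fundamental_theorem_of_calculus_interior[OF _ fc])
      (use assms fd in \<open>auto simp: has_real_derivative_iff_has_vector_derivative[symmetric]\<close>)
  from integral_unique[OF this, symmetric]
  have "f \<xi> = integral {0..\<xi>} (\<lambda>s. 4 * pi * \<rho>c * a ^ 3 * (s\<^sup>2 * trunc (\<psi> s) powr n))"
    unfolding f_def[of 0] by simp
  also have "\<dots> = 4 * pi * \<rho>c * a ^ 3 * integral {0..\<xi>} (\<lambda>s. s\<^sup>2 * trunc (\<psi> s) powr n)"
    by (rule integral_mult_right)
  also have "integral {0..\<xi>} (\<lambda>s. s\<^sup>2 * trunc (\<psi> s) powr n) = \<xi> ^ 3 * avg n \<psi> \<xi>"
    using avg_mass[OF n_bounds(3) \<psi>_cont[OF Y(1,3)], of \<xi>] assms by simp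
  finally show ?thesis using assms by (simp add: f_def power_mult_distrib mult_ac)
qed

text \<open>The factor \<open>deriv Pf\<close> in \<open>dPdr_scaled\<close> cancels against the
  derivative of the inverse function, and the remaining numerical factor is (\<gamma> - 1) * n =
  1.\<close>

lemma \<psi>_deriv:
  assumes "0 < \<xi>" "\<xi> \<le> Y"
  shows "(\<psi> has_real_derivative - rate xc \<beta> \<xi> (avg n \<psi> \<xi>) (\<psi> \<xi>)) (at \<xi>)"
proof -
  define y where "y = \<psi> \<xi>"
  define v where "v = avg n \<psi> \<xi>"
  define \<rho> where "\<rho> = dens (a * \<xi>)"
  have \<xi>R: "ereal (a * \<xi>) < R" by (rule in_R[OF Y(3) assms(2)])
  have r: "0 < a * \<xi>" using assms a_pos by simp
  have y: "0 < y" "y \<le> 2" using \<psi>_pos(1)[OF assms(1) \<xi>R] \<psi>_le[of \<xi>] assms by (auto simp: y_def)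
  have \<rho>: "0 < \<rho>" "\<rho> = \<rho>c * y powr n"
    unfolding \<rho>_def y_def by (rule sol_at(1)[OF r \<xi>R], rule \<psi>_pos(2)[OF assms(1) \<xi>R])
  have x: "x_of \<rho> = xc * y" using x_of_scale[of \<rho>c y] \<rho>c y by (simp add: \<rho>(2) xc_eq)
  have d: "dPdr (a * \<xi>) (m (a * \<xi>)) (p (a * \<xi>)) =
      deriv Pf \<rho> * (\<rho>c * (n * y powr (n - 1))) * (- rate xc \<beta> \<xi> v y / a)"
    using dPdr_scaled(1)[OF y r, of v] a_pos sol_at(2)[OF r \<xi>R]
    by (simp add: m_\<psi>[OF assms] v_def[symmetric] \<rho>_def[symmetric] \<rho>(2)[symmetric])
  have dp: "deriv Pf \<rho> \<noteq> 0" using Pf_deriv_pos[OF \<rho>(1)] by simp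
  have yn: "y powr n = y * y powr (n - 1)" using y by (simp add: powr_diff)
  have "(\<gamma> - 1) * x_of \<rho> / \<rho> * (inverse (deriv Pf \<rho>) * dPdr (a * \<xi>) (m (a * \<xi>)) (p (a * \<xi>)) * a) / xc
      = - (((\<gamma> - 1) * n) * rate xc \<beta> \<xi> v y)"
  proof -
    have "(\<gamma> - 1) * (xc * y) / (\<rho>c * (y * q)) * (inverse D * (D * (\<rho>c * (n * q)) * (- t / a)) * a) / xc = - (((\<gamma> - 1) * n) * t)"
      if "D \<noteq> 0" "q \<noteq> 0" for D q t :: real
      using that y \<rho>c xc a_pos by (simp add: field_simps)
    from this[OF dp, of "y powr (n - 1)" "rate xc \<beta> \<xi> v y"] y
    show ?thesis unfolding d x by (simp add: \<rho>(2) yn)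
  qed
  then show ?thesis using \<psi>_deriv'[OF assms(1) \<xi>R] \<gamma>_n by (simp add: \<rho>_def v_def y_def)
qed

lemma \<psi>_eq_\<theta>:
  assumes "\<xi> \<in> {0..Y}"
  shows "\<psi> \<xi> = \<theta> \<xi>"
proof -
  interpret Y: volterra "rate xc \<beta>" Y L n
    by (rule volterra_mono[OF volt]) (use Y in auto)
  have cc: "continuous_on {0..Y} \<psi>" by (rule \<psi>_cont[OF Y(1,3)])
  have ct: "continuous_on {0..Y} \<theta>" by (rule continuous_on_subset[OF cont]) (use Y in auto)
  have fc: "\<psi> \<xi> = Y.T \<psi> \<xi>" if \<xi>: "\<xi> \<in> {0..Y}" for \<xi>
  proof -
    have "((\<lambda>s. - rate xc \<beta> s (avg n \<psi> s) (\<psi> s)) has_integral \<psi> \<xi> - \<psi> 0) {0..\<xi>}"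
      by (rule fundamental_theorem_of_calculus_interior[OF _ continuous_on_subset[OF cc]])
        (use \<xi> \<psi>_deriv in \<open>auto simp: has_real_derivative_iff_has_vector_derivative[symmetric]\<close>)
    from integral_unique[OF this] show ?thesis by (simp add: Y.T_def \<psi>_def[of 0])
  qed
  have ft: "\<theta> \<xi> = Y.T \<theta> \<xi>" if "\<xi> \<in> {0..Y}" for \<xi> using fixp[of \<xi>] that Y by (simp add: Y.T_def)
  have "\<bar>\<psi> \<xi> - \<theta> \<xi>\<bar> \<le> 2 * 0 * exp (Y.M * Y)"
    \<comment> \<open>Both functions are exact fixed points on [0, Y], so the defect is 0.\<close>
    by (rule Y.stability[OF cc ct _ ft assms]) (use fc in auto)
  then show ?thesis by simp
qed

end

text \<open>A bootstrap: the first time \<open>\<psi>\<close> reaches \<open>2\<close> it would still agree with \<open>\<theta> \<le> 1\<close>.\<close>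

lemma \<psi>_le_2:
  assumes "0 < Y" "Y \<le> X" "ereal (a * Y) < R" "\<xi> \<in> {0..Y}"
  shows "\<psi> \<xi> \<le> 2"
proof (rule ccontr)
  assume "\<not> \<psi> \<xi> \<le> 2"
  have c\<psi>: "continuous_on {0..t} \<psi>" if "t \<in> {0..Y}" for t
    by (rule continuous_on_subset[OF \<psi>_cont[OF assms(1,3)]]) (use that in auto)
  have hit: "\<exists>s\<ge>0. s \<le> t \<and> \<psi> s = 2" if "2 < \<psi> t" "t \<in> {0..Y}" for t
    by (rule IVT') (use that c\<psi> in \<open>auto simp: \<psi>_def[of 0]\<close>)
  define S where "S = {s \<in> {0..Y}. \<psi> s = 2}"
  have "closed S" unfolding S_def
    by (rule continuous_closed_preimage_constant[OF \<psi>_cont[OF assms(1,3)]]) simp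
  moreover have "bounded S" by (rule bounded_subset[of "{0..Y}"]) (auto simp: S_def)
  ultimately have "compact S" by (simp add: compact_eq_bounded_closed)
  moreover have "S \<noteq> {}"
  proof -
    obtain s where "0 \<le> s" "s \<le> \<xi>" "\<psi> s = 2" using hit[of \<xi>] \<open>\<not> \<psi> \<xi> \<le> 2\<close> assms(4) by auto
    then have "s \<in> S" using assms(4) by (simp add: S_def)
    then show ?thesis by blast
  qed
  ultimately have "\<exists>t\<in>S. \<forall>s\<in>S. t \<le> s" by (rule compact_attains_inf)
  then obtain t where t: "t \<in> {0..Y}" "\<psi> t = 2" and first: "\<And>s. s \<in> {0..Y} \<Longrightarrow> \<psi> s = 2 \<Longrightarrow> t \<le> s"
    unfolding S_def by blast
  have t0: "0 < t" using t by (cases "t = 0") (auto simp: \<psi>_def[of 0])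
  have le: "\<psi> s \<le> 2" if s: "s \<in> {0..t}" for s
  proof (rule ccontr)
    assume "\<not> \<psi> s \<le> 2"
    then obtain u where u: "0 \<le> u" "u \<le> s" "\<psi> u = 2" using hit[of s] s t by auto
    then have "t \<le> u" using s t by (intro first) auto
    then have "u = s" using u s by auto
    then show False using u \<open>\<not> \<psi> s \<le> 2\<close> by simp
  qed
  have "\<psi> t = \<theta> t"
    by (rule \<psi>_eq_\<theta>[of t]) (use t0 t assms le in_R[OF assms(3), of t] in auto)
  then show False using t \<theta>_le[of t] assms by simp
qed

lemma \<psi>_\<theta>:
  assumes "0 < \<xi>" "\<xi> \<le> X" "ereal (a * \<xi>) < R"
  shows "\<psi> \<xi> = \<theta> \<xi>" "m (a * \<xi>) = mS (a * \<xi>)" "p (a * \<xi>) = pS (a * \<xi>)"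
proof -
  note le = \<psi>_le_2[OF assms]
  have eq: "\<psi> s = \<theta> s" if "s \<in> {0..\<xi>}" for s by (rule \<psi>_eq_\<theta>[OF assms le that])
  show e: "\<psi> \<xi> = \<theta> \<xi>" using eq assms by simp
  have "avg n \<psi> \<xi> = w \<xi>" unfolding avg_def
    by (rule integral_cong) (use eq assms in \<open>auto simp: mult_left_le\<close>)
  then show "m (a * \<xi>) = mS (a * \<xi>)" using m_\<psi>[OF assms le, of \<xi>] assms a_pos by (simp add: mS_def)
  have "0 < a * \<xi>" using assms a_pos by simp
  from sol_at(2)[OF this assms(3)]
  show "p (a * \<xi>) = pS (a * \<xi>)" using \<psi>_pos(2)[OF assms(1,3)] e a_pos by (simp add: pS_def)
qed

text \<open>A solution reaching \<open>rS\<close> would have positive density there, hence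
  \<open>\<psi>\<close> positive at z, but it equals \<open>\<theta>\<close>, which vanishes at
  z.\<close>

lemma R_le: "R \<le> ereal rS"
proof (rule ccontr)
  assume "\<not> R \<le> ereal rS"
  then have zR: "ereal (a * z) < R" by (simp add: rS_def not_le)
  have "\<psi> z = \<theta> z" using z zR by (intro \<psi>_\<theta>(1)) auto
  then show False using \<psi>_pos(1)[OF z(1) zR] z by simp
qed

lemma agree:
  assumes "0 < r" "ereal r < R"
  shows "m r = mS r" "p r = pS r"
proof -
  have "ereal r < ereal rS" using assms(2) R_le by (rule less_le_trans)
  then have s: "0 < r / a" "r / a \<le> X" using scaled_range[of r] assms by auto
  have e: "a * (r / a) = r" using a_pos by simp
  show "m r = mS r" "p r = pS r" using \<psi>_\<theta>(2,3)[OF s] assms unfolding e by auto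
qed

end

text \<open>By uniqueness the prolongation is a restriction of the constructed solution. The latter
  is then one of the extensions against which maximality is tested, so both end at
  \<open>rS\<close>, and the limits can be read off the profile.\<close>

lemma prolongation_monotone_short:
  assumes "tov_prolongation c G \<Lambda> Pf \<rho>c R m p"
  shows "monotone_short c G \<Lambda> R m p"
proof -
  have R: "0 < R" and sol: "tov_solution c G \<Lambda> Pf R m p" and germ: "tov_central_expansion c G \<Lambda> Pf \<rho>c m p"
    and maxi: "\<And>R' m' p'. R \<le> R' \<Longrightarrow> tov_solution c G \<Lambda> Pf R' m' p' \<Longrightarrow>
      (\<And>r. 0 < r \<Longrightarrow> ereal r < R \<Longrightarrow> m' r = m r \<and> p' r = p r) \<Longrightarrow> R' = R"
    using assms unfolding tov_prolongation_def by blast+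
  note ag = agree[OF sol germ R]
  have RS: "R = ereal rS"
    by (rule maxi[OF R_le[OF sol germ R] solution, symmetric]) (simp add: ag)
  have ag': "m r = mS r" "p r = pS r" if "0 < r" "r < rS" for r using ag[of r] that RS by auto
  have ev: "eventually (\<lambda>r. mS r = m r \<and> pS r = p r) (at_left rS)"
    unfolding eventually_at_left_field using rS_pos ag' by (intro exI[of _ 0]) auto
  have evm: "eventually (\<lambda>r. mS r = m r) (at_left rS)" and evp: "eventually (\<lambda>r. pS r = p r) (at_left rS)"
    using ev by (auto elim: eventually_mono)
  have rz: "rS / a = z" using a_pos by (simp add: rS_def)
  have "isCont w z"
    using continuous_on_avg[OF n_bounds(3) cont] z by (intro continuous_on_interior[of "{0..X}"]) auto
  then have "isCont (\<lambda>r. w (r / a)) rS"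
    using isCont_o2[of rS "\<lambda>r. r / a" w] a_pos rz by simp
  then have "isCont mS rS" unfolding mS_def[abs_def] by (intro continuous_intros)
  then have "(mS \<longlongrightarrow> mS rS) (at_left rS)" unfolding isCont_def by (rule tendsto_within_subset) simp
  then have ml: "(m \<longlongrightarrow> mS rS) (at_left rS)" using evm by (rule Lim_transform_eventually)
  have pl: "(p \<longlongrightarrow> 0) (at_left rS)" using pS_limit evp by (rule Lim_transform_eventually)
  have kl: "((\<lambda>r. kappa c G \<Lambda> r (m r)) \<longlongrightarrow> kappa c G \<Lambda> rS (mS rS)) (at_left rS)"
    unfolding kappa_def by (intro tendsto_intros ml) (use rS_pos c in auto)
  have Ql: "((\<lambda>r. tov_Q c G \<Lambda> r (m r) (p r)) \<longlongrightarrow> tov_Q c G \<Lambda> rS (mS rS) 0) (at_left rS)"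
    unfolding tov_Q_def by (intro tendsto_intros ml pl) (use c in auto)
  have kpos: "0 < kappa c G \<Lambda> rS (mS rS)" using mS_kappa[of rS] rS_pos by simp
  have f: "0 < force xc \<beta> (w \<xi>) (\<theta> \<xi>)" if "0 < \<xi>" "\<xi> \<le> z" for \<xi> using that z by (intro force_pos) auto
  have Qpos: "0 < tov_Q c G \<Lambda> rS (mS rS) 0"
  proof -
    \<comment> \<open>The scaled formula remains valid at the surface: the density is 0 there and
      \<open>gas_pressure\<close> evaluates to 0 because 0 powr \<gamma> = 0, so Q has the sign of
      \<open>force\<close>.\<close>
    have "tov_Q c G \<Lambda> rS (mS rS) (Pf (\<rho>c * \<theta> z powr n)) = 4 * pi * G * \<rho>c * rS ^ 3 * force xc \<beta> (w z) (\<theta> z)"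
      unfolding mS_def rz by (rule tov_Q_scaled) (use z in auto)
    moreover have "Pf (\<rho>c * \<theta> z powr n) = 0" using z by (simp add: gas_pressure_def)
    ultimately show ?thesis using G \<rho>c rS_pos f[of z] z by simp
  qed
  have neg: "deriv p r < 0" if r: "0 < r" "r < rS" for r
  proof -
    have rR: "ereal r < R" using r RS by simp
    have s: "0 < r / a" "r / a < z" "r / a < X" using scaled_range[OF r] by auto
    have y: "0 < \<theta> (r / a)" "\<theta> (r / a) \<le> 2" using \<theta>_pos[of "r / a"] \<theta>_le[of "r / a"] s by auto
    have "0 < kap xc \<beta> (r / a) (w (r / a))" using kap_half[OF _ w_range, of "r / a" "r / a"] s by simp
    then have "0 < (\<rho>c * (\<theta> (r / a) powr n + press xc (\<theta> (r / a)))) *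
        (4 * pi * G * \<rho>c * r * force xc \<beta> (w (r / a)) (\<theta> (r / a)) / kap xc \<beta> (r / a) (w (r / a)))"
      using \<rho>c G r y press_range(1)[of "\<theta> (r / a)"] f[of "r / a"] s
      by (intro mult_pos_pos divide_pos_pos add_pos_nonneg) auto
    then have "dPdr r (mS r) (pS r) < 0" unfolding mS_def pS_def dPdr_scaled(2)[OF y r(1)] by simp
    moreover have "deriv p r = dPdr r (m r) (p r)"
      by (rule DERIV_imp_deriv[OF sol_at(5)[OF sol germ R r(1) rR]])
    ultimately show ?thesis using ag'[OF r] by simp
  qed
  show ?thesis unfolding monotone_short_def
    using RS neg pl ml kl Ql kpos Qpos by blast
qed

end

theorem theorem1:
  fixes \<gamma> :: real and \<Omega> :: "real \<Rightarrow> real" and U :: "real set"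
  assumes "6 / 5 < \<gamma>" and "\<gamma> < 2"
    and "open U" and "{0..} \<subseteq> U" and "real_analytic_on \<Omega> U" and "\<Omega> 0 = 1"
  shows "\<exists>\<epsilon>\<^sub>0. 0 < \<epsilon>\<^sub>0 \<and> \<epsilon>\<^sub>0 \<le> 1 \<and>
    (\<forall>c G A \<Lambda> \<rho>c Pf uc.
       0 < c \<and> 0 < G \<and> 0 < A \<and> 0 < \<Lambda> \<and> 0 < \<rho>c \<and>
       Pf = gas_pressure c A \<gamma> \<Omega> \<and> admissible_pressure c Pf \<and>
       uc = central_potential c Pf \<rho>c \<and>
       uc \<le> c\<^sup>2 * \<epsilon>\<^sub>0 \<and>
       \<Lambda> \<le> 4 * pi / c\<^sup>2 * G * ((\<gamma> - 1) / (\<gamma> * A)) powr (1 / (\<gamma> - 1))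
              * uc powr (1 / (\<gamma> - 1)) * \<epsilon>\<^sub>0 \<longrightarrow>
       (\<exists>R m p. tov_prolongation c G \<Lambda> Pf \<rho>c R m p) \<and>
       (\<forall>R m p. tov_prolongation c G \<Lambda> Pf \<rho>c R m p \<longrightarrow> monotone_short c G \<Lambda> R m p))"
proof -
  define n where "n = 1 / (\<gamma> - 1)"
  obtain \<Omega>' x\<^sub>0 L\<^sub>0 where E: "eos \<gamma> n \<Omega> \<Omega>' x\<^sub>0 L\<^sub>0"
    unfolding n_def by (rule eos_exists[OF assms(1,2,4,5,6)])
  interpret eos \<gamma> n \<Omega> \<Omega>' x\<^sub>0 L\<^sub>0 by (rule E)
  obtain \<epsilon> X where \<epsilon>: "0 < \<epsilon>" and
    prof: "\<forall>xc \<beta>. 0 < xc \<and> xc \<le> \<epsilon> \<and> 0 \<le> \<beta> \<and> \<beta> \<le> \<epsilon> \<longrightarrow>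
      (\<exists>\<theta> z L. profile \<gamma> n \<Omega> \<Omega>' x\<^sub>0 L\<^sub>0 xc \<beta> X \<theta> z L)"
    using profile_exists by blast
  \<comment> \<open>The entry \<open>x\<^sub>0\<close> / 2 lies below the threshold (n + 1) *
    \<open>x\<^sub>0\<close> / 2 of \<open>central_potential_bounds\<close>; dividing by 2 powr n
    absorbs the loss in \<open>cosmological_bound\<close>.\<close>
  define \<epsilon>\<^sub>0 where "\<epsilon>\<^sub>0 = min (min 1 (x\<^sub>0 / 2)) (\<epsilon> / 2 powr n)"
  have "\<epsilon>\<^sub>0 \<le> min 1 (x\<^sub>0 / 2)" "\<epsilon>\<^sub>0 \<le> \<epsilon> / 2 powr n" unfolding \<epsilon>\<^sub>0_def
    by (rule min.cobounded1, rule min.cobounded2)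
  then have le: "\<epsilon>\<^sub>0 \<le> 1" "\<epsilon>\<^sub>0 \<le> x\<^sub>0 / 2" "\<epsilon>\<^sub>0 \<le> \<epsilon> / 2 powr n" unfolding min.bounded_iff by blast+
  have pos: "0 < \<epsilon>\<^sub>0" using \<epsilon> x0 by (simp add: \<epsilon>\<^sub>0_def)
  have le2: "2 powr n * \<epsilon>\<^sub>0 \<le> \<epsilon>" using le(3) by (simp add: pos_le_divide_eq mult.commute)
  have "(1 :: real) \<le> 2 powr n" using n_bounds by (simp add: ge_one_powr_ge_zero)
  then have "1 * \<epsilon>\<^sub>0 \<le> 2 powr n * \<epsilon>\<^sub>0" using pos by (intro mult_right_mono) auto
  then have le3: "\<epsilon>\<^sub>0 \<le> \<epsilon>" using le2 by simp
  have "1 * (x\<^sub>0 / 2) < (n + 1) * (x\<^sub>0 / 2)"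
    using n_bounds x0 by (intro mult_strict_right_mono) auto
  then have lt: "\<epsilon>\<^sub>0 < (n + 1) * x\<^sub>0 / 2" using le(2) by simp
  have main: "(\<exists>R m p. tov_prolongation c G \<Lambda> Pf \<rho>c R m p) \<and>
       (\<forall>R m p. tov_prolongation c G \<Lambda> Pf \<rho>c R m p \<longrightarrow> monotone_short c G \<Lambda> R m p)"
    if h: "0 < c" "0 < G" "0 < A" "0 < \<Lambda>" "0 < \<rho>c" "Pf = gas_pressure c A \<gamma> \<Omega>" "admissible_pressure c Pf"
      "uc = central_potential c Pf \<rho>c" "uc \<le> c\<^sup>2 * \<epsilon>\<^sub>0"
      "\<Lambda> \<le> 4 * pi / c\<^sup>2 * G * ((\<gamma> - 1) / (\<gamma> * A)) powr (1 / (\<gamma> - 1))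
              * uc powr (1 / (\<gamma> - 1)) * \<epsilon>\<^sub>0"
    for c G A \<Lambda> \<rho>c Pf uc
  proof -
    interpret gas \<gamma> n \<Omega> \<Omega>' x\<^sub>0 L\<^sub>0 c A
      by unfold_locales (fact h(1), fact h(3), fact h(7)[unfolded h(6)])
    have small: "central_potential c (gas_pressure c A \<gamma> \<Omega>) \<rho>c \<le> c\<^sup>2 * \<epsilon>\<^sub>0" using h by simp
    note u = central_potential_bounds[OF h(5) small lt]
    define \<beta> where "\<beta> = c\<^sup>2 * \<Lambda> / (4 * pi * G * \<rho>c)"
    have "\<beta> \<le> 2 powr n * \<epsilon>\<^sub>0" unfolding \<beta>_def
      by (rule cosmological_bound[OF h(5) h(2) pos u(2,3)]) (fact h(10)[unfolded h(8) h(6)])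
    then have "\<beta> \<le> \<epsilon>" using le2 by simp
    moreover have "0 \<le> \<beta>" unfolding \<beta>_def using h(2,4,5) by simp
    ultimately have \<beta>: "0 \<le> \<beta>" "\<beta> \<le> \<epsilon>" by simp_all
    obtain \<theta> z L where P: "profile \<gamma> n \<Omega> \<Omega>' x\<^sub>0 L\<^sub>0 (x_of \<rho>c) \<beta> X \<theta> z L"
      using prof x_of_pos[OF h(5)] order_trans[OF u(1) le3] \<beta> by blast
    interpret profile \<gamma> n \<Omega> \<Omega>' x\<^sub>0 L\<^sub>0 "x_of \<rho>c" \<beta> X \<theta> z L by (rule P)
    interpret star \<gamma> n \<Omega> \<Omega>' x\<^sub>0 L\<^sub>0 c A "x_of \<rho>c" \<beta> X \<theta> z L G \<Lambda> \<rho>c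
      by unfold_locales (fact h(2) h(4) h(5) refl \<beta>_def)+
    show ?thesis using prolongation prolongation_monotone_short unfolding h(6) by blast
  qed
  show ?thesis
    by (rule exI[of _ \<epsilon>\<^sub>0], rule conjI[OF pos], rule conjI[OF le(1)], intro allI impI, elim conjE)
      (rule main; assumption)
qed

end
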